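(* Suppose Assumption A1 holds, and let $\mathbf z^*\in\mathbb R^N$ be any optimal solution of the dual problem (D). Let $s\in[1,\infty)$. Then the map $$\mathbb R^{2N}\ni(\mathbf z_1,\mathbf z_2)\mapsto \delta_s(\mathbf z_1,\mathbf z_2):=\|\mathbf T_{\mathbf z_1}-\mathbf T_{\mathbf z_2}\|_{L^s(R)}^s=\int\|\mathbf T_{\mathbf z_1}(\mathbf y)-\mathbf T_{\mathbf z_2}(\mathbf y)\|^s\,dR(\mathbf y)$$ is Hadamard directionally differentiable at $(\mathbf z^*,\mathbf z^* )$, with derivative $$[\delta_s]'_{(\mathbf z^*,\mathbf z^* )}(\mathbf h_1,\mathbf h_2)=\sum_{1\le i<j\le N}\|\mathbf x_i-\mathbf x_j\|^{s-1}\,R^+(D_{ij})\,|h_{2,j}-h_{2,i}-h_{1,j}+h_{1,i}|$$ for $\mathbf h_\ell=(h_{\ell,1},\dots,h_{\ell,N})^\top\in\mathbb R^N$, $\ell=1,2$.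
   Context: Setting: $R$ is a Borel probability measure on $\mathbb R^d$ and $P$ is a probability measure on $\mathbb R^d$ with finite support $\{\mathbf x_1,\dots,\mathbf x_N\}$ (distinct points) and weights $p_i=P(\{\mathbf x_i\})>0$. Assumption A1: $R$ is compactly supported and absolutely continuous with Lebesgue density $\rho$ that is continuous on a compact convex set $\mathcal Y$ containing the support of $R$ ($\rho=0$ off $\mathcal Y$); moreover $\mathcal Y$ is either polyhedral or satisfies $\mathcal H^{d-1}(\partial\mathcal Y\cap H)=0$ for every hyperplane $H\subset\mathbb R^d$ ($\mathcal H^r$ denotes $r$-dimensional Hausdorff measure). Dual problem (D): maximize over $\mathbf z\in\mathbb R^N$ the function $\langle\mathbf z,\mathbf p\rangle+\int\min_{1\le i\le N}\big(\tfrac12\|\mathbf y-\mathbf x_i\|^2-z_i\big)\,dR(\mathbf y)$, $\mathbf p=(p_1,\dots,p_N)^\top$. For $\mathbf z\in\mathbb R^N$ let $b_{ij}(\mathbf z)=(\|\mathbf x_i\|^2-\|\mathbf x_j\|^2)/2-z_i+z_j$ and define the Laguerre cells $C_i(\mathbf z)=\bigcap_{j\neq i}\{\mathbf y:\langle\mathbf x_i-\mathbf x_j,\mathbf y\rangle\ge b_{ij}(\mathbf z)\}$. Let $\mathbf T_{\mathbf z}(\mathbf y)=\operatorname{argmin}_{\mathbf x_i}\big(\tfrac12\|\mathbf y-\mathbf x_i\|^2-z_i\big)$, defined $R$-a.e. (it equals $\mathbf x_i$ on the interior of $C_i(\mathbf z)$). Write $b_{ij}=b_{ij}(\mathbf z^*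 )$, $C_i=C_i(\mathbf z^* )$, and $D_{ij}=C_i\cap C_j$. For a subset $D$ of a hyperplane, $R^+(D)=\int_D\rho\,d\mathcal H^{d-1}$. A map $\phi:\Theta\to\mathbb R$ ($\Theta$ open in a normed space) is Hadamard directionally differentiable at $\theta$ with derivative $\phi'_\theta$ if $(\phi(\theta_n)-\phi(\theta))/t_n\to\phi'_\theta(h)$ for every $t_n\downarrow0$ and every $\theta_n\in\Theta$ with $t_n^{-1}(\theta_n-\theta)\to h$. *)

theory Defs
  imports "HOL-Probability.Probability"
begin

section \<open>Hausdorff measure (integer dimension m), normalised so that H^m = Lebesgue measure on m-dim affine subspaces\<close>

definition hausdorff_const :: "nat \<Rightarrow> real" where
  "hausdorff_const m = unit_ball_vol (real m) / 2 ^ m"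

text \<open>Contribution of a covering set: c_m * diam(C)^m, with the convention diam({})^m = 0
  (so that for m = 0 one obtains counting measure).\<close>
definition hausdorff_term :: "nat \<Rightarrow> 'a::metric_space set \<Rightarrow> ennreal" where
  "hausdorff_term m C = (if C = {} then 0 else ennreal (hausdorff_const m * diameter C ^ m))"

definition hausdorff_pre :: "nat \<Rightarrow> real \<Rightarrow> 'a::metric_space set \<Rightarrow> ennreal" where
  "hausdorff_pre m \<delta> A =
     (INF C \<in> {C :: nat \<Rightarrow> 'a set. A \<subseteq> (\<Union>i. C i) \<and> (\<forall>i. bounded (C i) \<and> diameter (C i) \<le> \<delta>)}.
        (\<Sum>i. hausdorff_term m (C i)))"

definition hausdorff_outer :: "nat \<Rightarrow> 'a::metric_space set \<Rightarrow> ennreal" where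
  "hausdorff_outer m A = (SUP \<delta> \<in> {0<..}. hausdorff_pre m \<delta> A)"

definition hausdorff_measure :: "nat \<Rightarrow> 'a::metric_space measure" where
  "hausdorff_measure m = measure_of UNIV (sets borel) (hausdorff_outer m)"

definition hadamard_dir_diff ::
  "('a::real_normed_vector \<Rightarrow> real) \<Rightarrow> 'a set \<Rightarrow> 'a \<Rightarrow> ('a \<Rightarrow> real) \<Rightarrow> bool" where
  "hadamard_dir_diff \<phi> \<Theta> \<theta> \<phi>' \<longleftrightarrow>
     (\<forall>(t :: nat \<Rightarrow> real) (\<theta>s :: nat \<Rightarrow> 'a) h.
        (\<forall>n. t n > 0) \<and> t \<longlonglongrightarrow> 0 \<and> (\<forall>n. \<theta>s n \<in> \<Theta>) \<and>
        (\<lambda>n. (1 / t n) *\<^sub>R (\<theta>s n - \<theta>)) \<longlonglongrightarrow> h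
        \<longrightarrow> (\<lambda>n. (\<phi> (\<theta>s n) - \<phi> \<theta>) / t n) \<longlonglongrightarrow> \<phi>' h)"

definition dual_obj :: "'a::euclidean_space measure \<Rightarrow> ('n::finite \<Rightarrow> 'a) \<Rightarrow> ('n \<Rightarrow> real) \<Rightarrow> real^'n \<Rightarrow> real" where
  "dual_obj R x p z = (\<Sum>i\<in>UNIV. z $ i * p i)
     + integral\<^sup>L R (\<lambda>y. Min (range (\<lambda>i. (1/2) * norm (y - x i) ^ 2 - z $ i)))"

text \<open>The map T_z (a fixed measurable version of the R-a.e. defined argmin map).\<close>
definition Tmap :: "('n::finite \<Rightarrow> 'a::real_normed_vector) \<Rightarrow> real^'n \<Rightarrow> 'a \<Rightarrow> 'a" where
  "Tmap x z y = x (SOME i. \<forall>j. (1/2) * norm (y - x i) ^ 2 - z $ i \<le> (1/2) * norm (y - x j) ^ 2 - z $ j)"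

definition delta_s :: "'a::euclidean_space measure \<Rightarrow> ('n::finite \<Rightarrow> 'a) \<Rightarrow> real \<Rightarrow> (real^'n) \<times> (real^'n) \<Rightarrow> real" where
  "delta_s R x s zz = integral\<^sup>L R (\<lambda>y. norm (Tmap x (fst zz) y - Tmap x (snd zz) y) powr s)"

definition bij_coef :: "('n::finite \<Rightarrow> 'a::real_inner) \<Rightarrow> real^'n \<Rightarrow> 'n \<Rightarrow> 'n \<Rightarrow> real" where
  "bij_coef x z i j = (norm (x i) ^ 2 - norm (x j) ^ 2) / 2 - z $ i + z $ j"

definition laguerre_cell :: "('n::finite \<Rightarrow> 'a::real_inner) \<Rightarrow> real^'n \<Rightarrow> 'n \<Rightarrow> 'a set" where
  "laguerre_cell x z i = (\<Inter>j\<in>UNIV - {i}. {y. inner (x i - x j) y \<ge> bij_coef x z i j})"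

definition R_plus :: "('a::euclidean_space \<Rightarrow> real) \<Rightarrow> 'a set \<Rightarrow> real" where
  "R_plus \<rho> D = (LINT y:D|hausdorff_measure (DIM('a) - 1). \<rho> y)"

definition assumption_A1 :: "'a::euclidean_space measure \<Rightarrow> ('a \<Rightarrow> real) \<Rightarrow> 'a set \<Rightarrow> bool" where
  "assumption_A1 R \<rho> Y \<longleftrightarrow>
     prob_space R \<and> R = density lborel (\<lambda>y. ennreal (\<rho> y)) \<and> (\<forall>y. \<rho> y \<ge> 0) \<and>
     compact Y \<and> convex Y \<and> continuous_on Y \<rho> \<and> (\<forall>y. y \<notin> Y \<longrightarrow> \<rho> y = 0) \<and>
     (polyhedron Y \<or>
      (\<forall>a b. a \<noteq> 0 \<longrightarrow> hausdorff_outer (DIM('a) - 1) (frontier Y \<inter> {y. inner a y = b}) = 0))"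

end

theory Submission
  imports Defs
begin

text \<open>
  On a hyperplane orthogonal to the unit vector \<open>u\<close>, Hausdorff measure is Lebesgue measure, in the
  form \<open>\<H>\<^sup>d\<^sup>-\<^sup>1(A) = \<lambda>{y. 0 \<le> \<langle>y,u\<rangle> \<le> 1 \<and> y - \<langle>y,u\<rangle>u + cu \<in> A}\<close>: \<open>\<ge>\<close> is the isodiametric inequality,
  obtained by Steiner symmetrisation; \<open>\<le>\<close> follows by packing balls into dyadic cubes.

  Up to ties, which are null, \<open>\<delta>\<^sub>s(z\<^sub>1,z\<^sub>2)\<close> is the sum of \<open>\<parallel>x\<^sub>i - x\<^sub>j\<parallel>\<^sup>s R(C\<^sub>i(z\<^sub>1) \<inter> C\<^sub>j(z\<^sub>2))\<close>. For \<open>z\<^sub>1\<close>, \<open>z\<^sub>2\<close>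
  within \<open>O(t)\<close> of \<open>z\<^sup>*\<close> this overlap lies in a slab of thickness \<open>O(t)\<close> around the hyperplane carrying \<open>D\<^sub>i\<^sub>j\<close>.
  Rescaling the normal coordinate by \<open>t\<close>, dominated convergence gives \<open>R\<^sup>+(D\<^sub>i\<^sub>j)\<close> times the limiting
  thickness, provided almost no point of the hyperplane lies on \<open>\<partial>Y\<close> or on a third cell interface.
  This is where optimality enters: it gives \<open>R(C\<^sub>i) \<ge> p\<^sub>i > 0\<close>, whereas a facet of \<open>Y\<close> or a
  third interface contained in the same hyperplane would squeeze some cell into that hyperplane.
\<close>

subsection \<open>Hausdorff measure\<close>

text \<open>The constant in the derivative must come out exactly, so Hausdorff and Lebesgue measure
  on a hyperplane have to agree with factor 1, not merely be comparable. Moreover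
  \<open>measure_of\<close> yields the intended values only for a genuine measure on the Borel sets,
  so Caratheodory's criterion precedes every use of \<open>R_plus\<close>.

  The limiting thickness arises as follows. Write the height along the unit normal as
  \<open>c + t * s\<close>. Lying in cell \<open>i\<close> for the first vector bounds
  \<open>s\<close> below by about \<open>(h1 $ j - h1 $ i) / L\<close>, lying in cell
  \<open>j\<close> for the second bounds it above by about \<open>(h2 $ j - h2 $ i) / L\<close>,
  where \<open>L\<close> is the distance of \<open>x i\<close> and \<open>x j\<close>. The interval
  has as length the positive part of a quantity that changes sign when \<open>i\<close> and
  \<open>j\<close> are exchanged; the two ordered pairs together give its absolute value, and the
  division by \<open>L\<close> lowers the exponent from \<open>s\<close> to \<open>s - 1\<close>.

  Only parallel objects can obstruct the limit: a facet of \<open>Y\<close> or a third interface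
  transversal to the hyperplane meets it in a null set. The dangerous cases are a parallel facet and
  three collinear points.\<close>

lemma hausdorff_pre_mono:
  "A \<subseteq> B \<Longrightarrow> hausdorff_pre m \<delta> A \<le> hausdorff_pre m \<delta> B"
  unfolding hausdorff_pre_def by (intro INF_superset_mono) auto

lemma hausdorff_pre_antimono:
  "\<delta> \<le> \<delta>' \<Longrightarrow> hausdorff_pre m \<delta>' A \<le> hausdorff_pre m \<delta> A"
  unfolding hausdorff_pre_def by (intro INF_superset_mono) (auto intro: order_trans)

lemma hausdorff_pre_le_suminf:
  assumes "A \<subseteq> (\<Union>i. C i)" "\<And>i. bounded (C i)" "\<And>i. diameter (C i) \<le> \<delta>"
  shows "hausdorff_pre m \<delta> A \<le> (\<Sum>i. hausdorff_term m (C i))"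
  unfolding hausdorff_pre_def using assms by (intro INF_lower) auto

lemma hausdorff_pre_le_term:
  assumes "bounded A" "diameter A \<le> \<delta>" "0 \<le> \<delta>"
  shows "hausdorff_pre m \<delta> A \<le> hausdorff_term m A"
proof -
  have "hausdorff_pre m \<delta> A \<le> (\<Sum>i. hausdorff_term m ((\<lambda>i::nat. if i = 0 then A else {}) i))"
    by (rule hausdorff_pre_le_suminf) (use assms in \<open>auto split: if_splits\<close>)
  also have "\<dots> = hausdorff_term m A"
    by (subst suminf_finite[of "{0}"]) (auto simp: hausdorff_term_def)
  finally show ?thesis .
qed

lemma hausdorff_pre_empty: "0 \<le> \<delta> \<Longrightarrow> hausdorff_pre m \<delta> {} = 0"
  using hausdorff_pre_le_term[of "{}" \<delta> m] by (simp add: hausdorff_term_def)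

lemma hausdorff_pre_countably_subadditive:
  fixes A :: "nat \<Rightarrow> 'a::metric_space set"
  shows "hausdorff_pre m \<delta> (\<Union>n. A n) \<le> (\<Sum>n. hausdorff_pre m \<delta> (A n))"
proof (rule ennreal_le_epsilon)
  fix e :: real assume e: "0 < e" and fin: "(\<Sum>n. hausdorff_pre m \<delta> (A n)) < top"
  \<comment> \<open>The slacks \<open>e * (1/2) ^ Suc n\<close> add up to \<open>e\<close>.
    Finiteness of the sum makes each \<open>hausdorff_pre\<close> finite, so adding a positive slack
    gives a strict inequality and some cover falls below it.\<close>
  have ex: "\<exists>C. A n \<subseteq> (\<Union>i. C i) \<and> (\<forall>i. bounded (C i) \<and> diameter (C i) \<le> \<delta>) \<and>
      (\<Sum>i. hausdorff_term m (C i)) \<le> hausdorff_pre m \<delta> (A n) + ennreal (e * (1/2) ^ Suc n)" for n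
  proof -
    have "hausdorff_pre m \<delta> (A n) < top"
      using fin ennreal_suminf_lessD by blast
    then have "hausdorff_pre m \<delta> (A n) < hausdorff_pre m \<delta> (A n) + ennreal (e * (1/2) ^ Suc n)"
      using e by (simp add: ennreal_add_left_cancel_less ennreal_less_zero_iff)
    then have "(INF C \<in> {C :: nat \<Rightarrow> 'a set. A n \<subseteq> (\<Union>i. C i) \<and>
         (\<forall>i. bounded (C i) \<and> diameter (C i) \<le> \<delta>)}. (\<Sum>i. hausdorff_term m (C i)))
        < hausdorff_pre m \<delta> (A n) + ennreal (e * (1/2) ^ Suc n)"
      unfolding hausdorff_pre_def .
    then show ?thesis
      unfolding INF_less_iff by (auto intro: less_imp_le)
  qed
  then obtain C where C: "\<And>n. A n \<subseteq> (\<Union>i. C n i)" "\<And>n i. bounded (C n i)" "\<And>n i. diameter (C n i) \<le> \<delta>"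
    "\<And>n. (\<Sum>i. hausdorff_term m (C n i)) \<le> hausdorff_pre m \<delta> (A n) + ennreal (e * (1/2) ^ Suc n)"
    by metis
  have "hausdorff_pre m \<delta> (\<Union>n. A n) \<le> (\<Sum>k. hausdorff_term m (case_prod C (prod_decode k)))"
  proof (rule hausdorff_pre_le_suminf)
    show "(\<Union>n. A n) \<subseteq> (\<Union>k. case_prod C (prod_decode k))"
    proof
      fix x assume "x \<in> (\<Union>n. A n)"
      then obtain n i where "x \<in> C n i" using C(1) by blast
      then have "x \<in> case_prod C (prod_decode (prod_encode (n, i)))" by simp
      then show "x \<in> (\<Union>k. case_prod C (prod_decode k))" by (rule UN_I[OF UNIV_I])
    qed
  qed (auto split: prod.split simp: C)
  also have "\<dots> = (\<Sum>n. \<Sum>i. hausdorff_term m (C n i))"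
    by (rule suminf_ennreal_2dimen[of _ "\<lambda>p. hausdorff_term m (case_prod C p)", simplified]) simp
  also have "\<dots> \<le> (\<Sum>n. hausdorff_pre m \<delta> (A n) + ennreal (e * (1/2) ^ Suc n))"
    by (intro suminf_le C) auto
  also have "\<dots> = (\<Sum>n. hausdorff_pre m \<delta> (A n)) + (\<Sum>n. ennreal e * ennreal ((1/2) ^ Suc n))"
    using e by (subst suminf_add[symmetric])
      (auto simp del: ennreal_suminf_cmult simp add: ennreal_mult[symmetric])
  also have "\<dots> = (\<Sum>n. hausdorff_pre m \<delta> (A n)) + e"
    unfolding ennreal_suminf_cmult
    by (subst suminf_ennreal_eq[OF zero_le_power power_half_series]) auto
  finally show "hausdorff_pre m \<delta> (\<Union>n. A n) \<le> (\<Sum>n. hausdorff_pre m \<delta> (A n)) + ennreal e" .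
qed

lemma hausdorff_pre_le_outer: "0 < \<delta> \<Longrightarrow> hausdorff_pre m \<delta> A \<le> hausdorff_outer m A"
  unfolding hausdorff_outer_def by (intro SUP_upper) auto

lemma hausdorff_outer_least:
  "(\<And>\<delta>. 0 < \<delta> \<Longrightarrow> hausdorff_pre m \<delta> A \<le> c) \<Longrightarrow> hausdorff_outer m A \<le> c"
  unfolding hausdorff_outer_def by (intro SUP_least) auto

lemma hausdorff_outer_mono: "A \<subseteq> B \<Longrightarrow> hausdorff_outer m A \<le> hausdorff_outer m B"
  by (meson hausdorff_outer_least hausdorff_pre_mono hausdorff_pre_le_outer order_trans)

lemma hausdorff_outer_empty [simp]: "hausdorff_outer m ({} :: 'a::metric_space set) = 0"
proof -
  have "hausdorff_outer m ({} :: 'a set) \<le> 0"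
    by (rule hausdorff_outer_least) (simp add: hausdorff_pre_empty)
  then show ?thesis by simp
qed

lemma hausdorff_outer_countably_subadditive:
  "hausdorff_outer m (\<Union>n. A n) \<le> (\<Sum>n. hausdorff_outer m (A n))"
proof (rule hausdorff_outer_least)
  fix \<delta> :: real assume "0 < \<delta>"
  then have "(\<Sum>n. hausdorff_pre m \<delta> (A n)) \<le> (\<Sum>n. hausdorff_outer m (A n))"
    by (intro suminf_le hausdorff_pre_le_outer) auto
  then show "hausdorff_pre m \<delta> (\<Union>n. A n) \<le> (\<Sum>n. hausdorff_outer m (A n))"
    using hausdorff_pre_countably_subadditive order_trans by blast
qed

lemma hausdorff_outer_measure_space: "outer_measure_space (Pow UNIV) (hausdorff_outer m)"
  unfolding outer_measure_space_def
  by (auto simp: positive_def increasing_def countably_subadditive_def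
      intro: hausdorff_outer_mono hausdorff_outer_countably_subadditive)

lemma hausdorff_outer_subadditive:
  "hausdorff_outer m (A \<union> B) \<le> hausdorff_outer m A + hausdorff_outer m B"
proof -
  let ?C = "\<lambda>n::nat. if n = 0 then A else if n = 1 then B else {}"
  have "A \<union> B = (\<Union>n. ?C n)" by (auto split: if_splits)
  then have "hausdorff_outer m (A \<union> B) \<le> (\<Sum>n. hausdorff_outer m (?C n))"
    using hausdorff_outer_countably_subadditive[of m ?C] by simp
  also have "\<dots> = hausdorff_outer m A + hausdorff_outer m B"
    by (subst suminf_finite[of "{0,1}"]) auto
  finally show ?thesis .
qed

section \<open>Additivity on separated sets and Caratheodory's criterion\<close>

text \<open>A covering set of diameter at most \<open>\<delta>\<close> is too small to meet both
  \<open>A\<close> and \<open>B\<close>, so each cover of the union splits into two covers that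
  share no cost. Discarded sets become empty and are free, even for \<open>m = 0\<close>, by the
  convention in \<open>hausdorff_term\<close>.\<close>

lemma hausdorff_pre_separated:
  fixes A B :: "'a::metric_space set"
  assumes sep: "\<And>a b. a \<in> A \<Longrightarrow> b \<in> B \<Longrightarrow> \<delta> < dist a b" and "0 \<le> \<delta>"
  shows "hausdorff_pre m \<delta> A + hausdorff_pre m \<delta> B \<le> hausdorff_pre m \<delta> (A \<union> B)"
proof -
  have "hausdorff_pre m \<delta> A + hausdorff_pre m \<delta> B \<le> (\<Sum>i. hausdorff_term m (C i))"
    if C: "A \<union> B \<subseteq> (\<Union>i. C i)" "\<forall>i. bounded (C i) \<and> diameter (C i) \<le> \<delta>" for C :: "nat \<Rightarrow> 'a set"
  proof -
    let ?CA = "\<lambda>i. if C i \<inter> A = {} then {} else C i"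
    let ?CB = "\<lambda>i. if C i \<inter> B = {} then {} else C i"
    have "hausdorff_pre m \<delta> A \<le> (\<Sum>i. hausdorff_term m (?CA i))"
      by (rule hausdorff_pre_le_suminf) (use C \<open>0 \<le> \<delta>\<close> in \<open>auto split: if_splits\<close>, fastforce)
    moreover have "hausdorff_pre m \<delta> B \<le> (\<Sum>i. hausdorff_term m (?CB i))"
      by (rule hausdorff_pre_le_suminf) (use C \<open>0 \<le> \<delta>\<close> in \<open>auto split: if_splits\<close>, fastforce)
    ultimately have "hausdorff_pre m \<delta> A + hausdorff_pre m \<delta> B
        \<le> (\<Sum>i. hausdorff_term m (?CA i)) + (\<Sum>i. hausdorff_term m (?CB i))"
      by (rule add_mono)
    also have "\<dots> = (\<Sum>i. hausdorff_term m (?CA i) + hausdorff_term m (?CB i))"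
      by (rule suminf_add) auto
    also have "\<dots> \<le> (\<Sum>i. hausdorff_term m (C i))"
    proof (intro suminf_le)
      fix i
      have "C i \<inter> A = {} \<or> C i \<inter> B = {}"
      proof (rule ccontr)
        assume "\<not> ?thesis"
        then obtain a b where ab: "a \<in> C i" "a \<in> A" "b \<in> C i" "b \<in> B" by blast
        then have "dist a b \<le> diameter (C i)" using C(2) diameter_bounded_bound by blast
        with sep[OF ab(2,4)] C(2) show False by (meson leD order_trans)
      qed
      then show "hausdorff_term m (?CA i) + hausdorff_term m (?CB i) \<le> hausdorff_term m (C i)"
        by (auto simp: hausdorff_term_def)
    qed auto
    finally show ?thesis .
  qed
  then show ?thesis
    unfolding hausdorff_pre_def[of m \<delta> "A \<union> B"] by (intro INF_greatest) auto
qed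

text \<open>The two suprema run over independent scales. Shrinking both to one scale below
  \<open>\<epsilon>\<close> only increases the values and makes the splitting of covers
  available.\<close>

lemma hausdorff_outer_separated:
  fixes A B :: "'a::metric_space set"
  assumes sep: "\<And>a b. a \<in> A \<Longrightarrow> b \<in> B \<Longrightarrow> \<epsilon> \<le> dist a b" and "0 < \<epsilon>"
  shows "hausdorff_outer m A + hausdorff_outer m B \<le> hausdorff_outer m (A \<union> B)"
proof -
  have *: "hausdorff_pre m \<delta>1 A + hausdorff_pre m \<delta>2 B \<le> hausdorff_outer m (A \<union> B)"
    if "0 < \<delta>1" "0 < \<delta>2" for \<delta>1 \<delta>2
  proof -
    define \<delta> where "\<delta> = min (min \<delta>1 \<delta>2) (\<epsilon>/2)"
    have \<delta>: "0 < \<delta>" "\<delta> \<le> \<delta>1" "\<delta> \<le> \<delta>2" "\<delta> < \<epsilon>"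
      using that \<open>0 < \<epsilon>\<close> by (auto simp: \<delta>_def)
    have "hausdorff_pre m \<delta>1 A + hausdorff_pre m \<delta>2 B \<le> hausdorff_pre m \<delta> A + hausdorff_pre m \<delta> B"
      by (intro add_mono hausdorff_pre_antimono \<delta>)
    also have "\<dots> \<le> hausdorff_pre m \<delta> (A \<union> B)"
      by (rule hausdorff_pre_separated) (use sep \<delta> in \<open>auto intro: less_le_trans\<close>)
    also have "\<dots> \<le> hausdorff_outer m (A \<union> B)"
      by (rule hausdorff_pre_le_outer) fact
    finally show ?thesis .
  qed
  have "hausdorff_outer m A + hausdorff_outer m B =
     (SUP \<delta>1\<in>{0<..}. SUP \<delta>2\<in>{0<..}. hausdorff_pre m \<delta>1 A + hausdorff_pre m \<delta>2 B)"
    unfolding hausdorff_outer_def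
    by (subst ennreal_SUP_add_left[symmetric], force, subst ennreal_SUP_add_right[symmetric]) auto
  also have "\<dots> \<le> hausdorff_outer m (A \<union> B)"
    by (intro SUP_least *) auto
  finally show ?thesis .
qed

lemma summable_tail_ennreal:
  fixes f :: "nat \<Rightarrow> ennreal"
  assumes "(\<Sum>k. f k) < top"
  shows "(\<lambda>n. \<Sum>k. f (k + n)) \<longlonglongrightarrow> 0"
proof -
  have fin: "f k \<noteq> top" for k using assms ennreal_suminf_lessD by (metis less_top)
  define g where "g k = enn2real (f k)" for k
  have fg: "f k = ennreal (g k)" and g0: "0 \<le> g k" for k
    using fin by (auto simp: g_def less_top)
  have s: "summable g"
    using assms g0 by (intro summable_suminf_not_top) (auto simp: fg)
  then have s': "summable (\<lambda>k. g (k + n))" for n by (simp add: summable_iff_shift)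
  have "(\<lambda>n. \<Sum>k. g (k + n)) \<longlonglongrightarrow> 0"
    using suminf_exist_split2[OF s] .
  then have "(\<lambda>n. ennreal (\<Sum>k. g (k + n))) \<longlonglongrightarrow> ennreal 0"
    by (intro tendsto_ennrealI)
  then show ?thesis
    using s' g0 by (simp add: fg suminf_ennreal2)
qed

text \<open>Caratheodory's criterion: the shells \<open>E (k+1) - E k\<close> at distance about \<open>1/k\<close> from the closed set
  are pairwise separated when their indices have the same parity, so their measures are summable.\<close>
lemma closed_in_lambda_system_hausdorff_outer:
  fixes F :: "'a::metric_space set"
  assumes "closed F"
  shows "F \<in> lambda_system UNIV (Pow UNIV) (hausdorff_outer m)"
proof (cases "F = {}")
  case True
  then show ?thesis by (auto simp: lambda_system_def)
next
  case F: False
  let ?H = "hausdorff_outer m :: 'a set \<Rightarrow> ennreal"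
  have "?H (X \<inter> F) + ?H (X - F) \<le> ?H X" for X
  proof (cases "?H X = top")
    case True
    then show ?thesis by simp
  next
    case False
    define E where "E n = {y\<in>X. 1 / real (Suc n) \<le> infdist y F}" for n
    define S where "S k = E (Suc k) - E k" for k
    have Ssub: "S k \<subseteq> X" for k by (auto simp: S_def E_def)
    have infd: "dist y z \<ge> infdist y F - infdist z F" for y z
      using infdist_triangle[of y F z] by simp
    have par: "(\<Sum>k<n. ?H (S (2*k+r))) \<le> ?H (\<Union>k<n. S (2*k+r))" for n r
    proof (induction n)
      case (Suc n)
      have "(\<Sum>k<Suc n. ?H (S (2*k+r))) \<le> ?H (\<Union>k<n. S (2*k+r)) + ?H (S (2*n+r))"
        using Suc by (simp add: add_right_mono)
      also have "\<dots> \<le> ?H ((\<Union>k<n. S (2*k+r)) \<union> S (2*n+r))"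
      proof (rule hausdorff_outer_separated)
        fix a b assume "a \<in> (\<Union>k<n. S (2*k+r))" and b: "b \<in> S (2*n+r)"
        then obtain k where k: "k < n" "a \<in> S (2*k+r)" by blast
        \<comment> \<open>Skipping one shell leaves a gap: \<open>k < n\<close> gives
          \<open>2*k+r+2 \<le> 2*n+r\<close>, so \<open>a\<close> has distance at least
          \<open>1 / (2*n+r)\<close> from \<open>F\<close>, while \<open>b\<close> is closer than
          \<open>1 / (2*n+r+1)\<close>.\<close>
        have "1 / real (2*n+r) \<le> 1 / real (Suc (Suc (2*k+r)))"
          using k by (intro divide_left_mono) auto
        also have "\<dots> \<le> infdist a F" using k by (auto simp: S_def E_def)
        finally have "1 / real (2*n+r) \<le> infdist a F" .
        moreover have "infdist b F < 1 / real (Suc (2*n+r))"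
          using b by (auto simp: S_def E_def)
        \<comment> \<open>For \<open>n = 0\<close> the union is empty and any positive gap will do;
          with \<open>r = 0\<close> the general formula would contain \<open>1 / real 0 = 0\<close>
          and turn negative.\<close>
        ultimately show "(if n = 0 then 1 else 1 / real (2*n+r) - 1 / real (Suc (2*n+r))) \<le> dist a b"
          using infd[of a b] k by auto
      next
        show "0 < (if n = 0 then 1 else 1 / real (2*n+r) - 1 / real (Suc (2*n+r)))"
          by (auto intro!: divide_strict_left_mono mult_pos_pos add_pos_nonneg)
      qed
      also have "(\<Union>k<n. S (2*k+r)) \<union> S (2*n+r) = (\<Union>k<Suc n. S (2*k+r))"
        by (auto simp: less_Suc_eq)
      finally show ?case .
    qed simp
    have par': "(\<Sum>k<n. ?H (S (2*k+r))) \<le> ?H X" for n r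
      using par[where n=n and r=r] hausdorff_outer_mono[of "\<Union>k<n. S (2*k+r)" X m] Ssub
      by (meson UN_least order_trans)
    have "(\<Sum>k<n. ?H (S k)) \<le> ?H X + ?H X" for n
    proof -
      have "(\<Sum>k<n. ?H (S k)) \<le> (\<Sum>k<2*n. ?H (S k))"
        by (intro sum_mono2) auto
      also have "\<dots> = (\<Sum>k<n. ?H (S (2*k+0))) + (\<Sum>k<n. ?H (S (2*k+1)))"
        by (induction n) (auto simp: algebra_simps)
      also have "\<dots> \<le> ?H X + ?H X"
        by (intro add_mono par')
      finally show ?thesis .
    qed
    then have "(\<Sum>k. ?H (S k)) \<le> ?H X + ?H X"
      by (intro suminf_le_const) auto
    also have "\<dots> < top" using False by (simp add: less_top)
    finally have tail: "(\<lambda>n. \<Sum>k. ?H (S (k + n))) \<longlonglongrightarrow> 0"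
      by (rule summable_tail_ennreal)
    have "?H (X \<inter> F) + ?H (X - F) \<le> ?H X + (\<Sum>k. ?H (S (k + n)))" for n
    proof -
      \<comment> \<open>A point outside the closed set \<open>F\<close> has positive distance from
        it, so there is a least \<open>K\<close> with the point in \<open>E K\<close>; if
        \<open>K > n\<close>, the point lies in the shell with index \<open>K - 1\<close>.\<close>
      have "X - F \<subseteq> E n \<union> (\<Union>k. S (k + n))"
      proof
        fix y assume y: "y \<in> X - F"
        then have "infdist y F > 0"
          using F assms by (metis DiffD2 in_closed_iff_infdist_zero infdist_nonneg less_eq_real_def)
        then obtain N where N: "1 / real (Suc N) < infdist y F"
          using nat_approx_posE by metis
        define K where "K = (LEAST N. y \<in> E N)"
        have "y \<in> E N" using y N by (auto simp: E_def)
        then have K: "y \<in> E K" unfolding K_def by (rule LeastI)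
        have mono: "E k \<subseteq> E l" if "k \<le> l" for k l
        proof -
          have "1 / real (Suc l) \<le> 1 / real (Suc k)" using that by (intro divide_left_mono) auto
          then show ?thesis by (auto simp: E_def)
        qed
        show "y \<in> E n \<union> (\<Union>k. S (k + n))"
        proof (cases "K \<le> n")
          case True
          then show ?thesis using K mono by blast
        next
          case False
          then obtain j where j: "K = Suc (j + n)"
            by (metis add.commute less_imp_Suc_add not_le)
          then have "y \<notin> E (j + n)" unfolding K_def using not_less_Least
            by (metis K_def j lessI)
          then show ?thesis using K j by (auto simp: S_def)
        qed
      qed
      then have "?H (X - F) \<le> ?H (E n) + ?H (\<Union>k. S (k + n))"
        by (meson hausdorff_outer_mono hausdorff_outer_subadditive order_trans)
      also have "\<dots> \<le> ?H (E n) + (\<Sum>k. ?H (S (k + n)))"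
        by (intro add_left_mono hausdorff_outer_countably_subadditive)
      finally have "?H (X \<inter> F) + ?H (X - F) \<le> ?H (X \<inter> F) + ?H (E n) + (\<Sum>k. ?H (S (k + n)))"
        by (simp add: add.assoc add_left_mono)
      also have "?H (X \<inter> F) + ?H (E n) \<le> ?H ((X \<inter> F) \<union> E n)"
      proof (rule hausdorff_outer_separated)
        fix a b assume "a \<in> X \<inter> F" "b \<in> E n"
        then show "1 / real (Suc n) \<le> dist a b"
          using infdist_le[of a F b] by (auto simp: E_def dist_commute)
      qed simp
      also have "\<dots> \<le> ?H X"
        by (intro hausdorff_outer_mono) (auto simp: E_def)
      finally show ?thesis by (simp add: add_right_mono)
    qed
    moreover have "(\<lambda>n. ?H X + (\<Sum>k. ?H (S (k + n)))) \<longlonglongrightarrow> ?H X + 0"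
      by (intro tendsto_add tendsto_const tail)
    ultimately show ?thesis
      by (metis (no_types, lifting) LIMSEQ_le_const add.right_neutral)
  qed
  moreover have "?H X \<le> ?H (X \<inter> F) + ?H (X - F)" for X
    using hausdorff_outer_subadditive[of m "X \<inter> F" "X - F"]
    by (metis Int_Diff_Un)
  ultimately have "?H (X \<inter> F) + ?H (X - F) = ?H X" for X
    by (simp add: antisym)
  then show ?thesis
    by (auto simp: lambda_system_def Int_commute Diff_eq)
qed

text \<open>\<open>measure_of\<close> falls back to the zero measure when its set function is not a
  measure, so the definition gains its content here: the sets satisfying Caratheodory's condition
  form a sigma-algebra that contains the closed sets, hence all Borel sets.\<close>

lemma emeasure_hausdorff_measure:
  fixes A :: "'a::metric_space set"
  assumes "A \<in> sets borel"
  shows "emeasure (hausdorff_measure m) A = hausdorff_outer m A"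
proof -
  let ?L = "lambda_system UNIV (Pow UNIV) (hausdorff_outer m :: 'a set \<Rightarrow> ennreal)"
  interpret sigma_algebra UNIV "Pow UNIV :: 'a set set" by (rule sigma_algebra_Pow)
  have L: "measure_space UNIV ?L (hausdorff_outer m)"
    by (rule caratheodory_lemma) (rule hausdorff_outer_measure_space)
  then interpret L: sigma_algebra UNIV ?L by (simp add: measure_space_def)
  have "sets (borel :: 'a measure) \<subseteq> ?L"
    unfolding borel_eq_closed
    by (subst sets_measure_of)
       (use closed_in_lambda_system_hausdorff_outer in \<open>blast intro!: L.sigma_sets_subset\<close>)+
  then have "measure_space UNIV (sets borel) (hausdorff_outer m :: 'a set \<Rightarrow> ennreal)"
    using measure_down[OF L _ ] sets.sigma_algebra_axioms[of borel] by (metis space_borel)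
  then show ?thesis
    unfolding hausdorff_measure_def
    using emeasure_measure_of_sigma[of UNIV "sets (borel :: 'a measure)" "hausdorff_outer m" A] assms
    by (auto simp: measure_space_def)
qed

lemma sets_hausdorff_measure [simp, measurable_cong]:
  "sets (hausdorff_measure m :: 'a::metric_space measure) = sets borel"
  unfolding hausdorff_measure_def
  using sets.sigma_sets_eq[of "borel :: 'a measure"] by (simp add: sets_measure_of_conv)

lemma space_hausdorff_measure [simp]: "space (hausdorff_measure m :: 'a::metric_space measure) = UNIV"
  using sets_eq_imp_space_eq[OF sets_hausdorff_measure] by simp

lemma hausdorff_outer_isometry_le:
  fixes f :: "'a::metric_space \<Rightarrow> 'b::metric_space"
  assumes iso: "\<And>x y. dist (f x) (f y) = dist x y"
  shows "hausdorff_outer m (f ` A) \<le> hausdorff_outer m A"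
proof (rule hausdorff_outer_least)
  fix \<delta> :: real assume \<delta>: "0 < \<delta>"
  have "hausdorff_pre m \<delta> (f ` A) \<le> (\<Sum>i. hausdorff_term m (C i))"
    if C: "A \<subseteq> (\<Union>i. C i)" "\<forall>i. bounded (C i) \<and> diameter (C i) \<le> \<delta>" for C :: "nat \<Rightarrow> 'a set"
  proof -
    \<comment> \<open>Boundedness is tested at the centre \<open>undefined\<close> and at its image,
      between which the isometry translates directly.\<close>
    have bd: "bounded (f ` C i)" for i
      using C(2)[rule_format, of i] unfolding bounded_any_center[where a="f undefined"] bounded_any_center[where a=undefined]
      by (auto simp: iso)
    have diam: "diameter (f ` C i) = diameter (C i)" for i
    proof -
      have "(\<lambda>(x, y). dist x y) ` (f ` C i \<times> f ` C i) = (\<lambda>(x, y). dist x y) ` (C i \<times> C i)"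
        by (force simp: iso)
      then show ?thesis by (simp add: diameter_def)
    qed
    have "hausdorff_pre m \<delta> (f ` A) \<le> (\<Sum>i. hausdorff_term m (f ` C i))"
      by (rule hausdorff_pre_le_suminf) (use C(1) in blast, simp_all add: C(2) bd diam)
    then show ?thesis unfolding hausdorff_term_def diam by simp
  qed
  then have "hausdorff_pre m \<delta> (f ` A) \<le> hausdorff_pre m \<delta> A"
    unfolding hausdorff_pre_def[of m \<delta> A] by (intro INF_greatest) auto
  also have "\<dots> \<le> hausdorff_outer m A" using \<delta> by (rule hausdorff_pre_le_outer)
  finally show "hausdorff_pre m \<delta> (f ` A) \<le> hausdorff_outer m A" .
qed

subsection \<open>Lebesgue measure: rotations, Fubini in a direction, Steiner symmetrisation\<close>

definition perp :: "'a::real_inner \<Rightarrow> 'a \<Rightarrow> 'a" where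
  "perp u y = y - (y \<bullet> u) *\<^sub>R u"

text \<open>Integrals over the hyperplane orthogonal to a unit vector \<open>u\<close> are written as integrals over
  this slab of thickness one; no measure space of dimension \<open>d - 1\<close> is then needed.\<close>
definition slab :: "'a::real_inner \<Rightarrow> 'a set" where
  "slab u = {y. 0 \<le> y \<bullet> u \<and> y \<bullet> u \<le> 1}"

lemma perp_add: "perp u (x + y) = perp u x + perp u y"
  and perp_diff: "perp u (x - y) = perp u x - perp u y"
  and perp_scaleR: "perp u (c *\<^sub>R x) = c *\<^sub>R perp u x"
  by (simp_all add: perp_def algebra_simps inner_add_left inner_diff_left)

lemma perp_self: "norm u = 1 \<Longrightarrow> perp u u = 0"
  by (simp add: perp_def norm_eq_1)

lemma perp_idem: "norm u = 1 \<Longrightarrow> perp u (perp u y) = perp u y"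
  by (simp add: perp_def norm_eq_1 algebra_simps inner_diff_left)

lemma inner_perp_self: "norm u = 1 \<Longrightarrow> perp u y \<bullet> u = 0"
  by (simp add: perp_def norm_eq_1 inner_diff_left)

lemma inner_perp_orth: "u \<bullet> v = 0 \<Longrightarrow> perp u y \<bullet> v = y \<bullet> v"
  by (simp add: perp_def inner_diff_left)

lemma perp_decomp: "perp u y + (y \<bullet> u) *\<^sub>R u = y"
  by (simp add: perp_def)

lemma norm_perp_plus:
  assumes "norm u = 1"
  shows "(norm (perp u y + t *\<^sub>R u))\<^sup>2 = (norm (perp u y))\<^sup>2 + t\<^sup>2"
proof -
  have "perp u y \<bullet> u = 0" using assms by (rule inner_perp_self)
  then show ?thesis using assms
    unfolding power2_norm_eq_inner norm_eq_1 inner_add_left inner_add_right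
    by (simp add: inner_commute power2_eq_square)
qed

lemma continuous_on_perp [continuous_intros]:
  "continuous_on S f \<Longrightarrow> continuous_on S (\<lambda>y. perp u (f y))"
  unfolding perp_def by (intro continuous_intros)

lemma borel_measurable_perp [measurable]: "perp (u::'a::euclidean_space) \<in> borel_measurable borel"
  by (intro borel_measurable_continuous_onI continuous_intros)

lemma sets_slab [measurable]: "slab (u::'a::euclidean_space) \<in> sets borel"
  unfolding slab_def by measurable

section \<open>Invariance of Lebesgue measure under rotations\<close>

lemma nn_integral_lborel_translate:
  fixes f :: "'a::euclidean_space \<Rightarrow> ennreal"
  assumes [measurable]: "f \<in> borel_measurable borel"
  shows "(\<integral>\<^sup>+y. f (a + y) \<partial>lborel) = (\<integral>\<^sup>+y. f y \<partial>lborel)"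
  by (subst (2) lborel_distr_plus[of a, symmetric], subst nn_integral_distr) auto

lemma nn_integral_lborel_reflect:
  fixes f :: "'a::euclidean_space \<Rightarrow> ennreal"
  assumes [measurable]: "f \<in> borel_measurable borel"
  shows "(\<integral>\<^sup>+y. f (a - y) \<partial>lborel) = (\<integral>\<^sup>+y. f y \<partial>lborel)"
  by (subst (2) lborel_affine[of "-1" a]) (auto simp: nn_integral_density nn_integral_distr)

text \<open>The uniqueness argument for Haar measure; the unit ball fixes the constant.\<close>
lemma distr_lborel_orthogonal:
  fixes f :: "'a::euclidean_space \<Rightarrow> 'a"
  assumes f: "orthogonal_transformation f"
  shows "distr lborel borel f = lborel"
proof (rule measure_eqI)
  have lin: "linear f" using f by (rule orthogonal_transformation_linear)
  then have [measurable]: "f \<in> borel_measurable borel"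
    by (intro borel_measurable_continuous_onI linear_continuous_on) (simp add: linear_conv_bounded_linear)
  fix A assume "A \<in> sets (distr lborel borel f)"
  then have A [measurable]: "A \<in> sets borel" by simp
  define g :: "'a \<Rightarrow> ennreal" where "g = indicator A"
  define h :: "'a \<Rightarrow> ennreal" where "h = indicator (cball 0 1)"
  have [measurable]: "g \<in> borel_measurable borel" "h \<in> borel_measurable borel"
    unfolding g_def h_def by (measurable, simp)
  define w where "w = (\<integral>\<^sup>+x. h x \<partial>lborel)"
  have w: "w = ennreal (unit_ball_vol (DIM('a)))"
    using emeasure_cball[of 1 "0::'a"] by (simp add: w_def h_def)
  have "(\<integral>\<^sup>+y. g (f y) \<partial>lborel) * w = (\<integral>\<^sup>+y. \<integral>\<^sup>+x. g (f y) * h (f y + x) \<partial>lborel \<partial>lborel)"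
    by (simp add: nn_integral_cmult nn_integral_multc nn_integral_lborel_translate w_def)
  also have "\<dots> = (\<integral>\<^sup>+x. \<integral>\<^sup>+y. g (f y) * h (f y + x) \<partial>lborel \<partial>lborel)"
    by (rule lborel_pair.Fubini') measurable
  also have "\<dots> = (\<integral>\<^sup>+x. \<integral>\<^sup>+y. g (f y - x) * h (f y) \<partial>lborel \<partial>lborel)"
  proof (rule nn_integral_cong)
    fix x
    \<comment> \<open>A preimage of the shift \<open>x\<close> lets translation invariance in
      \<open>y\<close> move the shift from \<open>h\<close> to \<open>g\<close>; afterwards the
      factor \<open>h (f y)\<close> is free of \<open>x\<close> and the double integral
      separates.\<close>
    obtain x' where x': "f x' = x" using orthogonal_transformation_surj[OF f] by (metis surjD)
    have "(\<integral>\<^sup>+y. g (f y - x) * h (f y) \<partial>lborel) = (\<integral>\<^sup>+y. g (f (x' + y) - x) * h (f (x' + y)) \<partial>lborel)"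
      by (rule nn_integral_lborel_translate[symmetric]) measurable
    then show "(\<integral>\<^sup>+y. g (f y) * h (f y + x) \<partial>lborel) = (\<integral>\<^sup>+y. g (f y - x) * h (f y) \<partial>lborel)"
      by (simp add: linear_add[OF lin] x' add.commute)
  qed
  also have "\<dots> = (\<integral>\<^sup>+y. \<integral>\<^sup>+x. g (f y - x) * h (f y) \<partial>lborel \<partial>lborel)"
    by (rule lborel_pair.Fubini') measurable
  also have "\<dots> = (\<integral>\<^sup>+x. g x \<partial>lborel) * (\<integral>\<^sup>+y. h (f y) \<partial>lborel)"
    by (simp add: nn_integral_cmult nn_integral_multc nn_integral_lborel_reflect)
  also have "(\<lambda>y. h (f y)) = h"
    using f by (auto simp: h_def indicator_def orthogonal_transformation_norm)
  finally have "(\<integral>\<^sup>+y. g (f y) \<partial>lborel) * w = (\<integral>\<^sup>+x. g x \<partial>lborel) * w"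
    by (simp add: w_def)
  moreover have "w \<noteq> 0" "w \<noteq> top" using unit_ball_vol_pos[of "real DIM('a)"] by (auto simp: w ennreal_eq_0_iff simp del: unit_ball_vol_pos)
  ultimately have "(\<integral>\<^sup>+y. g (f y) \<partial>lborel) = (\<integral>\<^sup>+x. g x \<partial>lborel)"
    by (metis ennreal_mult_cancel_left mult.commute)
  then show "emeasure (distr lborel borel f) A = emeasure lborel A"
    by (simp add: g_def nn_integral_distr flip: nn_integral_indicator)
qed simp

section \<open>Fubini along an arbitrary direction\<close>

text \<open>No coordinates are rotated. The inner integral is unchanged by shifts along
  \<open>u\<close>, so \<open>perp u y\<close> may be replaced by \<open>y\<close>; after an
  exchange of integrals and a translation, the point \<open>y\<close> is weighted with the length of
  \<open>{t. y - t *\<^sub>R u \<in> slab u}\<close>, an interval of length 1.\<close>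

lemma nn_integral_lborel_fubini_direction:
  fixes u :: "'a::euclidean_space" and g :: "'a \<Rightarrow> ennreal"
  assumes u: "norm u = 1" and [measurable]: "g \<in> borel_measurable borel"
  shows "(\<integral>\<^sup>+y. g y \<partial>lborel) =
    (\<integral>\<^sup>+y. indicator (slab u) y * (\<integral>\<^sup>+t. g (perp u y + t *\<^sub>R u) \<partial>lborel) \<partial>lborel)"
proof -
  have "(\<integral>\<^sup>+t. g (perp u y + t *\<^sub>R u) \<partial>lborel) = (\<integral>\<^sup>+t. g (y + t *\<^sub>R u) \<partial>lborel)" for y
    by (subst nn_integral_real_affine[where c=1 and t="y \<bullet> u"]) (auto simp: perp_def algebra_simps)
  then have "(\<integral>\<^sup>+y. indicator (slab u) y * (\<integral>\<^sup>+t. g (perp u y + t *\<^sub>R u) \<partial>lborel) \<partial>lborel)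
     = (\<integral>\<^sup>+y. \<integral>\<^sup>+t. indicator (slab u) y * g (y + t *\<^sub>R u) \<partial>lborel \<partial>lborel)"
    by (simp add: nn_integral_cmult)
  also have "\<dots> = (\<integral>\<^sup>+t. \<integral>\<^sup>+y. indicator (slab u) y * g (y + t *\<^sub>R u) \<partial>lborel \<partial>lborel)"
    by (rule lborel_pair.Fubini') measurable
  also have "\<dots> = (\<integral>\<^sup>+t. \<integral>\<^sup>+y. indicator (slab u) (y - t *\<^sub>R u) * g y \<partial>lborel \<partial>lborel)"
  proof (rule nn_integral_cong)
    fix t
    show "(\<integral>\<^sup>+y. indicator (slab u) y * g (y + t *\<^sub>R u) \<partial>lborel) =
      (\<integral>\<^sup>+y. indicator (slab u) (y - t *\<^sub>R u) * g y \<partial>lborel)"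
      by (subst nn_integral_lborel_translate[where a="t *\<^sub>R u", symmetric])
         (measurable, simp add: add.commute)
  qed
  also have "\<dots> = (\<integral>\<^sup>+y. \<integral>\<^sup>+t. indicator (slab u) (y - t *\<^sub>R u) * g y \<partial>lborel \<partial>lborel)"
    by (rule lborel_pair.Fubini') measurable
  also have "\<dots> = (\<integral>\<^sup>+y. \<integral>\<^sup>+t. indicator {y \<bullet> u - 1..y \<bullet> u} t * g y \<partial>lborel \<partial>lborel)"
    using u by (intro nn_integral_cong) (auto simp: indicator_def slab_def inner_diff_left norm_eq_1)
  also have "\<dots> = (\<integral>\<^sup>+y. g y \<partial>lborel)"
    by (simp add: nn_integral_multc)
  finally show ?thesis by simp
qed

lemma emeasure_fibre:
  fixes u :: "'a::euclidean_space"
  assumes [measurable]: "A \<in> sets borel"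
  shows "emeasure lborel {t. perp u y + t *\<^sub>R u \<in> A} = (\<integral>\<^sup>+t. indicator A (perp u y + t *\<^sub>R u) \<partial>lborel)"
proof -
  have "(\<integral>\<^sup>+t. indicator A (perp u y + t *\<^sub>R u) \<partial>lborel) = (\<integral>\<^sup>+t. indicator {t. perp u y + t *\<^sub>R u \<in> A} t \<partial>lborel)"
    by (intro nn_integral_cong) (auto simp: indicator_def)
  also have "\<dots> = emeasure lborel {t. perp u y + t *\<^sub>R u \<in> A}"
    by (intro nn_integral_indicator) measurable
  finally show ?thesis ..
qed

lemma emeasure_lborel_fubini_direction:
  fixes u :: "'a::euclidean_space"
  assumes u: "norm u = 1" and A: "A \<in> sets borel"
  shows "emeasure lborel A =
    (\<integral>\<^sup>+y. indicator (slab u) y * emeasure lborel {t. perp u y + t *\<^sub>R u \<in> A} \<partial>lborel)"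
  using nn_integral_lborel_fubini_direction[OF u, of "indicator A"] A by (simp add: emeasure_fibre)

lemma norm_perp_Basis:
  fixes e :: "'a::euclidean_space"
  assumes "e \<in> Basis"
  shows "norm (perp e y) = sqrt (\<Sum>b\<in>Basis - {e}. (y \<bullet> b)\<^sup>2)"
proof -
  have "perp e y \<bullet> perp e y = (\<Sum>b\<in>Basis. (perp e y \<bullet> b) * (perp e y \<bullet> b))"
    by (rule euclidean_inner)
  also have "\<dots> = (\<Sum>b\<in>Basis - {e}. (perp e y \<bullet> b) * (perp e y \<bullet> b))"
    using assms by (intro sum.mono_neutral_right) (auto simp: perp_def inner_diff_left)
  also have "\<dots> = (\<Sum>b\<in>Basis - {e}. (y \<bullet> b)\<^sup>2)"
    using assms by (intro sum.cong) (auto simp: perp_def inner_diff_left inner_Basis power2_eq_square)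
  finally show ?thesis by (simp add: norm_eq_sqrt_inner)
qed

text \<open>The coordinates other than \<open>e\<close> range over a Euclidean ball indexed by
  \<open>Basis - {e}\<close>. Its volume formula holds for every finite index set, including the
  empty one that occurs in dimension 1.\<close>

lemma emeasure_ball_cylinder:
  fixes e :: "'a::euclidean_space"
  assumes e: "e \<in> Basis" and r: "0 < r"
  shows "emeasure lborel {y\<in>slab e. norm (perp e y) \<le> r} =
    ennreal (unit_ball_vol (real (DIM('a) - 1)) * r ^ (DIM('a) - 1))"
proof -
  interpret product_sigma_finite "\<lambda>_::'a. lborel :: real measure" by standard
  define B where "B = (Basis - {e} :: 'a set)"
  have B: "finite B" "e \<notin> B" "Basis = insert e B" "card B = DIM('a) - 1"
    using e by (auto simp: B_def)
  let ?S = "{y\<in>slab e. norm (perp e y) \<le> r}"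
  let ?P = "Pi\<^sub>M (insert e B) (\<lambda>_. lborel :: real measure)"
  let ?Q = "Pi\<^sub>M B (\<lambda>_. lborel :: real measure)"
  let ?F = "\<lambda>f. \<Sum>b\<in>insert e B. f b *\<^sub>R b"
  let ?C = "{f. sqrt (\<Sum>i\<in>B. (f i)\<^sup>2) \<le> r} \<inter> space ?Q"
  have [measurable]: "?S \<in> sets borel" by measurable
  have [measurable]: "?F \<in> ?P \<rightarrow>\<^sub>M borel"
    unfolding B(3)[symmetric] by measurable
  have [measurable]: "?C \<in> sets ?Q" by measurable
  have Fb: "?F f \<bullet> b = f b" if "b \<in> insert e B" for f b
    using that unfolding B(3)[symmetric] by simp
  have mem: "?F f \<in> ?S \<longleftrightarrow> 0 \<le> f e \<and> f e \<le> 1 \<and> sqrt (\<Sum>i\<in>B. (f i)\<^sup>2) \<le> r" for f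
  proof -
    have "norm (perp e (?F f)) = sqrt (\<Sum>i\<in>B. (f i)\<^sup>2)"
      unfolding norm_perp_Basis[OF e] B_def[symmetric] by (intro arg_cong[where f=sqrt] sum.cong) (auto simp: Fb)
    then show ?thesis by (simp add: slab_def Fb)
  qed
  have "emeasure lborel ?S = emeasure (distr ?P borel ?F) ?S"
    by (subst lborel_eq) (simp add: B(3))
  also have "\<dots> = (\<integral>\<^sup>+f. indicator ?S (?F f) \<partial>?P)"
    by (simp add: nn_integral_distr flip: nn_integral_indicator)
  also have "\<dots> = (\<integral>\<^sup>+y. \<integral>\<^sup>+f. indicator ?S (?F (f(e := y))) \<partial>?Q \<partial>lborel)"
    by (rule product_nn_integral_insert_rev) (use B in auto)
  also have "\<dots> = (\<integral>\<^sup>+(y::real). \<integral>\<^sup>+f. indicator {0..1} y * indicator ?C f \<partial>?Q \<partial>lborel)"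
  proof (intro nn_integral_cong)
    fix y f assume f: "f \<in> space ?Q"
    have "(\<Sum>i\<in>B. ((f(e := y)) i)\<^sup>2) = (\<Sum>i\<in>B. (f i)\<^sup>2)"
      using B by (intro sum.cong) auto
    then have "?F (f(e := y)) \<in> ?S \<longleftrightarrow> 0 \<le> y \<and> y \<le> 1 \<and> sqrt (\<Sum>i\<in>B. (f i)\<^sup>2) \<le> r"
      using mem[of "f(e := y)"] by simp
    then show "indicator ?S (?F (f(e := y))) = (indicator {0..1} y * indicator ?C f :: ennreal)"
      using f by (auto simp: indicator_def)
  qed
  also have "\<dots> = emeasure ?Q ?C"
    by (simp add: nn_integral_cmult nn_integral_multc)
  also have "\<dots> = ennreal (unit_ball_vol (real (card B)) * r ^ card B)"
    by (rule emeasure_cball_aux) (use B r in auto)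
  finally show ?thesis using B by simp
qed

text \<open>The inequality is strict so that empty fibres contribute no points: the projection of \<open>E\<close>,
  which need not be Borel, never enters.\<close>
definition steiner :: "'a::euclidean_space \<Rightarrow> 'a set \<Rightarrow> 'a set" where
  "steiner b E = {y. ennreal (2 * \<bar>y \<bullet> b\<bar>) < emeasure lborel {t. perp b y + t *\<^sub>R b \<in> E}}"

lemma borel_measurable_fibre_length:
  fixes b :: "'a::euclidean_space"
  assumes [measurable]: "E \<in> sets borel"
  shows "(\<lambda>y. emeasure lborel {t. perp b y + t *\<^sub>R b \<in> E}) \<in> borel_measurable borel"
  by (simp add: emeasure_fibre)

lemma sets_steiner [measurable]:
  assumes [measurable]: "E \<in> sets borel"
  shows "steiner b E \<in> sets borel"
proof -
  note borel_measurable_fibre_length[OF assms, of b, measurable]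
  show ?thesis unfolding steiner_def by measurable
qed

text \<open>Each fibre is replaced by a centred open interval of the same length, or by the whole
  line if that length is infinite, so the fibrewise integrals agree.\<close>

lemma emeasure_steiner:
  fixes b :: "'a::euclidean_space"
  assumes b: "norm b = 1" and [measurable]: "E \<in> sets borel"
  shows "emeasure lborel (steiner b E) = emeasure lborel E"
proof -
  have "emeasure lborel {t. perp b y + t *\<^sub>R b \<in> steiner b E} = emeasure lborel {t. perp b y + t *\<^sub>R b \<in> E}" for y
  proof -
    define l where "l = emeasure lborel {t. perp b y + t *\<^sub>R b \<in> E}"
    have "(perp b y + t *\<^sub>R b) \<bullet> b = t" "perp b (perp b y + t *\<^sub>R b) = perp b y" for t
      using b by (simp_all add: inner_add_left inner_perp_self perp_add perp_idem perp_scaleR perp_self norm_eq_1[symmetric] flip: power2_norm_eq_inner)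
    then have "{t. perp b y + t *\<^sub>R b \<in> steiner b E} = {t. ennreal (2 * \<bar>t\<bar>) < l}"
      by (simp add: steiner_def l_def)
    also have "emeasure lborel \<dots> = l"
    proof (cases l)
      case (real r)
      then have "{t. ennreal (2 * \<bar>t\<bar>) < l} = {- (r/2)<..<r/2}"
        by (auto simp: ennreal_less_iff)
      then show ?thesis using real by simp
    next
      case top
      then show ?thesis by simp
    qed
    finally show ?thesis by (simp add: l_def)
  qed
  then show ?thesis
    by (simp add: emeasure_lborel_fubini_direction[OF b])
qed

text \<open>The one-dimensional core of the isodiametric inequality: adding the crossed bounds
  \<open>Sup F - Inf G \<le> k\<close> and \<open>Sup G - Inf F \<le> k\<close> bounds the total
  length of the two convex hulls by \<open>2 * k\<close>.\<close>

lemma emeasure_lborel_add_le_of_close: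
  fixes F G :: "real set"
  assumes ne: "F \<noteq> {}" "G \<noteq> {}" and close: "\<And>s t. s \<in> F \<Longrightarrow> t \<in> G \<Longrightarrow> \<bar>s - t\<bar> \<le> k"
  shows "emeasure lborel F + emeasure lborel G \<le> ennreal (2 * k)"
proof -
  obtain s0 t0 where st: "s0 \<in> F" "t0 \<in> G" using ne by auto
  have bF: "bdd_above F" "bdd_below F"
    using close[OF _ st(2)] by (auto intro!: bdd_aboveI[of _ "t0 + k"] bdd_belowI[of _ "t0 - k"] simp: abs_le_iff) (smt (verit))+
  have bG: "bdd_above G" "bdd_below G"
    using close[OF st(1)] by (auto intro!: bdd_aboveI[of _ "s0 + k"] bdd_belowI[of _ "s0 - k"] simp: abs_le_iff) (smt (verit))+
  have "Sup F \<le> t + k" if "t \<in> G" for t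
    using close[OF _ that] ne by (intro cSup_least) (auto simp: abs_le_iff algebra_simps)
  then have "Sup F - k \<le> Inf G"
    using ne by (intro cInf_greatest) (auto simp: algebra_simps)
  moreover have "Sup G \<le> t + k" if "t \<in> F" for t
    using close[OF that] ne by (intro cSup_least) (auto simp: abs_le_iff algebra_simps)
  then have "Sup G - k \<le> Inf F"
    using ne by (intro cInf_greatest) (auto simp: algebra_simps)
  moreover have "Inf F \<le> Sup F" "Inf G \<le> Sup G"
    using bF bG ne by (auto intro!: cInf_le_cSup)
  moreover have "emeasure lborel F \<le> emeasure lborel {Inf F..Sup F}"
    "emeasure lborel G \<le> emeasure lborel {Inf G..Sup G}"
    using bF bG by (auto intro!: emeasure_mono cInf_lower cSup_upper)
  ultimately have "emeasure lborel F + emeasure lborel G \<le> ennreal (Sup F - Inf F) + ennreal (Sup G - Inf G)"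
    by (intro add_mono) auto
  also have "\<dots> = ennreal ((Sup F - Inf F) + (Sup G - Inf G))"
    using \<open>Inf F \<le> Sup F\<close> \<open>Inf G \<le> Sup G\<close> by (intro ennreal_plus[symmetric]) auto
  also have "\<dots> \<le> ennreal (2 * k)"
    using \<open>Sup F - k \<le> Inf G\<close> \<open>Sup G - k \<le> Inf F\<close> by (intro ennreal_leI) auto
  finally show ?thesis .
qed

lemma steiner_subset_slab:
  assumes "E \<subseteq> slab e" "b \<bullet> e = 0"
  shows "steiner b E \<subseteq> slab e"
proof
  fix y assume "y \<in> steiner b E"
  then have "emeasure lborel {t. perp b y + t *\<^sub>R b \<in> E} \<noteq> 0" by (auto simp: steiner_def)
  then have "{t. perp b y + t *\<^sub>R b \<in> E} \<noteq> {}" by force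
  then obtain t where "perp b y + t *\<^sub>R b \<in> slab e" using assms by blast
  then show "y \<in> slab e" using assms(2)
    by (simp add: slab_def inner_add_left inner_perp_orth)
qed

lemma perp_commute:
  "b \<bullet> e = 0 \<Longrightarrow> perp e (perp b y) = perp b (perp e y)"
  by (simp add: perp_def inner_diff_left inner_commute algebra_simps)

text \<open>All differences between points of the fibres through \<open>y\<close> and
  \<open>z\<close> share the same component orthogonal to \<open>b\<close> and \<open>e\<close>, of
  squared norm \<open>q\<close>. By Pythagoras, fibre parameters then differ by at most
  \<open>k = sqrt (D^2 - q)\<close>, so the two fibre lengths add up to at most
  \<open>2 * k\<close>. Points of the symmetrised set have heights below half of these lengths,
  whence their difference along \<open>b\<close> is again at most \<open>k\<close>.\<close>

lemma steiner_diameter: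
  fixes b :: "'a::euclidean_space"
  assumes diam: "\<And>y z. y \<in> E \<Longrightarrow> z \<in> E \<Longrightarrow> norm (perp e (y - z)) \<le> D"
    and b: "norm b = 1" and be: "b \<bullet> e = 0" and y: "y \<in> steiner b E" and z: "z \<in> steiner b E"
  shows "norm (perp e (y - z)) \<le> D"
proof -
  define F where "F y = {t. perp b y + t *\<^sub>R b \<in> E}" for y
  have lF: "ennreal (2 * \<bar>y \<bullet> b\<bar>) < emeasure lborel (F y)" "ennreal (2 * \<bar>z \<bullet> b\<bar>) < emeasure lborel (F z)"
    using y z by (auto simp: steiner_def F_def)
  have ne: "F y \<noteq> {}" "F z \<noteq> {}" using lF by force+
  define q where "q = (norm (perp b (perp e (y - z))))\<^sup>2"
  have pb: "perp e b = b" using be by (simp add: perp_def)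
  have split: "(norm (perp e (perp b (y - z) + t *\<^sub>R b)))\<^sup>2 = q + t\<^sup>2" for t
    using norm_perp_plus[OF b, of "perp e (y - z)" t] perp_commute[OF be, of "y - z"] pb
    by (simp add: perp_add perp_scaleR q_def)
  have D0: "0 \<le> D" using diam ne unfolding F_def by (smt (verit) Collect_empty_eq norm_ge_zero)
  have le: "q + (s - t)\<^sup>2 \<le> D\<^sup>2" if "s \<in> F y" "t \<in> F z" for s t
  proof -
    have "norm (perp e ((perp b y + s *\<^sub>R b) - (perp b z + t *\<^sub>R b))) \<le> D"
      using that by (intro diam) (auto simp: F_def)
    moreover have "(perp b y + s *\<^sub>R b) - (perp b z + t *\<^sub>R b) = perp b (y - z) + (s - t) *\<^sub>R b"
      by (simp add: perp_diff algebra_simps)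
    ultimately show ?thesis
      using split[of "s - t"] D0 by (metis norm_ge_zero power_mono)
  qed
  define k where "k = sqrt (D\<^sup>2 - q)"
  have "0 \<le> D\<^sup>2 - q" using le ne by (smt (verit) ex_in_conv zero_le_power2)
  then have k: "k\<^sup>2 = D\<^sup>2 - q" "0 \<le> k" by (auto simp: k_def)
  have "\<bar>s - t\<bar> \<le> k" if "s \<in> F y" "t \<in> F z" for s t
    using le[OF that] unfolding k_def by (intro real_le_rsqrt) auto
  then have "emeasure lborel (F y) + emeasure lborel (F z) \<le> ennreal (2 * k)"
    by (intro emeasure_lborel_add_le_of_close ne)
  then have "ennreal (2 * \<bar>y \<bullet> b\<bar>) + ennreal (2 * \<bar>z \<bullet> b\<bar>) \<le> ennreal (2 * k)"
    using lF by (meson add_mono less_imp_le order_trans)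
  then have "\<bar>y \<bullet> b\<bar> + \<bar>z \<bullet> b\<bar> \<le> k"
    using k by (simp add: ennreal_plus[symmetric] del: ennreal_plus)
  then have "\<bar>(y - z) \<bullet> b\<bar> \<le> k" by (auto simp: inner_diff_left)
  then have "((y - z) \<bullet> b)\<^sup>2 \<le> k\<^sup>2" using k(2) by (metis abs_le_square_iff abs_of_nonneg)
  then have "(norm (perp e (perp b (y - z) + ((y - z) \<bullet> b) *\<^sub>R b)))\<^sup>2 \<le> D\<^sup>2"
    unfolding split using k by simp
  then show ?thesis
    using D0 by (simp add: perp_decomp power2_le_iff_abs_le)
qed

section \<open>Reflections and the isodiametric inequality\<close>

text \<open>For a unit vector \<open>b\<close> this is the Householder reflection in the hyperplane
  orthogonal to \<open>b\<close>. It is both the symmetry created by Steiner symmetrisation and,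
  later, the isometry that carries one unit vector to another.\<close>

definition flip :: "'a::real_inner \<Rightarrow> 'a \<Rightarrow> 'a" where
  "flip b y = y - (2 * (y \<bullet> b)) *\<^sub>R b"

lemma steiner_flip_self:
  assumes b: "norm b = 1" and "y \<in> steiner b E"
  shows "flip b y \<in> steiner b E"
proof -
  have bb: "b \<bullet> b = 1" using b by (simp add: norm_eq_1)
  have "flip b y \<bullet> b = - (y \<bullet> b)" by (simp add: flip_def inner_diff_left bb)
  moreover from this have "perp b (flip b y) = perp b y" by (simp add: perp_def flip_def algebra_simps flip: scaleR_2)
  ultimately show ?thesis using assms by (simp add: steiner_def)
qed

text \<open>Symmetrising in a new direction must not destroy earlier symmetries. The reflection
  along \<open>c\<close> carries fibres in direction \<open>b\<close> to fibres in direction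
  \<open>b\<close> with the same parameters, so a symmetric \<open>E\<close> has equal fibre lengths
  at \<open>y\<close> and at its mirror image.\<close>

lemma steiner_flip_orth:
  assumes c: "norm c = 1" and bc: "b \<bullet> c = 0" and E: "\<And>y. y \<in> E \<Longrightarrow> flip c y \<in> E" and y: "y \<in> steiner b E"
  shows "flip c y \<in> steiner b E"
proof -
  have cb: "c \<bullet> b = 0" using bc by (simp add: inner_commute)
  have cc: "c \<bullet> c = 1" using c by (simp add: norm_eq_1)
  have inv: "flip c (flip c v) = v" for v
    by (simp add: flip_def inner_diff_left cc algebra_simps)
  have E': "flip c v \<in> E \<longleftrightarrow> v \<in> E" for v using E inv by metis
  have "flip c y \<bullet> b = y \<bullet> b" by (simp add: flip_def inner_diff_left cb)
  moreover have "perp b (flip c y) + t *\<^sub>R b = flip c (perp b y + t *\<^sub>R b)" for t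
    by (simp add: perp_def flip_def inner_diff_left inner_add_left cb bc algebra_simps)
  ultimately show ?thesis using y by (simp add: steiner_def E')
qed

text \<open>After symmetrisation in every basis direction except \<open>e\<close>, the set is
  invariant under the composition of all these reflections, which negates \<open>perp e y\<close>. A
  point and its image then have projected distance \<open>2 * norm (perp e y)\<close>, so the set
  lies over a ball of radius \<open>D/2\<close>.\<close>

lemma isodiametric_slab:
  fixes e :: "'a::euclidean_space"
  assumes e: "e \<in> Basis" and E: "E \<in> sets borel" "E \<subseteq> slab e"
    and diam: "\<And>y z. y \<in> E \<Longrightarrow> z \<in> E \<Longrightarrow> norm (perp e (y - z)) \<le> D"
  shows "emeasure lborel E \<le> ennreal (unit_ball_vol (real (DIM('a) - 1)) * (D/2) ^ (DIM('a) - 1))"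
proof (cases "E = {}")
  case True
  then show ?thesis by simp
next
  case False
  then have D0: "0 \<le> D" using diam by (meson ex_in_conv norm_ge_zero order_trans)
  have "\<exists>E'. E' \<in> sets borel \<and> E' \<subseteq> slab e \<and> emeasure lborel E' = emeasure lborel E \<and>
      (\<forall>y\<in>E'. \<forall>z\<in>E'. norm (perp e (y - z)) \<le> D) \<and> (\<forall>b\<in>J. \<forall>y\<in>E'. flip b y \<in> E')"
    if "J \<subseteq> Basis - {e}" for J
    using finite_subset[OF that finite_Diff[OF finite_Basis]] that
  proof (induction J rule: finite_induct)
    case empty
    then show ?case using E diam by (intro exI[of _ E]) auto
  next
    case (insert b J)
    then obtain E' where E': "E' \<in> sets borel" "E' \<subseteq> slab e" "emeasure lborel E' = emeasure lborel E"
      "\<And>y z. y\<in>E' \<Longrightarrow> z\<in>E' \<Longrightarrow> norm (perp e (y - z)) \<le> D" "\<And>b y. b\<in>J \<Longrightarrow> y\<in>E' \<Longrightarrow> flip b y \<in> E'"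
      by auto
    have b: "norm b = 1" "b \<bullet> e = 0" using insert.prems e by (auto simp: inner_Basis)
    have "flip c y \<in> steiner b E'" if "c \<in> J" "y \<in> steiner b E'" for c y
    proof (rule steiner_flip_orth)
      have "c \<in> Basis" "c \<noteq> b" "b \<in> Basis" using that insert.prems insert.hyps by auto
      then show "norm c = 1" "b \<bullet> c = 0" by (auto simp: inner_Basis)
    qed (use that E'(5) in auto)
    moreover have "norm (perp e (y - z)) \<le> D" if "y \<in> steiner b E'" "z \<in> steiner b E'" for y z
      using E'(4) b that by (rule steiner_diameter)
    ultimately show ?case
      using E'(1,3) steiner_subset_slab[OF E'(2) b(2)] steiner_flip_self[OF b(1)] emeasure_steiner[OF b(1) E'(1)]
      by (intro exI[of _ "steiner b E'"]) auto
  qed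
  from this[OF order_refl] obtain E' where E': "E' \<in> sets borel" "E' \<subseteq> slab e" "emeasure lborel E' = emeasure lborel E"
      "\<And>y z. y\<in>E' \<Longrightarrow> z\<in>E' \<Longrightarrow> norm (perp e (y - z)) \<le> D" "\<And>b y. b\<in>Basis - {e} \<Longrightarrow> y\<in>E' \<Longrightarrow> flip b y \<in> E'"
    by auto
  have "norm (perp e y) \<le> D/2" if y: "y \<in> E'" for y
  proof -
    \<comment> \<open>Composing the flips along \<open>J\<close> one at a time; orthogonality of the
      basis leaves the coordinate along the next \<open>b\<close> untouched by the earlier
      flips.\<close>
    have "y - 2 *\<^sub>R (\<Sum>b\<in>J. (y \<bullet> b) *\<^sub>R b) \<in> E'" if "J \<subseteq> Basis - {e}" for J
      using finite_subset[OF that finite_Diff[OF finite_Basis]] that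
    proof (induction J rule: finite_induct)
      case (insert b J)
      let ?v = "y - 2 *\<^sub>R (\<Sum>b\<in>J. (y \<bullet> b) *\<^sub>R b)"
      have "(\<Sum>c\<in>J. (y \<bullet> c) * (c \<bullet> b)) = 0"
      proof (rule sum.neutral, rule ballI)
        fix c assume "c \<in> J"
        then have "c \<in> Basis" "b \<in> Basis" "c \<noteq> b" using insert by auto
        then show "(y \<bullet> c) * (c \<bullet> b) = 0" by (simp add: inner_Basis)
      qed
      then have "?v \<bullet> b = y \<bullet> b" by (simp add: inner_diff_left inner_sum_left)
      then have "flip b ?v = y - 2 *\<^sub>R (\<Sum>b\<in>insert b J. (y \<bullet> b) *\<^sub>R b)"
        using insert by (simp add: flip_def algebra_simps)
      moreover have "flip b ?v \<in> E'" using insert by (intro E') auto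
      ultimately show ?case by simp
    qed (use y in simp)
    from this[OF order_refl] have "y - 2 *\<^sub>R (\<Sum>b\<in>Basis - {e}. (y \<bullet> b) *\<^sub>R b) \<in> E'" .
    moreover have "(\<Sum>b\<in>Basis - {e}. (y \<bullet> b) *\<^sub>R b) = perp e y"
      using e by (simp add: sum_diff1 euclidean_representation perp_def)
    ultimately have "norm (perp e (y - (y - 2 *\<^sub>R perp e y))) \<le> D"
      using y by (intro E') auto
    then show ?thesis using e by (simp add: perp_scaleR perp_idem)
  qed
  \<comment> \<open>Radii strictly above \<open>D/2\<close> are taken because the cylinder formula
    asks for a positive radius and \<open>D\<close> may be 0; a limit removes the excess.\<close>
  then have sub: "E' \<subseteq> {y\<in>slab e. norm (perp e y) \<le> r}" if "D/2 < r" for r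
    using E'(2) that by fastforce
  have "emeasure lborel E \<le> ennreal (unit_ball_vol (real (DIM('a) - 1)) * (D/2 + 1 / real (Suc n)) ^ (DIM('a) - 1))" for n
    using emeasure_mono[OF sub[of "D/2 + 1 / real (Suc n)"], of lborel] D0 E'(3)
      emeasure_ball_cylinder[OF e, of "D/2 + 1 / real (Suc n)"]
    by (simp add: add_nonneg_pos)
  moreover have "(\<lambda>n. ennreal (unit_ball_vol (real (DIM('a) - 1)) * (D/2 + 1 / real (Suc n)) ^ (DIM('a) - 1)))
     \<longlonglongrightarrow> ennreal (unit_ball_vol (real (DIM('a) - 1)) * (D/2 + 0) ^ (DIM('a) - 1))"
    by (intro tendsto_intros tendsto_ennrealI LIMSEQ_Suc[OF lim_1_over_n])
  ultimately show ?thesis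
    by (metis (no_types, lifting) LIMSEQ_le_const add.right_neutral)
qed

subsection \<open>Hausdorff measure on hyperplanes\<close>

text \<open>Only the section of \<open>A\<close> at height \<open>c\<close> matters, so
  \<open>A\<close> need not lie in the hyperplane: the definition also applies to
  \<open>frontier Y\<close> or to the closure of a covering set.\<close>

definition cyl :: "'a::euclidean_space \<Rightarrow> real \<Rightarrow> 'a set \<Rightarrow> 'a set" where
  "cyl u c A = {y \<in> slab u. perp u y + c *\<^sub>R u \<in> A}"

lemma sets_cyl [measurable]:
  assumes [measurable]: "A \<in> sets borel"
  shows "cyl u c A \<in> sets borel"
  unfolding cyl_def by measurable

lemma cyl_UN: "cyl u c (\<Union>i\<in>I. A i) = (\<Union>i\<in>I. cyl u c (A i))"
  by (auto simp: cyl_def)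

lemma cyl_mono: "A \<subseteq> B \<Longrightarrow> cyl u c A \<subseteq> cyl u c B"
  by (auto simp: cyl_def)

lemma cyl_Diff: "cyl u c (A - B) = cyl u c A - cyl u c B"
  by (auto simp: cyl_def)

lemma disjoint_family_cyl: "disjoint_family A \<Longrightarrow> disjoint_family (\<lambda>i. cyl u c (A i))"
  by (auto simp: disjoint_family_on_def cyl_def)

lemma hausdorff_const_pos: "0 < hausdorff_const m"
  by (simp add: hausdorff_const_def)

text \<open>This is the effect of the normalisation: a set of diameter \<open>2 * r\<close> costs
  the volume of a ball of radius \<open>r\<close>. It makes the isodiametric bound and the packing
  by balls sharp with the same constant.\<close>

lemma hausdorff_const_mult: "hausdorff_const m * (2 * r) ^ m = unit_ball_vol (real m) * r ^ m"
  by (simp add: hausdorff_const_def power_mult_distrib)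

lemma hausdorff_term_le:
  assumes "bounded C" "diameter C \<le> d"
  shows "hausdorff_term m C \<le> ennreal (hausdorff_const m * d ^ m)"
proof -
  have "hausdorff_const m * diameter C ^ m \<le> hausdorff_const m * d ^ m"
    using assms hausdorff_const_pos[of m]
    by (intro mult_left_mono power_mono diameter_ge_0) auto
  then show ?thesis by (simp add: hausdorff_term_def ennreal_leI)
qed

lemma emeasure_cyl_le_hausdorff_pre:
  fixes e :: "'a::euclidean_space"
  assumes e: "e \<in> Basis" and A: "A \<in> sets borel"
  shows "emeasure lborel (cyl e c A) \<le> hausdorff_pre (DIM('a) - 1) \<delta> A"
  unfolding hausdorff_pre_def
proof (rule INF_greatest, clarify)
  fix C :: "nat \<Rightarrow> 'a set"
  assume C: "A \<subseteq> (\<Union>i. C i)" "\<forall>i. bounded (C i) \<and> diameter (C i) \<le> \<delta>"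
  \<comment> \<open>Covering sets are arbitrary; their closures are Borel and have the same
    diameter.\<close>
  have "A \<subseteq> (\<Union>i. closure (C i))"
    using C(1) closure_subset by blast
  then have "cyl e c A \<subseteq> (\<Union>i. cyl e c (closure (C i)))"
    by (auto simp: cyl_def)
  then have "emeasure lborel (cyl e c A) \<le> emeasure lborel (\<Union>i. cyl e c (closure (C i)))"
    by (intro emeasure_mono) auto
  also have "\<dots> \<le> (\<Sum>i. emeasure lborel (cyl e c (closure (C i))))"
    by (intro emeasure_subadditive_countably) auto
  also have "\<dots> \<le> (\<Sum>i. hausdorff_term (DIM('a) - 1) (C i))"
  proof (intro suminf_le)
    fix i
    show "emeasure lborel (cyl e c (closure (C i))) \<le> hausdorff_term (DIM('a) - 1) (C i)"
    \<comment> \<open>In dimension 1 the isodiametric bound equals 1 even for an empty set, whereas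
      the empty set has cost 0, so it is treated apart.\<close>
    proof (cases "C i = {}")
      case True
      then show ?thesis by (simp add: cyl_def)
    next
      case False
      have bd: "bounded (closure (C i))" using C(2) by auto
      have "emeasure lborel (cyl e c (closure (C i))) \<le>
         ennreal (unit_ball_vol (real (DIM('a) - 1)) * (diameter (C i) / 2) ^ (DIM('a) - 1))"
      proof (rule isodiametric_slab[OF e])
        fix y z assume "y \<in> cyl e c (closure (C i))" "z \<in> cyl e c (closure (C i))"
        then have "dist (perp e y + c *\<^sub>R e) (perp e z + c *\<^sub>R e) \<le> diameter (closure (C i))"
          using bd by (intro diameter_bounded_bound) (auto simp: cyl_def)
        then show "norm (perp e (y - z)) \<le> diameter (C i)"
          using C(2) by (simp add: perp_diff dist_norm diameter_closure)
      qed (auto intro!: sets_cyl, auto simp: cyl_def)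
      also have "\<dots> = hausdorff_term (DIM('a) - 1) (C i)"
        using False hausdorff_const_mult[of "DIM('a) - 1" "diameter (C i) / 2"] by (simp add: hausdorff_term_def)
      finally show ?thesis .
    qed
  qed auto
  finally show "emeasure lborel (cyl e c A) \<le> (\<Sum>i. hausdorff_term (DIM('a) - 1) (C i))" .
qed

section \<open>Dyadic cubes in a hyperplane\<close>

text \<open>Padding with the empty set covers finite families; the injective numbering
  \<open>to_nat_on\<close> prevents a nonempty member from occurring twice, which would break
  disjointness of the sequence.\<close>

lemma disjoint_countable_enumeration:
  assumes "countable F" "disjoint F"
  obtains A :: "nat \<Rightarrow> 'a set" where "disjoint_family A" "(\<Union>n. A n) = \<Union>F" "\<And>n. A n \<in> insert {} F"
proof
  define A where "A n = (if n \<in> to_nat_on F ` F then from_nat_into F n else {})" for n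
  have A: "A (to_nat_on F S) = S" if "S \<in> F" for S
    using that assms by (simp add: A_def)
  show mem: "A n \<in> insert {} F" for n
    using assms by (auto simp: A_def)
  have idx: "n = to_nat_on F (A n)" if "A n \<noteq> {}" for n
  proof -
    have "n \<in> to_nat_on F ` F" using that by (auto simp: A_def split: if_splits)
    then obtain S where "S \<in> F" "n = to_nat_on F S" by auto
    then show ?thesis using A by simp
  qed
  show "(\<Union>n. A n) = \<Union>F"
  proof (intro set_eqI iffI)
    fix x assume "x \<in> \<Union>F"
    then obtain S where "S \<in> F" "x \<in> S" by auto
    then show "x \<in> (\<Union>n. A n)" using A by (intro UN_I[of "to_nat_on F S"]) auto
  qed (use mem in blast)
  show "disjoint_family A"
    unfolding disjoint_family_on_def
  proof (intro ballI impI)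
    fix m n :: nat assume "m \<noteq> n"
    show "A m \<inter> A n = {}"
    proof (cases "A m = {} \<or> A n = {}")
      case False
      then have "A m \<noteq> A n" using idx \<open>m \<noteq> n\<close> by metis
      then show ?thesis using mem[of m] mem[of n] False assms(2) by (auto dest: disjointD)
    qed auto
  qed
qed

text \<open>The half-open cube of side \<open>1 / 2^k\<close> inside the hyperplane at height
  \<open>c\<close> whose other coordinates match those of \<open>y\<close> up to rounding. Floors
  make the cubes of one level a partition and reduce nesting to an identity for
  \<open>\<lfloor>2 * a\<rfloor>\<close>.\<close>

definition dyadic :: "'a::euclidean_space \<Rightarrow> real \<Rightarrow> nat \<Rightarrow> 'a \<Rightarrow> 'a set" where
  "dyadic e c k y = {z. z \<bullet> e = c \<and> (\<forall>b\<in>Basis - {e}. \<lfloor>2^k * (z \<bullet> b)\<rfloor> = \<lfloor>2^k * (y \<bullet> b)\<rfloor>)}"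

lemma dyadic_self: "y \<bullet> e = c \<Longrightarrow> y \<in> dyadic e c k y"
  by (simp add: dyadic_def)

lemma dyadic_eq: "z \<in> dyadic e c k y \<Longrightarrow> dyadic e c k z = dyadic e c k y"
  by (auto simp: dyadic_def)

lemma floor_eq_of_floor_double_eq:
  fixes a b :: real
  assumes "\<lfloor>2 * a\<rfloor> = \<lfloor>2 * b\<rfloor>"
  shows "\<lfloor>a\<rfloor> = \<lfloor>b\<rfloor>"
proof -
  have "\<lfloor>x\<rfloor> = \<lfloor>2 * x\<rfloor> div 2" for x :: real
    using floor_divide_real_eq_div[of 2 "2 * x"] by simp
  then show ?thesis using assms by metis
qed

lemma dyadic_antimono:
  assumes "k \<le> l"
  shows "dyadic e c l y \<subseteq> dyadic e c k y"
  using assms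
proof (induction l rule: dec_induct)
  case (step l)
  have "dyadic e c (Suc l) y \<subseteq> dyadic e c l y"
  proof
    fix z assume z: "z \<in> dyadic e c (Suc l) y"
    have "\<lfloor>2^l * (z \<bullet> b)\<rfloor> = \<lfloor>2^l * (y \<bullet> b)\<rfloor>" if "b \<in> Basis - {e}" for b
    proof -
      have "\<lfloor>2 ^ Suc l * (z \<bullet> b)\<rfloor> = \<lfloor>2 ^ Suc l * (y \<bullet> b)\<rfloor>"
        using z that unfolding dyadic_def by blast
      then have "\<lfloor>2 * (2 ^ l * (z \<bullet> b))\<rfloor> = \<lfloor>2 * (2 ^ l * (y \<bullet> b))\<rfloor>"
        by (simp only: power_Suc mult.assoc)
      then show ?thesis by (rule floor_eq_of_floor_double_eq)
    qed
    then show "z \<in> dyadic e c l y" using z unfolding dyadic_def by blast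
  qed
  with step show ?case by blast
qed simp

lemma dyadic_dist:
  assumes e: "e \<in> Basis" and "z \<in> dyadic e c k y" "w \<in> dyadic e c k y"
  shows "dist (z::'a::euclidean_space) w \<le> DIM('a) / 2^k"
proof -
  have *: "\<bar>(z - w) \<bullet> b\<bar> \<le> 1 / 2^k" if "b \<in> Basis" for b
  proof (cases "b = e")
    case True
    then show ?thesis using assms by (simp add: dyadic_def inner_diff_left)
  next
    case False
    then have "\<lfloor>2^k * (z \<bullet> b)\<rfloor> = \<lfloor>2^k * (w \<bullet> b)\<rfloor>" using assms that by (simp add: dyadic_def)
    then have "\<bar>2^k * (z \<bullet> b) - 2^k * (w \<bullet> b)\<bar> \<le> 1" by linarith
    then have "2^k * \<bar>(z - w) \<bullet> b\<bar> \<le> 1"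
      by (simp add: inner_diff_left abs_mult flip: right_diff_distrib)
    then show ?thesis by (simp add: field_simps)
  qed
  have "norm (z - w) \<le> (\<Sum>b\<in>Basis. \<bar>(z - w) \<bullet> b\<bar>)" by (rule norm_le_l1)
  also have "\<dots> \<le> (\<Sum>b\<in>(Basis::'a set). 1 / 2^k)" by (intro sum_mono *)
  finally show ?thesis by (simp add: dist_norm)
qed

lemma sets_dyadic [measurable]: "dyadic e c k y \<in> sets borel"
proof -
  have "dyadic e c k y = {z. z \<bullet> e = c} \<inter> (\<Inter>b\<in>insert e Basis - {e}. {z. \<lfloor>2^k * (z \<bullet> b)\<rfloor> = \<lfloor>2^k * (y \<bullet> b)\<rfloor>}) "
    by (auto simp: dyadic_def)
  moreover have "{z. z \<bullet> e = c} \<in> sets borel" by measurable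
  moreover have "{z. \<lfloor>2^k * (z \<bullet> b)\<rfloor> = \<lfloor>2^k * (y \<bullet> b)\<rfloor>} \<in> sets borel" for b
    by measurable
  ultimately show ?thesis
    by (cases "Basis - {e} = {}") (auto intro!: sets.Int sets.finite_INT)
qed

lemma countable_dyadic: "countable (range (dyadic (e::'a::euclidean_space) c k))"
proof -
  let ?P = "PiE (Basis - {e}) (\<lambda>_. UNIV :: int set)"
  have "countable ?P" by (intro countable_PiE) auto
  moreover have "range (dyadic e c k) \<subseteq>
     (\<lambda>f. {z. z \<bullet> e = c \<and> (\<forall>b\<in>Basis - {e}. \<lfloor>2^k * (z \<bullet> b)\<rfloor> = f b)}) ` ?P"
  proof clarify
    fix y
    show "dyadic e c k y \<in> (\<lambda>f. {z. z \<bullet> e = c \<and> (\<forall>b\<in>Basis - {e}. \<lfloor>2^k * (z \<bullet> b)\<rfloor> = f b)}) ` ?P"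
      by (rule image_eqI[of _ _ "\<lambda>b\<in>Basis - {e}. \<lfloor>2^k * (y \<bullet> b)\<rfloor>"]) (auto simp: dyadic_def)
  qed
  ultimately show ?thesis by (meson countable_image countable_subset)
qed

text \<open>The set lies between an open and a closed box with the same corners, of side 1 along
  \<open>e\<close> and \<open>1 / 2^k\<close> in the other directions; the two boxes have equal
  volume.\<close>

lemma emeasure_cyl_dyadic:
  fixes e :: "'a::euclidean_space"
  assumes e: "e \<in> Basis"
  shows "emeasure lborel (cyl e c (dyadic e c k y)) = ennreal ((1 / 2^k) ^ (DIM('a) - 1))"
proof -
  define l where "l = (\<Sum>b\<in>Basis. (if b = e then 0 else \<lfloor>2^k * (y \<bullet> b)\<rfloor> / 2^k) *\<^sub>R b)"
  define u where "u = (\<Sum>b\<in>Basis. (if b = e then 1 else (\<lfloor>2^k * (y \<bullet> b)\<rfloor> + 1) / 2^k) *\<^sub>R b)"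
  have lb: "l \<bullet> b = (if b = e then 0 else \<lfloor>2^k * (y \<bullet> b)\<rfloor> / 2^k)"
    and ub: "u \<bullet> b = (if b = e then 1 else (\<lfloor>2^k * (y \<bullet> b)\<rfloor> + 1) / 2^k)" if "b \<in> Basis" for b
    using that by (simp_all add: l_def u_def)
  have in_cyl: "z \<in> cyl e c (dyadic e c k y) \<longleftrightarrow> 0 \<le> z \<bullet> e \<and> z \<bullet> e \<le> 1 \<and>
     (\<forall>b\<in>Basis - {e}. l \<bullet> b \<le> z \<bullet> b \<and> z \<bullet> b < u \<bullet> b)" for z
  proof -
    have "(perp e z + c *\<^sub>R e) \<bullet> e = c" using e by (simp add: inner_add_left inner_perp_self)
    moreover have "(perp e z + c *\<^sub>R e) \<bullet> b = z \<bullet> b" if "b \<in> Basis - {e}" for b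
    proof -
      have "e \<bullet> b = 0" using e that by (auto simp: inner_Basis)
      then show ?thesis by (simp add: inner_add_left inner_perp_orth)
    qed
    moreover have "\<lfloor>2^k * (z \<bullet> b)\<rfloor> = \<lfloor>2^k * (y \<bullet> b)\<rfloor> \<longleftrightarrow> l \<bullet> b \<le> z \<bullet> b \<and> z \<bullet> b < u \<bullet> b" if "b \<in> Basis - {e}" for b
      using that by (simp add: lb ub floor_eq_iff field_simps)
    ultimately show ?thesis by (auto simp: cyl_def dyadic_def slab_def)
  qed
  have ux: "u \<bullet> b - l \<bullet> b = (if b = e then 1 else 1 / 2^k)" if "b \<in> Basis" for b
    using that by (simp add: lb ub add_divide_distrib)
  have le: "l \<bullet> b \<le> u \<bullet> b" if "b \<in> Basis" for b using ux[OF that] by (smt (verit) divide_pos_pos zero_less_power)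
  have "(\<Prod>b\<in>Basis. (u - l) \<bullet> b) = (\<Prod>b\<in>Basis. if b = e then 1 else 1 / 2^k)"
    by (intro prod.cong) (auto simp: inner_diff_left ux)
  also have "\<dots> = (1 / 2^k) ^ (DIM('a) - 1)"
    using e by (simp add: prod.If_cases Diff_eq[symmetric] Collect_neg_eq Int_commute card_Diff_singleton prod.remove[of _ e])
  finally have vol: "(\<Prod>b\<in>Basis. (u - l) \<bullet> b) = (1 / 2^k) ^ (DIM('a) - 1)" .
  have "box l u \<subseteq> cyl e c (dyadic e c k y)"
  proof
    fix z assume "z \<in> box l u"
    then have "\<forall>b\<in>Basis. l \<bullet> b < z \<bullet> b \<and> z \<bullet> b < u \<bullet> b" by (simp add: mem_box)
    then show "z \<in> cyl e c (dyadic e c k y)" unfolding in_cyl using e lb[OF e] ub[OF e]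
      by (auto intro: less_imp_le)
  qed
  moreover have "cyl e c (dyadic e c k y) \<subseteq> cbox l u"
  proof
    fix z assume z: "z \<in> cyl e c (dyadic e c k y)"
    show "z \<in> cbox l u" unfolding mem_box
    proof
      fix b :: 'a assume "b \<in> Basis"
      then show "l \<bullet> b \<le> z \<bullet> b \<and> z \<bullet> b \<le> u \<bullet> b"
        using z e lb[of e] ub[of e] unfolding in_cyl by (cases "b = e") (auto intro: less_imp_le)
    qed
  qed
  ultimately have "emeasure lborel (box l u) \<le> emeasure lborel (cyl e c (dyadic e c k y))"
    "emeasure lborel (cyl e c (dyadic e c k y)) \<le> emeasure lborel (cbox l u)"
    by (auto intro!: emeasure_mono)
  then show ?thesis using le vol by simp
qed

text \<open>Decompose \<open>S\<close> into its maximal dyadic cubes of level at least \<open>k0\<close>.\<close>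
lemma hausdorff_pre_le_of_dyadic:
  fixes e :: "'a::euclidean_space"
  assumes e: "e \<in> Basis" and S: "S \<in> sets borel" "\<And>y. y \<in> S \<Longrightarrow> y \<bullet> e = c"
    and op: "\<And>y. y \<in> S \<Longrightarrow> \<exists>l\<ge>k0. dyadic e c l y \<subseteq> S" and \<delta>: "0 \<le> \<delta>"
    and K: "\<And>l y. k0 \<le> l \<Longrightarrow> y \<bullet> e = c \<Longrightarrow> hausdorff_pre m \<delta> (dyadic e c l y) \<le> K * emeasure lborel (cyl e c (dyadic e c l y))"
  shows "hausdorff_pre m \<delta> S \<le> K * emeasure lborel (cyl e c S)"
proof -
  define lev where "lev y = (LEAST l. k0 \<le> l \<and> dyadic e c l y \<subseteq> S)" for y
  have lev: "k0 \<le> lev y" "dyadic e c (lev y) y \<subseteq> S" if "y \<in> S" for y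
    using LeastI_ex[of "\<lambda>l. k0 \<le> l \<and> dyadic e c l y \<subseteq> S"] op[OF that] unfolding lev_def by auto
  have lev_le: "lev y \<le> l" if "k0 \<le> l" "dyadic e c l y \<subseteq> S" for l y
    unfolding lev_def using that by (intro Least_le) auto
  define F where "F = (\<lambda>y. dyadic e c (lev y) y) ` S"
  have "F \<subseteq> (\<Union>l. range (dyadic e c l))" by (auto simp: F_def)
  then have "countable F" by (rule countable_subset) (auto intro: countable_dyadic)
  \<comment> \<open>If two selected cubes meet, the coarser one contains the base point of the
    other. It is then an admissible cube for that point as well, and minimality of the level makes
    the two equal.\<close>
  have main: "dyadic e c (lev y) y = dyadic e c (lev w) w"
    if y: "y \<in> S" and w: "w \<in> S" and z: "z \<in> dyadic e c (lev y) y" "z \<in> dyadic e c (lev w) w" and le: "lev y \<le> lev w" for y w z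
  proof -
    have "z \<in> dyadic e c (lev y) w" using z(2) dyadic_antimono[OF le] by blast
    then have eq: "dyadic e c (lev y) w = dyadic e c (lev y) y" using z(1) by (metis dyadic_eq)
    then have "dyadic e c (lev y) w \<subseteq> S" using lev y by simp
    then have "lev w \<le> lev y" using lev(1)[OF y] by (intro lev_le)
    with le eq show ?thesis by simp
  qed
  have "disjoint F"
  proof (rule disjointI)
    fix a b assume "a \<in> F" "b \<in> F" "a \<noteq> b"
    then obtain y w where yw: "y \<in> S" "w \<in> S" "a = dyadic e c (lev y) y" "b = dyadic e c (lev w) w"
      by (auto simp: F_def)
    show "a \<inter> b = {}"
    proof (rule ccontr)
      assume "a \<inter> b \<noteq> {}"
      then obtain z where "z \<in> a" "z \<in> b" by auto
      then show False
        using main[of y w z] main[of w y z] yw \<open>a \<noteq> b\<close> by (metis linear)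
    qed
  qed
  have UF: "\<Union>F = S"
  proof
    show "\<Union>F \<subseteq> S" using lev(2) unfolding F_def by blast
    show "S \<subseteq> \<Union>F"
    proof
      fix y assume "y \<in> S"
      then show "y \<in> \<Union>F" unfolding F_def using dyadic_self[OF S(2)] by (intro UnionI[OF imageI])
    qed
  qed
  obtain A :: "nat \<Rightarrow> 'a set" where A: "disjoint_family A" "(\<Union>n. A n) = S" "\<And>n. A n \<in> insert {} F"
    using disjoint_countable_enumeration[OF \<open>countable F\<close> \<open>disjoint F\<close>] UF by metis
  have Ab: "A n \<in> sets borel" for n using A(3)[of n] by (auto simp: F_def)
  have "hausdorff_pre m \<delta> S \<le> (\<Sum>n. hausdorff_pre m \<delta> (A n))"
    using hausdorff_pre_countably_subadditive[of m \<delta> A] A(2) by simp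
  also have "\<dots> \<le> (\<Sum>n. K * emeasure lborel (cyl e c (A n)))"
  proof (intro suminf_le)
    fix n
    show "hausdorff_pre m \<delta> (A n) \<le> K * emeasure lborel (cyl e c (A n))"
      using A(3)[of n] K lev S(2) by (auto simp: F_def hausdorff_pre_empty[OF \<delta>])
  qed auto
  also have "\<dots> = K * emeasure lborel (\<Union>n. cyl e c (A n))"
    using A(1) Ab by (subst suminf_emeasure[symmetric]) (auto intro: disjoint_family_cyl)
  also have "\<dots> = K * emeasure lborel (cyl e c S)"
    using A(2) by (simp flip: cyl_UN)
  finally show ?thesis .
qed

lemma emeasure_cyl_ball:
  fixes e q :: "'a::euclidean_space"
  assumes e: "e \<in> Basis" and r: "0 < r" and q: "q \<bullet> e = c"
  shows "emeasure lborel (cyl e c {z. z \<bullet> e = c \<and> dist z q \<le> r}) =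
    ennreal (unit_ball_vol (real (DIM('a) - 1)) * r ^ (DIM('a) - 1))"
proof -
  have ee: "norm e = 1" "e \<bullet> e = 1" using e by (auto simp: norm_eq_1[symmetric])
  have "q = perp e q + c *\<^sub>R e" using perp_decomp[of e q] q by simp
  then have "dist (perp e y + c *\<^sub>R e) q = norm (perp e y - perp e q)" for y
    by (metis add_diff_cancel_right dist_norm)
  \<comment> \<open>A translation orthogonal to \<open>e\<close> preserves the slab and moves the
    centre onto the axis.\<close>
  then have "(\<lambda>y. - perp e q + y) -` {y\<in>slab e. norm (perp e y) \<le> r} = cyl e c {z. z \<bullet> e = c \<and> dist z q \<le> r}"
    using ee by (auto simp: cyl_def slab_def inner_add_left inner_diff_left inner_perp_self perp_diff perp_idem)
  then have "emeasure lborel (cyl e c {z. z \<bullet> e = c \<and> dist z q \<le> r}) =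
     emeasure (distr lborel borel ((+) (- perp e q))) {y\<in>slab e. norm (perp e y) \<le> r}"
    by (subst emeasure_distr) auto
  then show ?thesis
    using emeasure_ball_cylinder[OF e r] by (simp add: lborel_distr_plus)
qed

lemma dyadic_contains_ball:
  fixes e :: "'a::euclidean_space"
  assumes e: "e \<in> Basis"
  obtains q where "q \<bullet> e = c" "{z. z \<bullet> e = c \<and> dist z q \<le> 1 / 2^l / 4} \<subseteq> dyadic e c l y"
proof
  \<comment> \<open>The centre of the cube, hence the \<open>1/2\<close>. A radius of a quarter of
    the side, instead of half, keeps the closed ball inside the half-open cube.\<close>
  define q where "q = (\<Sum>b\<in>Basis. (if b = e then c else (\<lfloor>2^l * (y \<bullet> b)\<rfloor> + 1/2) / 2^l) *\<^sub>R b)"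
  have qb: "q \<bullet> b = (if b = e then c else (\<lfloor>2^l * (y \<bullet> b)\<rfloor> + 1/2) / 2^l)" if "b \<in> Basis" for b
    using that by (simp add: q_def)
  then show "q \<bullet> e = c" using e by simp
  show "{z. z \<bullet> e = c \<and> dist z q \<le> 1 / 2^l / 4} \<subseteq> dyadic e c l y"
  proof clarify
    fix z assume z: "dist z q \<le> 1 / 2^l / 4" "c = z \<bullet> e"
    have "\<lfloor>2^l * (z \<bullet> b)\<rfloor> = \<lfloor>2^l * (y \<bullet> b)\<rfloor>" if b: "b \<in> Basis" "b \<noteq> e" for b
    proof -
      have "\<bar>(z - q) \<bullet> b\<bar> \<le> norm (z - q)" using b by (intro Basis_le_norm)
      then have "\<bar>(z - q) \<bullet> b\<bar> \<le> 1 / 2^l / 4" using z by (simp add: dist_norm)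
      then have "\<bar>2^l * (z \<bullet> b) - 2^l * (q \<bullet> b)\<bar> \<le> 1/4"
      proof -
        have "2^l * (z \<bullet> b) - 2^l * (q \<bullet> b) = 2^l * ((z - q) \<bullet> b)"
          by (simp add: inner_diff_left right_diff_distrib)
        then have "\<bar>2^l * (z \<bullet> b) - 2^l * (q \<bullet> b)\<bar> = 2^l * \<bar>(z - q) \<bullet> b\<bar>"
          by (simp add: abs_mult)
        also have "\<dots> \<le> 2^l * (1 / 2^l / 4)"
          using \<open>\<bar>(z - q) \<bullet> b\<bar> \<le> 1 / 2^l / 4\<close> by (intro mult_left_mono) auto
        finally show ?thesis by simp
      qed
      moreover have "2^l * (q \<bullet> b) = \<lfloor>2^l * (y \<bullet> b)\<rfloor> + 1/2" using b by (simp add: qb)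
      ultimately show ?thesis by linarith
    qed
    then show "z \<in> dyadic e (z \<bullet> e) l y" by (auto simp: dyadic_def)
  qed
qed

text \<open>A cube contains a ball occupying a fixed proportion \<open>\<theta>\<close> of it, whose cost equals its volume;
  covering the remainder by smaller cubes improves the constant \<open>1 + a\<close> to \<open>1 + (1 - \<theta>) a\<close>.\<close>
lemma hausdorff_pre_dyadic_improve:
  fixes e :: "'a::euclidean_space"
  assumes e: "e \<in> Basis" and \<delta>: "DIM('a) / 2^k0 \<le> \<delta>" and a: "0 \<le> a"
    and valid: "\<And>l y. k0 \<le> l \<Longrightarrow> y \<bullet> e = c \<Longrightarrow>
      hausdorff_pre (DIM('a) - 1) \<delta> (dyadic e c l y) \<le> ennreal (1 + a) * emeasure lborel (cyl e c (dyadic e c l y))"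
    and th: "\<theta> = unit_ball_vol (real (DIM('a) - 1)) / 4 ^ (DIM('a) - 1)"
    and l: "k0 \<le> l" and y: "y \<bullet> e = c"
  shows "\<theta> \<le> 1"
    "hausdorff_pre (DIM('a) - 1) \<delta> (dyadic e c l y) \<le> ennreal (1 + (1 - \<theta>) * a) * emeasure lborel (cyl e c (dyadic e c l y))"
proof -
  let ?m = "DIM('a) - 1"
  let ?Q = "dyadic e c l y"
  define v where "v = (1 / 2^l :: real) ^ ?m"
  have v: "0 < v" "emeasure lborel (cyl e c ?Q) = ennreal v"
    using e by (simp_all add: v_def emeasure_cyl_dyadic)
  have th0: "0 < \<theta>" by (simp add: th)
  have \<delta>0: "0 < \<delta>" using \<delta> by (smt (verit) DIM_positive divide_pos_pos of_nat_0_less_iff zero_less_power)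
  obtain q where q: "q \<bullet> e = c" "{z. z \<bullet> e = c \<and> dist z q \<le> 1 / 2^l / 4} \<subseteq> ?Q"
    using dyadic_contains_ball[OF e] by metis
  define r :: real where "r = 1 / 2^l / 4"
  define B where "B = {z. z \<bullet> e = c \<and> dist z q \<le> r}"
  have r: "0 < r" by (simp add: r_def)
  have BQ: "B \<subseteq> ?Q" using q(2) by (simp add: B_def r_def)
  have Bb [measurable]: "B \<in> sets borel"
    unfolding B_def by measurable
  have vB0: "emeasure lborel (cyl e c B) = ennreal (unit_ball_vol (real ?m) * r ^ ?m)"
    unfolding B_def by (rule emeasure_cyl_ball[OF e r q(1)])
  \<comment> \<open>Since \<open>r\<close> is a quarter of the side, the ratio of ball to cube is
    the same at every level; this is the \<open>\<theta>\<close> of the hypothesis.\<close>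
  have tv: "unit_ball_vol (real ?m) * r ^ ?m = \<theta> * v"
    by (simp add: th v_def r_def power_divide power_mult_distrib)
  have vB: "emeasure lborel (cyl e c B) = ennreal (\<theta> * v)" using vB0 tv by simp
  have "emeasure lborel (cyl e c B) \<le> emeasure lborel (cyl e c ?Q)"
    by (intro emeasure_mono cyl_mono BQ) auto
  then have "\<theta> * v \<le> v" using v vB by (simp add: ennreal_le_iff)
  then show th1: "\<theta> \<le> 1" using v by simp
  have HB: "hausdorff_pre ?m \<delta> B \<le> ennreal (\<theta> * v)"
  proof -
    have bB: "bounded B" unfolding B_def bounded_def by (rule exI[of _ q]) (auto simp: dist_commute)
    have "dist z w \<le> 2 * r" if "z \<in> B" "w \<in> B" for z w
      using that dist_triangle2[of z w q] by (auto simp: B_def)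
    then have dB: "diameter B \<le> 2 * r"
      using r by (intro diameter_le) (auto simp: dist_norm)
    have "2 * r \<le> 1 / 2^l" by (simp add: r_def field_simps)
    also have "\<dots> \<le> 1 / 2^k0" using l by (simp add: field_simps)
    also have "\<dots> \<le> DIM('a) / 2^k0" by (intro divide_right_mono) (auto simp: Suc_le_eq)
    finally have "2 * r \<le> \<delta>" using \<delta> by simp
    then have "hausdorff_pre ?m \<delta> B \<le> hausdorff_term ?m B"
      using bB dB \<delta>0 by (intro hausdorff_pre_le_term) auto
    also have "\<dots> \<le> ennreal (hausdorff_const ?m * (2 * r) ^ ?m)"
      using dB bB by (rule hausdorff_term_le[rotated])
    also have "\<dots> = ennreal (\<theta> * v)" by (simp only: hausdorff_const_mult tv)
    finally show ?thesis .
  qed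
  \<comment> \<open>\<open>B\<close> is closed in the hyperplane, so a sufficiently fine dyadic cube
    around any point of the cube outside \<open>B\<close> avoids \<open>B\<close>, and nesting keeps
    it within the cube. The remainder thus splits into cubes to which \<open>valid\<close>
    applies.\<close>
  have HS: "hausdorff_pre ?m \<delta> (?Q - B) \<le> ennreal (1 + a) * emeasure lborel (cyl e c (?Q - B))"
  proof (rule hausdorff_pre_le_of_dyadic[OF e])
    show "?Q - B \<in> sets borel" by measurable
    show "z \<bullet> e = c" if "z \<in> ?Q - B" for z using that by (auto simp: dyadic_def)
    show "\<exists>j\<ge>k0. dyadic e c j z \<subseteq> ?Q - B" if z: "z \<in> ?Q - B" for z
    proof -
      have ze: "z \<bullet> e = c" using z by (auto simp: dyadic_def)
      then have "0 < dist z q - r" using z by (auto simp: B_def)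
      then obtain N where N: "inverse (real (Suc N)) < (dist z q - r) / DIM('a)"
        using reals_Archimedean[of "(dist z q - r) / DIM('a)"] by auto
      define j where "j = max l (Suc N)"
      have "real (Suc N) \<le> 2 ^ j"
      proof -
        have "real (Suc N) \<le> 2 ^ Suc N" using of_nat_less_two_power[of "Suc N"] by (metis less_imp_le)
        also have "(2::real) ^ Suc N \<le> 2 ^ j" unfolding j_def by (intro power_increasing) auto
        finally show ?thesis .
      qed
      then have "1 / 2^j \<le> inverse (real (Suc N))" by (simp add: field_simps)
      with N have "1 / 2^j < (dist z q - r) / DIM('a)" by simp
      then have small: "DIM('a) / 2^j < dist z q - r" by (simp add: field_simps)
      have "dyadic e c j z \<subseteq> dyadic e c l z" by (rule dyadic_antimono) (simp add: j_def)
      also have "\<dots> = ?Q" using z by (intro dyadic_eq) auto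
      finally have "dyadic e c j z \<subseteq> ?Q" .
      moreover have "w \<notin> B" if "w \<in> dyadic e c j z" for w
        using dyadic_dist[OF e that dyadic_self[OF ze]] small dist_triangle[of z q w]
        by (auto simp: B_def dist_commute)
      ultimately show ?thesis using l by (intro exI[of _ j]) (auto simp: j_def)
    qed
  qed (use valid \<delta>0 in auto)
  have "emeasure lborel (cyl e c (?Q - B)) = ennreal (v - \<theta> * v)"
    unfolding cyl_Diff using cyl_mono[OF BQ, of e c] v vB th0
    by (subst emeasure_Diff) (auto simp: ennreal_minus)
  with HS have HS': "hausdorff_pre ?m \<delta> (?Q - B) \<le> ennreal ((1 + a) * (v - \<theta> * v))"
    using a th1 v by (simp add: ennreal_mult)
  have "hausdorff_pre ?m \<delta> ?Q \<le> hausdorff_pre ?m \<delta> B + hausdorff_pre ?m \<delta> (?Q - B)"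
  proof -
    let ?C = "\<lambda>n::nat. if n = 0 then B else if n = 1 then ?Q - B else {}"
    have "?Q = (\<Union>n. ?C n)" using BQ by (auto split: if_splits)
    then have "hausdorff_pre ?m \<delta> ?Q \<le> (\<Sum>n. hausdorff_pre ?m \<delta> (?C n))"
      using hausdorff_pre_countably_subadditive[of ?m \<delta> ?C] by simp
    also have "\<dots> = hausdorff_pre ?m \<delta> B + hausdorff_pre ?m \<delta> (?Q - B)"
      using \<delta>0 by (subst suminf_finite[of "{0,1}"]) (auto simp: hausdorff_pre_empty)
    finally show ?thesis .
  qed
  also have "\<dots> \<le> ennreal (\<theta> * v) + ennreal ((1 + a) * (v - \<theta> * v))"
    by (intro add_mono HB HS')
  also have "\<dots> = ennreal (\<theta> * v + (1 + a) * (v - \<theta> * v))"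
    using th0 th1 v a by (intro ennreal_plus[symmetric]) (auto intro!: mult_nonneg_nonneg)
  also have "\<theta> * v + (1 + a) * (v - \<theta> * v) = (1 + (1 - \<theta>) * a) * v"
    by (simp add: algebra_simps)
  also have "ennreal \<dots> = ennreal (1 + (1 - \<theta>) * a) * emeasure lborel (cyl e c ?Q)"
    using th1 a v by (simp add: ennreal_mult)
  finally show "hausdorff_pre ?m \<delta> ?Q \<le> ennreal (1 + (1 - \<theta>) * a) * emeasure lborel (cyl e c ?Q)" .
qed

text \<open>Starting from a crude constant \<open>1 + K\<close>, each improvement multiplies the
  excess over 1 by \<open>1 - \<theta> < 1\<close>; in the limit the constant is 1.\<close>

lemma hausdorff_pre_dyadic_le:
  fixes e :: "'a::euclidean_space"
  assumes e: "e \<in> Basis" and \<delta>: "DIM('a) / 2^k0 \<le> \<delta>" and l: "k0 \<le> l" and y: "y \<bullet> e = c"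
  shows "hausdorff_pre (DIM('a) - 1) \<delta> (dyadic e c l y) \<le> emeasure lborel (cyl e c (dyadic e c l y))"
proof -
  let ?m = "DIM('a) - 1"
  define \<theta> where "\<theta> = unit_ball_vol (real ?m) / 4 ^ ?m"
  have th0: "0 < \<theta>" by (simp add: \<theta>_def)
  \<comment> \<open>From the crude estimate: a cube of side \<open>1 / 2^j\<close> has diameter at
    most \<open>DIM('a) / 2^j\<close>, so using it as its own cover costs at most \<open>K\<close>
    times its volume.\<close>
  define K where "K = hausdorff_const ?m * real DIM('a) ^ ?m"
  have K0: "0 \<le> K" unfolding K_def using hausdorff_const_pos[of ?m] by (intro mult_nonneg_nonneg) auto
  have \<delta>0: "0 < \<delta>" using \<delta> by (smt (verit) DIM_positive divide_pos_pos of_nat_0_less_iff zero_less_power)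
  have base: "hausdorff_pre ?m \<delta> (dyadic e c j z) \<le> ennreal (1 + K) * emeasure lborel (cyl e c (dyadic e c j z))"
    if "k0 \<le> j" for j z
  proof -
    let ?Q = "dyadic e c j z"
    have bQ: "bounded ?Q" unfolding bounded_two_points using dyadic_dist[OF e] by blast
    have dQ: "diameter ?Q \<le> DIM('a) / 2^j"
      using dyadic_dist[OF e, of _ c j z] by (intro diameter_le) (auto simp: dist_norm)
    have "DIM('a) / 2^j \<le> DIM('a) / 2^k0" using that by (intro divide_left_mono power_increasing) auto
    then have "hausdorff_pre ?m \<delta> ?Q \<le> hausdorff_term ?m ?Q"
      using bQ dQ \<delta> \<delta>0 by (intro hausdorff_pre_le_term) auto
    also have "\<dots> \<le> ennreal (hausdorff_const ?m * (DIM('a) / 2^j) ^ ?m)"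
      using dQ bQ by (rule hausdorff_term_le[rotated])
    also have "hausdorff_const ?m * (DIM('a) / 2^j) ^ ?m = K * (1 / 2^j) ^ ?m"
      by (simp add: K_def power_divide)
    also have "ennreal \<dots> \<le> ennreal ((1 + K) * (1 / 2^j) ^ ?m)"
      by (intro ennreal_leI mult_right_mono) auto
    also have "\<dots> = ennreal (1 + K) * emeasure lborel (cyl e c ?Q)"
      using K0 by (simp add: emeasure_cyl_dyadic[OF e] ennreal_mult)
    finally show ?thesis .
  qed
  have th1: "\<theta> \<le> 1"
    by (rule hausdorff_pre_dyadic_improve(1)[OF e \<delta> K0 base \<theta>_def l y])
  have iter: "hausdorff_pre ?m \<delta> (dyadic e c j z) \<le> ennreal (1 + (1 - \<theta>) ^ n * K) * emeasure lborel (cyl e c (dyadic e c j z))"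
    if "k0 \<le> j" "z \<bullet> e = c" for n j z
    using that
  proof (induction n arbitrary: j z)
    case 0
    then show ?case using base by simp
  next
    case (Suc n)
    have "hausdorff_pre ?m \<delta> (dyadic e c j z) \<le> ennreal (1 + (1 - \<theta>) * ((1 - \<theta>) ^ n * K)) * emeasure lborel (cyl e c (dyadic e c j z))"
      by (rule hausdorff_pre_dyadic_improve(2)[OF e \<delta> _ _ \<theta>_def]) (use Suc th1 K0 in auto)
    then show ?case by (simp add: mult.assoc)
  qed
  define v where "v = (1 / 2^l :: real) ^ ?m"
  have v: "0 \<le> v" "emeasure lborel (cyl e c (dyadic e c l y)) = ennreal v"
    using e by (simp_all add: v_def emeasure_cyl_dyadic)
  have "hausdorff_pre ?m \<delta> (dyadic e c l y) \<le> ennreal ((1 + (1 - \<theta>) ^ n * K) * v)" for n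
    using iter[OF l y, of n] th1 K0 v by (simp add: ennreal_mult)
  moreover have "(\<lambda>n. ennreal ((1 + (1 - \<theta>) ^ n * K) * v)) \<longlonglongrightarrow> ennreal ((1 + 0 * K) * v)"
    using th0 th1 by (intro tendsto_intros tendsto_ennrealI LIMSEQ_realpow_zero) auto
  ultimately have "hausdorff_pre ?m \<delta> (dyadic e c l y) \<le> ennreal ((1 + 0 * K) * v)"
    by (intro LIMSEQ_le_const) auto
  then show ?thesis using v by simp
qed

text \<open>The bound with constant 1 is available only for cubes small compared with
  \<open>\<delta>\<close>. A larger cube is cut into such cubes, at no loss, by the decomposition
  lemma with constant 1.\<close>

lemma hausdorff_outer_dyadic_le:
  fixes e :: "'a::euclidean_space"
  assumes e: "e \<in> Basis" and y: "y \<bullet> e = c"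
  shows "hausdorff_outer (DIM('a) - 1) (dyadic e c k y) \<le> emeasure lborel (cyl e c (dyadic e c k y))"
proof (rule hausdorff_outer_least)
  fix \<delta> :: real assume \<delta>: "0 < \<delta>"
  obtain N where N: "inverse (real (Suc N)) < \<delta> / DIM('a)"
    using reals_Archimedean[of "\<delta> / DIM('a)"] \<delta> by auto
  define k0 where "k0 = max k (Suc N)"
  have "real (Suc N) \<le> 2 ^ Suc N" using of_nat_less_two_power[of "Suc N"] by (metis less_imp_le)
  also have "(2::real) ^ Suc N \<le> 2 ^ k0" unfolding k0_def by (intro power_increasing) auto
  finally have "1 / 2^k0 \<le> inverse (real (Suc N))" by (simp add: field_simps)
  with N have "1 / 2^k0 < \<delta> / DIM('a)" by simp
  then have small: "DIM('a) / 2^k0 \<le> \<delta>" by (simp add: field_simps)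
  have "hausdorff_pre (DIM('a) - 1) \<delta> (dyadic e c k y) \<le> 1 * emeasure lborel (cyl e c (dyadic e c k y))"
  proof (rule hausdorff_pre_le_of_dyadic[OF e, where ?k0.0=k0])
    show "\<exists>l\<ge>k0. dyadic e c l z \<subseteq> dyadic e c k y" if "z \<in> dyadic e c k y" for z
      using dyadic_antimono[of k k0 e c z] dyadic_eq[OF that] by (intro exI[of _ k0]) (auto simp: k0_def)
    show "hausdorff_pre (DIM('a) - 1) \<delta> (dyadic e c l z) \<le> 1 * emeasure lborel (cyl e c (dyadic e c l z))"
      if "k0 \<le> l" "z \<bullet> e = c" for l z
      using hausdorff_pre_dyadic_le[OF e small that] by simp
    show "z \<bullet> e = c" if "z \<in> dyadic e c k y" for z using that by (simp add: dyadic_def)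
  qed (use \<delta> in auto)
  then show "hausdorff_pre (DIM('a) - 1) \<delta> (dyadic e c k y) \<le> emeasure lborel (cyl e c (dyadic e c k y))"
    by simp
qed

section \<open>Hausdorff measure equals Lebesgue measure on hyperplanes\<close>

text \<open>The lower bound holds for all Borel sets, the upper bound only for cubes. On a cube of
  finite mass this suffices: a measure that dominates another and gives the cube the same mass
  agrees with it on every Borel subset, by comparing complements. Countably many disjoint unit cubes
  exhaust the hyperplane.\<close>

lemma hausdorff_outer_coordinate_hyperplane:
  fixes e :: "'a::euclidean_space"
  assumes e: "e \<in> Basis" and A [measurable]: "A \<in> sets borel" and sub: "A \<subseteq> {y. y \<bullet> e = c}"
  shows "hausdorff_outer (DIM('a) - 1) A = emeasure lborel (cyl e c A)"
proof -
  let ?m = "DIM('a) - 1"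
  let ?H = "hausdorff_measure ?m :: 'a measure"
  have ge: "emeasure lborel (cyl e c S) \<le> emeasure ?H S" if "S \<in> sets borel" for S
    using emeasure_cyl_le_hausdorff_pre[OF e that, of c 1] hausdorff_pre_le_outer[of 1 ?m S]
    by (simp add: emeasure_hausdorff_measure that)
  have cube: "emeasure ?H (A \<inter> dyadic e c 0 y) = emeasure lborel (cyl e c (A \<inter> dyadic e c 0 y))" if y: "y \<bullet> e = c" for y
  proof -
    let ?Q = "dyadic e c 0 y"
    let ?S = "A \<inter> ?Q"
    have Q: "emeasure ?H ?Q = emeasure lborel (cyl e c ?Q)"
      using hausdorff_outer_dyadic_le[OF e y, of 0] ge[of ?Q] by (simp add: emeasure_hausdorff_measure)
    have fin: "emeasure lborel (cyl e c ?Q) = 1" by (simp add: emeasure_cyl_dyadic[OF e])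
    have [measurable]: "?S \<in> sets borel" by measurable
    have "emeasure ?H ?S + emeasure ?H (?Q - ?S) = emeasure ?H ?Q"
      by (subst plus_emeasure) (auto intro!: arg_cong[where f="emeasure _"])
    moreover have "emeasure lborel (cyl e c ?S) + emeasure lborel (cyl e c (?Q - ?S)) = emeasure lborel (cyl e c ?Q)"
      by (subst plus_emeasure) (auto simp: cyl_def intro!: arg_cong[where f="emeasure _"])
    moreover have "emeasure lborel (cyl e c ?S) \<le> emeasure ?H ?S"
      "emeasure lborel (cyl e c (?Q - ?S)) \<le> emeasure ?H (?Q - ?S)"
      by (intro ge; measurable)+
    ultimately have "emeasure lborel (cyl e c (?Q - ?S)) + emeasure ?H ?S \<le>
        emeasure lborel (cyl e c (?Q - ?S)) + emeasure lborel (cyl e c ?S)"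
      "emeasure lborel (cyl e c (?Q - ?S)) \<noteq> top"
      using Q fin by (auto simp: add.commute add_left_mono) (metis add_left_mono)
    then show ?thesis
      using ge[of ?S] by (simp add: ennreal_add_left_cancel_le antisym)
  qed
  let ?F = "dyadic e c 0 ` {y. y \<bullet> e = c}"
  have "countable ?F" using countable_dyadic[of e c 0] by (rule countable_subset[rotated]) auto
  moreover have "disjoint ?F"
  proof (rule disjointI)
    fix S T assume "S \<in> ?F" "T \<in> ?F" "S \<noteq> T"
    then obtain y w where "S = dyadic e c 0 y" "T = dyadic e c 0 w" by auto
    then show "S \<inter> T = {}" using dyadic_eq[of _ e c 0] \<open>S \<noteq> T\<close> by blast
  qed
  ultimately obtain Q :: "nat \<Rightarrow> 'a set" where Q: "disjoint_family Q" "(\<Union>n. Q n) = \<Union>?F" "\<And>n. Q n \<in> insert {} ?F"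
    using disjoint_countable_enumeration[of ?F] by metis
  have Qm [measurable]: "Q n \<in> sets borel" for n using Q(3)[of n] by auto
  have AQ: "A = (\<Union>n. A \<inter> Q n)"
  proof -
    have "A \<subseteq> \<Union>?F"
    proof
      fix y assume "y \<in> A"
      then have "y \<bullet> e = c" using sub by auto
      then show "y \<in> \<Union>?F" using dyadic_self[of y e c 0] by (intro UnionI[of "dyadic e c 0 y"]) auto
    qed
    then show ?thesis using Q(2) by blast
  qed
  have dAQ: "disjoint_family (\<lambda>n. A \<inter> Q n)"
    using Q(1) by (auto simp: disjoint_family_on_def)
  have "emeasure ?H A = (\<Sum>n. emeasure ?H (A \<inter> Q n))"
    by (subst AQ, rule suminf_emeasure[symmetric]) (use dAQ in auto)
  also have "\<dots> = (\<Sum>n. emeasure lborel (cyl e c (A \<inter> Q n)))"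
  proof (rule suminf_cong)
    fix n
    show "emeasure ?H (A \<inter> Q n) = emeasure lborel (cyl e c (A \<inter> Q n))"
      using Q(3)[of n] cube by (auto simp: cyl_def)
  qed
  also have "\<dots> = emeasure lborel (\<Union>n. cyl e c (A \<inter> Q n))"
    by (rule suminf_emeasure) (use disjoint_family_cyl[OF dAQ] in auto)
  also have "\<dots> = emeasure lborel (cyl e c A)"
    using AQ by (metis cyl_UN)
  finally show ?thesis by (simp add: emeasure_hausdorff_measure)
qed

lemma orthogonal_transformation_flip: "norm b = 1 \<Longrightarrow> orthogonal_transformation (flip b)"
  unfolding orthogonal_transformation_def
  by (auto simp: flip_def norm_eq_1 inner_diff_left inner_diff_right inner_commute algebra_simps
      intro!: linearI)

lemma flip_flip: "norm b = 1 \<Longrightarrow> flip b (flip b y) = y"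
  by (simp add: flip_def norm_eq_1 inner_diff_left algebra_simps)

text \<open>The reflection along \<open>e - u\<close> exchanges the two vectors. With an involution,
  image and preimage of a set coincide, so images are Borel and the one-sided isometry inequality,
  applied twice, gives equality.\<close>

lemma unit_vectors_involution:
  fixes e u :: "'a::euclidean_space"
  assumes "norm e = 1" "norm u = 1"
  obtains f where "orthogonal_transformation f" "\<And>y. f (f y) = y" "f e = u"
proof (cases "e = u")
  case True
  then show ?thesis by (intro that[of "\<lambda>y. y"]) auto
next
  case False
  define b where "b = (1 / norm (e - u)) *\<^sub>R (e - u)"
  have b: "norm b = 1" using False by (simp add: b_def)
  have n2: "(norm (e - u))\<^sup>2 = 2 * (e \<bullet> (e - u))"
    using assms by (simp add: power2_norm_eq_inner norm_eq_1 inner_diff_left inner_diff_right inner_commute)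
  have "flip b e = e - (2 * (e \<bullet> (e - u)) / (norm (e - u))\<^sup>2) *\<^sub>R (e - u)"
    by (simp add: flip_def b_def power2_eq_square)
  also have "2 * (e \<bullet> (e - u)) / (norm (e - u))\<^sup>2 = 1"
    unfolding n2[symmetric] using False by simp
  also have "e - 1 *\<^sub>R (e - u) = u" by simp
  finally have "flip b e = u" .
  then show ?thesis using b by (intro that[of "flip b"]) (auto simp: orthogonal_transformation_flip flip_flip)
qed

text \<open>One reflection carries both sides to a coordinate direction: Hausdorff measure is
  preserved because distances are, Lebesgue measure by
  \<open>distr_lborel_orthogonal\<close>.\<close>

theorem hausdorff_outer_hyperplane:
  fixes u :: "'a::euclidean_space"
  assumes u: "norm u = 1" and A [measurable]: "A \<in> sets borel" and sub: "A \<subseteq> {y. y \<bullet> u = c}"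
  shows "hausdorff_outer (DIM('a) - 1) A = emeasure lborel (cyl u c A)"
proof -
  obtain e :: 'a where e: "e \<in> Basis" using nonempty_Basis by blast
  then have "norm e = 1" by simp
  then obtain f where f: "orthogonal_transformation f" "\<And>y. f (f y) = y" "f e = u"
    using unit_vectors_involution u by metis
  have lin: "linear f" using f(1) by (rule orthogonal_transformation_linear)
  have inn: "f v \<bullet> f w = v \<bullet> w" for v w using f(1) by (simp add: orthogonal_transformation_def)
  have [measurable]: "f \<in> borel_measurable borel"
    using lin by (intro borel_measurable_continuous_onI linear_continuous_on) (simp add: linear_conv_bounded_linear)
  have iso: "dist (f v) (f w) = dist v w" for v w
    using f(1) lin by (metis dist_norm linear_diff orthogonal_transformation_norm)
  have fA: "f ` A = f -` A"
  proof (intro set_eqI iffI)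
    fix v assume "v \<in> f -` A"
    then show "v \<in> f ` A" using f(2)[of v] by (intro image_eqI[of _ _ "f v"]) auto
  qed (auto simp: f(2))
  have [measurable]: "f ` A \<in> sets borel"
    unfolding fA by (rule measurable_sets_borel[OF _ A]) measurable
  have "f ` f ` A = A" using f(2) by (simp add: image_image)
  then have "hausdorff_outer (DIM('a) - 1) A = hausdorff_outer (DIM('a) - 1) (f ` A)"
    using hausdorff_outer_isometry_le[OF iso, of "DIM('a) - 1" A] hausdorff_outer_isometry_le[OF iso, of "DIM('a) - 1" "f ` A"]
    by (intro antisym) auto
  also have "\<dots> = emeasure lborel (cyl e c (f ` A))"
  proof (rule hausdorff_outer_coordinate_hyperplane[OF e])
    show "f ` A \<subseteq> {y. y \<bullet> e = c}"
    proof clarify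
      fix v assume "v \<in> A"
      then show "f v \<bullet> e = c" using sub inn[of "f v" e] f by auto
    qed
  qed measurable
  also have "cyl e c (f ` A) = f -` cyl u c A"
  proof -
    have "f (perp e y + c *\<^sub>R e) = perp u (f y) + c *\<^sub>R u" "f y \<bullet> u = y \<bullet> e" for y
      using inn[of y e] f(3) by (simp_all add: perp_def linear_add[OF lin] linear_diff[OF lin] linear_cmul[OF lin])
    then show ?thesis unfolding fA by (simp add: cyl_def slab_def vimage_def)
  qed
  also have "emeasure lborel \<dots> = emeasure (distr lborel borel f) (cyl u c A)"
    by (subst emeasure_distr) auto
  also have "\<dots> = emeasure lborel (cyl u c A)"
    by (simp add: distr_lborel_orthogonal[OF f(1)])
  finally show ?thesis .
qed

text \<open>Restricted to \<open>D\<close>, Hausdorff measure is the image of Lebesgue measure on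
  \<open>cyl u c D\<close> under projection to the hyperplane, so the formula is a change of
  variables.\<close>

lemma set_integral_hausdorff_hyperplane:
  fixes u :: "'a::euclidean_space" and f :: "'a \<Rightarrow> real"
  assumes u: "norm u = 1" and D [measurable]: "D \<in> sets borel" and sub: "D \<subseteq> {y. y \<bullet> u = c}"
    and [measurable]: "f \<in> borel_measurable borel"
  shows "(LINT y:D|hausdorff_measure (DIM('a) - 1). f y) =
    (\<integral>y. indicator (slab u) y * (indicator D (perp u y + c *\<^sub>R u) * f (perp u y + c *\<^sub>R u)) \<partial>lborel)"
proof -
  let ?H = "hausdorff_measure (DIM('a) - 1) :: 'a measure"
  let ?g = "\<lambda>y. perp u y + c *\<^sub>R u"
  let ?L = "density lborel (\<lambda>y. ennreal (indicator (cyl u c D) y))"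
  have eq: "density ?H (\<lambda>y. ennreal (indicator D y)) = distr ?L borel ?g"
  proof (rule measure_eqI)
    fix A assume "A \<in> sets (density ?H (\<lambda>y. ennreal (indicator D y)))"
    then have A [measurable]: "A \<in> sets borel" by simp
    have "emeasure (density ?H (\<lambda>y. ennreal (indicator D y))) A = emeasure ?H (D \<inter> A)"
      using emeasure_restricted[of D ?H A] by (simp add: ennreal_indicator)
    also have "\<dots> = hausdorff_outer (DIM('a) - 1) (D \<inter> A)"
      by (rule emeasure_hausdorff_measure) simp
    also have "\<dots> = emeasure lborel (cyl u c (D \<inter> A))"
      using sub by (intro hausdorff_outer_hyperplane[OF u]) auto
    also have "cyl u c (D \<inter> A) = cyl u c D \<inter> ?g -` A" by (auto simp: cyl_def)
    also have "emeasure lborel \<dots> = emeasure ?L (?g -` A)"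
    proof -
      have "?g -` A \<in> sets borel" by (rule measurable_sets_borel[OF _ A]) measurable
      then show ?thesis using emeasure_restricted[of "cyl u c D" lborel "?g -` A"] by (simp add: ennreal_indicator)
    qed
    also have "\<dots> = emeasure (distr ?L borel ?g) A"
      by (subst emeasure_distr) auto
    finally show "emeasure (density ?H (\<lambda>y. ennreal (indicator D y))) A = emeasure (distr ?L borel ?g) A" .
  qed simp
  have "(LINT y:D|?H. f y) = integral\<^sup>L (density ?H (\<lambda>y. ennreal (indicator D y))) f"
    unfolding set_lebesgue_integral_def by (subst integral_density) auto
  also have "\<dots> = (\<integral>y. indicator (cyl u c D) y *\<^sub>R f (?g y) \<partial>lborel)"
    unfolding eq by (subst integral_distr, simp, simp, subst integral_density) auto
  also have "\<dots> = (\<integral>y. indicator (slab u) y * (indicator D (?g y) * f (?g y)) \<partial>lborel)"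
    by (intro Bochner_Integration.integral_cong) (auto simp: cyl_def indicator_def)
  finally show ?thesis .
qed

lemma null_sets_hyperplane:
  fixes a :: "'a::euclidean_space"
  assumes "a \<noteq> 0"
  shows "{y. a \<bullet> y = b} \<in> null_sets lborel"
proof -
  have "{y. a \<bullet> y = b} \<in> sets borel" by measurable
  moreover have "negligible {y. a \<bullet> y = b}" using assms by (intro negligible_hyperplane) auto
  ultimately show ?thesis by (simp add: negligible_iff_null_sets null_sets_completion_iff)
qed

lemma AE_hyperplane:
  fixes a :: "'a::euclidean_space"
  assumes "a \<noteq> 0"
  shows "AE y in lborel. a \<bullet> y \<noteq> b"
  by (rule AE_I'[OF null_sets_hyperplane[OF assms, of b]]) auto

subsection \<open>Laguerre cells\<close>

text \<open>The cost of \<open>j\<close> minus the cost of \<open>i\<close> at \<open>y\<close>, see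
  \<open>gap_eq\<close>. Cells, ties and minimisers all become sign conditions on one function that
  is affine both in \<open>y\<close> and in \<open>z\<close>.\<close>

definition gap :: "('n::finite \<Rightarrow> 'a::real_inner) \<Rightarrow> real^'n \<Rightarrow> 'n \<Rightarrow> 'n \<Rightarrow> 'a \<Rightarrow> real" where
  "gap x z i j y = inner (x i - x j) y - bij_coef x z i j"

lemma gap_eq: "gap x z i j y = ((1/2) * norm (y - x j) ^ 2 - z $ j) - ((1/2) * norm (y - x i) ^ 2 - z $ i)"
  by (simp add: gap_def bij_coef_def power2_norm_eq_inner inner_diff_left inner_diff_right inner_commute field_simps)

lemma gap_self [simp]: "gap x z i i y = 0"
  by (simp add: gap_eq)

lemma gap_swap: "gap x z j i y = - gap x z i j y"
  by (simp add: gap_eq)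

lemma gap_trans: "gap x z j k y = gap x z i k y - gap x z i j y"
  by (simp add: gap_eq)

lemma gap_shift: "gap x z i j y = gap x z' i j y + (z $ i - z' $ i) - (z $ j - z' $ j)"
  by (simp add: gap_eq)

lemma laguerre_cell_gap: "laguerre_cell x z i = {y. \<forall>j. 0 \<le> gap x z i j y}"
proof -
  have "y \<in> laguerre_cell x z i \<longleftrightarrow> (\<forall>j. j \<noteq> i \<longrightarrow> 0 \<le> gap x z i j y)" for y
    by (auto simp: laguerre_cell_def gap_def)
  then show ?thesis by (auto, metis gap_self order_refl)
qed

lemma closed_laguerre_cell: "closed (laguerre_cell x z i)"
  unfolding laguerre_cell_def by (intro closed_INT ballI closed_Collect_le continuous_intros)

lemma sets_laguerre_cell [measurable]: "laguerre_cell x z (i::'n::finite) \<in> sets (borel :: 'a::euclidean_space measure)"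
  by (intro borel_closed closed_laguerre_cell)

lemma Tmap_gap: "Tmap x z y = x (SOME i. i \<in> {i. \<forall>j. 0 \<le> gap x z i j y})"
  by (simp add: Tmap_def gap_eq)

lemma Tmap_eq:
  assumes "\<And>j. j \<noteq> i \<Longrightarrow> 0 < gap x z i j y"
  shows "Tmap x z y = x i"
proof -
  have "k = i" if "\<forall>j. 0 \<le> gap x z k j y" for k
    using assms[of k] gap_swap[of x z k i y] that by (metis less_le_not_le neg_0_le_iff_le)
  moreover have "\<forall>j. 0 \<le> gap x z i j y" using assms by (metis gap_self less_imp_le order_refl)
  ultimately have "{i. \<forall>j. 0 \<le> gap x z i j y} = {i}" by blast
  then show ?thesis by (simp add: Tmap_gap)
qed

lemma borel_measurable_gap [measurable]: "gap x z i j \<in> borel_measurable (borel :: 'a::euclidean_space measure)"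
  unfolding gap_def by measurable

text \<open>The choice operator sees \<open>y\<close> only through the set of minimising indices, so
  the map factors through a measurable map into a finite discrete space.\<close>

lemma borel_measurable_Tmap [measurable]:
  fixes x :: "'n::finite \<Rightarrow> 'a::euclidean_space"
  shows "Tmap x z \<in> borel_measurable borel"
proof -
  let ?F = "\<lambda>y. {i. \<forall>j. 0 \<le> gap x z i j y}"
  have "?F \<in> borel \<rightarrow>\<^sub>M count_space UNIV"
  proof (subst measurable_count_space_eq_countable)
    show "countable (UNIV :: 'n set set)" by (intro countable_finite) auto
    have "?F -` {S} = {y. \<forall>i. (\<forall>j. 0 \<le> gap x z i j y) \<longleftrightarrow> i \<in> S}" for S by auto
    moreover have "{y. \<forall>i. (\<forall>j. 0 \<le> gap x z i j y) \<longleftrightarrow> i \<in> S} \<in> sets borel" for S by measurable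
    ultimately show "?F \<in> space borel \<rightarrow> UNIV \<and> (\<forall>a\<in>UNIV. ?F -` {a} \<inter> space borel \<in> sets borel)"
      by simp
  qed
  from measurable_compose[OF this, of "\<lambda>S. x (SOME i. i \<in> S)" borel]
  show ?thesis by (simp add: Tmap_gap[abs_def])
qed

lemma argmin_gap: "\<exists>i. \<forall>j. 0 \<le> gap x z i j y"
proof -
  let ?v = "\<lambda>i. (1/2) * norm (y - x i) ^ 2 - z $ i"
  obtain i where "?v i = Min (range ?v)" using Min_in[of "range ?v"] by fastforce
  then have "\<forall>j. ?v i \<le> ?v j" by simp
  then show ?thesis by (auto simp: gap_eq)
qed

lemma AE_no_ties:
  fixes x :: "'n::finite \<Rightarrow> 'a::euclidean_space"
  assumes "inj x"
  shows "AE y in lborel. \<forall>i j. i \<noteq> j \<longrightarrow> gap x z i j y \<noteq> 0"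
proof -
  have "AE y in lborel. i \<noteq> j \<longrightarrow> gap x z i j y \<noteq> 0" for i j
  proof (cases "i = j")
    case False
    then have "x i - x j \<noteq> 0" using assms by (auto dest: injD)
    from AE_hyperplane[OF this, of "bij_coef x z i j"] show ?thesis by (auto simp: gap_def)
  qed simp
  then show ?thesis by (simp add: AE_all_countable)
qed

text \<open>Without ties \<open>y\<close> lies in exactly one cell for each of the two vectors, so a
  single summand survives.\<close>

lemma Tmap_diff_powr:
  fixes x :: "'n::finite \<Rightarrow> 'a::euclidean_space"
  assumes 1: "\<forall>i j. i \<noteq> j \<longrightarrow> gap x z1 i j y \<noteq> 0" and 2: "\<forall>i j. i \<noteq> j \<longrightarrow> gap x z2 i j y \<noteq> 0"
  shows "norm (Tmap x z1 y - Tmap x z2 y) powr s =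
    (\<Sum>(i, j)\<in>UNIV. norm (x i - x j) powr s * indicator (laguerre_cell x z1 i \<inter> laguerre_cell x z2 j) y)"
proof -
  have ex: "\<exists>i. Tmap x z y = x i \<and> (\<forall>k. y \<in> laguerre_cell x z k \<longleftrightarrow> k = i)"
    if ties: "\<forall>i j. i \<noteq> j \<longrightarrow> gap x z i j y \<noteq> 0" for z
  proof -
    obtain i where i: "\<forall>j. 0 \<le> gap x z i j y" using argmin_gap by metis
    then have pos: "0 < gap x z i j y" if "j \<noteq> i" for j using ties that by (metis order_le_less)
    have "k = i" if "y \<in> laguerre_cell x z k" for k
      using that pos[of k] gap_swap[of x z k i y] by (auto simp: laguerre_cell_gap) (smt (verit))
    moreover have "y \<in> laguerre_cell x z i" using i by (simp add: laguerre_cell_gap)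
    moreover have "Tmap x z y = x i" by (rule Tmap_eq[OF pos])
    ultimately show ?thesis by blast
  qed
  obtain i where i: "Tmap x z1 y = x i" "\<forall>k. y \<in> laguerre_cell x z1 k \<longleftrightarrow> k = i" using ex[OF 1] by auto
  obtain j where j: "Tmap x z2 y = x j" "\<forall>k. y \<in> laguerre_cell x z2 k \<longleftrightarrow> k = j" using ex[OF 2] by auto
  have "(\<Sum>(k, l)\<in>UNIV. norm (x k - x l) powr s * indicator (laguerre_cell x z1 k \<inter> laguerre_cell x z2 l) y)
     = (\<Sum>p\<in>UNIV. if p = (i, j) then norm (x i - x j) powr s else 0)"
    using i(2) j(2) by (intro sum.cong) (auto simp: indicator_def)
  then show ?thesis using i j by simp
qed

lemma assumption_A1_facts:
  fixes \<rho> :: "'a::euclidean_space \<Rightarrow> real"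
  assumes A1: "assumption_A1 R \<rho> Y"
  shows "prob_space R" "R = density lborel (\<lambda>y. ennreal (\<rho> y))" "\<And>y. 0 \<le> \<rho> y" "compact Y"
    "continuous_on Y \<rho>" "\<And>y. y \<notin> Y \<Longrightarrow> \<rho> y = 0" "\<rho> \<in> borel_measurable borel"
    "sets R = sets borel" "space R = UNIV"
proof -
  show "prob_space R" and R: "R = density lborel (\<lambda>y. ennreal (\<rho> y))" and "\<And>y. 0 \<le> \<rho> y" and Y: "compact Y"
    and cont: "continuous_on Y \<rho>" and off: "\<And>y. y \<notin> Y \<Longrightarrow> \<rho> y = 0"
    using A1 unfolding assumption_A1_def by auto
  have "(\<lambda>y. if y \<in> Y then \<rho> y else 0) \<in> borel_measurable borel"
    using cont Y by (intro borel_measurable_continuous_on_if) (auto intro: borel_compact)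
  moreover have "(\<lambda>y. if y \<in> Y then \<rho> y else 0) = \<rho>" using off by auto
  ultimately show "\<rho> \<in> borel_measurable borel" by simp
  show "sets R = sets borel" "space R = UNIV" unfolding R by simp_all
qed

lemma assumption_A1_AE:
  fixes \<rho> :: "'a::euclidean_space \<Rightarrow> real"
  assumes A1: "assumption_A1 R \<rho> Y" and ae: "AE y in lborel. P y"
  shows "AE y in R. P y"
  unfolding assumption_A1_facts(2)[OF A1] using ae assumption_A1_facts(7)[OF A1]
  by (subst AE_density) auto

lemma assumption_A1_AE_support:
  fixes \<rho> :: "'a::euclidean_space \<Rightarrow> real"
  assumes A1: "assumption_A1 R \<rho> Y"
  shows "AE y in R. y \<in> Y"
proof -
  have "0 < ennreal (\<rho> y) \<longrightarrow> y \<in> Y" for y using assumption_A1_facts(6)[OF A1, of y] by (cases "y \<in> Y") auto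
  then show ?thesis
    unfolding assumption_A1_facts(2)[OF A1] using assumption_A1_facts(7)[OF A1] by (subst AE_density) auto
qed

lemma delta_s_sum:
  fixes x :: "'n::finite \<Rightarrow> 'a::euclidean_space"
  assumes A1: "assumption_A1 R \<rho> Y" and x: "inj x"
  shows "delta_s R x s (z1, z2) =
    (\<Sum>(i, j)\<in>UNIV. norm (x i - x j) powr s * measure R (laguerre_cell x z1 i \<inter> laguerre_cell x z2 j))"
proof -
  interpret prob_space R by (rule assumption_A1_facts(1)[OF A1])
  note [measurable_cong] = assumption_A1_facts(8)[OF A1]
  have "AE y in R. (\<forall>i j. i \<noteq> j \<longrightarrow> gap x z1 i j y \<noteq> 0) \<and> (\<forall>i j. i \<noteq> j \<longrightarrow> gap x z2 i j y \<noteq> 0)"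
    using assumption_A1_AE[OF A1 AE_no_ties[OF x, of z1]] assumption_A1_AE[OF A1 AE_no_ties[OF x, of z2]] by eventually_elim auto
  then have "delta_s R x s (z1, z2) = (\<integral>y. (\<Sum>(i, j)\<in>UNIV. norm (x i - x j) powr s *
       indicator (laguerre_cell x z1 i \<inter> laguerre_cell x z2 j) y) \<partial>R)"
    unfolding delta_s_def fst_conv snd_conv
  proof (intro integral_cong_AE)
    assume "AE y in R. (\<forall>i j. i \<noteq> j \<longrightarrow> gap x z1 i j y \<noteq> 0) \<and> (\<forall>i j. i \<noteq> j \<longrightarrow> gap x z2 i j y \<noteq> 0)"
    then show "AE y in R. norm (Tmap x z1 y - Tmap x z2 y) powr s = (\<Sum>(i, j)\<in>UNIV. norm (x i - x j) powr s *
       indicator (laguerre_cell x z1 i \<inter> laguerre_cell x z2 j) y)"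
      by eventually_elim (rule Tmap_diff_powr; blast)
  qed (unfold case_prod_unfold, measurable)
  also have "\<dots> = (\<Sum>(i, j)\<in>UNIV. norm (x i - x j) powr s * measure R (laguerre_cell x z1 i \<inter> laguerre_cell x z2 j))"
    unfolding case_prod_unfold
    by (subst Bochner_Integration.integral_sum)
       (auto simp: assumption_A1_facts(9)[OF A1] intro!: integrable_mult_right integrable_real_indicator emeasure_finite[THEN less_top[THEN iffD1]])
  finally show ?thesis .
qed

section \<open>Consequences of dual optimality\<close>

text \<open>A one-sided perturbation: raising \<open>zs $ i\<close> by \<open>t\<close> gains
  \<open>t * p i\<close> in the linear term and lowers the integral by at most \<open>t\<close>
  times the mass of the enlarged cell. Optimality therefore bounds that mass below by
  \<open>p i\<close>, and the enlarged cells decrease into the original one as \<open>t\<close>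
  tends to 0. Differentiability of the dual objective is never invoked.\<close>

lemma laguerre_cell_mass_ge:
  fixes x :: "'n::finite \<Rightarrow> 'a::euclidean_space"
  assumes A1: "assumption_A1 R \<rho> Y" and opt: "\<forall>z. dual_obj R x p z \<le> dual_obj R x p zs"
  shows "p i \<le> measure R (laguerre_cell x zs i)"
proof -
  interpret prob_space R by (rule assumption_A1_facts(1)[OF A1])
  note [measurable_cong] = assumption_A1_facts(8)[OF A1]
  define v where "v z k y = (1/2) * norm (y - x k) ^ 2 - z $ k" for z :: "real^'n" and k y
  define V where "V z y = Min (range (\<lambda>k. v z k y))" for z y
  have V_le: "V z y \<le> v z k y" for z y k by (simp add: V_def)
  have V_ex: "\<exists>k. V z y = v z k y" for z y
  proof -
    have "V z y \<in> range (\<lambda>k. v z k y)" unfolding V_def by (rule Min_in) auto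
    then show ?thesis by auto
  qed
  have dual: "dual_obj R x p z = (\<Sum>k\<in>UNIV. z $ k * p k) + (\<integral>y. V z y \<partial>R)" for z
    by (simp add: dual_obj_def V_def v_def)
  have [measurable]: "V z \<in> borel_measurable borel" for z
    unfolding V_def[abs_def] v_def by measurable
  have int: "integrable R (V z)" for z
  proof -
    obtain r where r: "\<And>y. y \<in> Y \<Longrightarrow> norm y \<le> r"
      using compact_imp_bounded[OF assumption_A1_facts(4)[OF A1]] by (auto simp: bounded_iff)
    define B where "B = (\<Sum>k\<in>UNIV. (1/2) * (r + norm (x k))^2 + \<bar>z $ k\<bar>)"
    have "norm (V z y) \<le> B" if "y \<in> Y" for y
    proof -
      obtain k where k: "V z y = v z k y" using V_ex by blast
      have "norm (y - x k) \<le> r + norm (x k)" using r[OF that] norm_triangle_ineq4[of y "x k"] by linarith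
      then have "norm (y - x k) ^ 2 \<le> (r + norm (x k))^2" by (intro power_mono) auto
      then have "\<bar>v z k y\<bar> \<le> (1/2) * (r + norm (x k))^2 + \<bar>z $ k\<bar>" 
        unfolding v_def using zero_le_power2[of "norm (y - x k)"] by linarith
      also have "\<dots> \<le> B" unfolding B_def by (rule member_le_sum) auto
      finally show ?thesis by (simp add: k)
    qed
    then have "AE y in R. norm (V z y) \<le> B" using assumption_A1_AE_support[OF A1] by auto
    then show ?thesis by (rule integrable_const_bound) measurable
  qed
  define t where "t n = 1 / real (Suc n)" for n
  define zn where "zn n = zs + axis i (t n)" for n
  have t: "0 < t n" for n by (simp add: t_def)
  have zn: "zn n $ k = zs $ k + (if k = i then t n else 0)" for n k by (simp add: zn_def axis_def)
  have "p i \<le> measure R (laguerre_cell x (zn n) i)" for n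
  proof -
    let ?C = "laguerre_cell x (zn n) i"
    \<comment> \<open>Only the cost of \<open>i\<close> has changed, by \<open>t n\<close>. Outside
      the enlarged cell the new minimum is attained at another index, whose cost is the old
      one.\<close>
    have pt: "V zs y - t n * indicator ?C y \<le> V (zn n) y" for y
    proof -
      obtain k where k: "V (zn n) y = v (zn n) k y" using V_ex by blast
      show ?thesis
      proof (cases "y \<in> ?C")
        case True
        then show ?thesis using V_le[of zs y k] t[of n] by (auto simp: k v_def zn split: if_splits)
      next
        case False
        then obtain j where "gap x (zn n) i j y < 0" by (auto simp: laguerre_cell_gap not_le)
        then have "v (zn n) j y < v (zn n) i y" by (simp add: gap_eq v_def)
        then have "k \<noteq> i" using k V_le[of "zn n" y j] by auto
        then show ?thesis using V_le[of zs y k] False by (simp add: k v_def zn)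
      qed
    qed
    have intC: "integrable R (\<lambda>y. t n * indicator ?C y)"
      using t[of n] by (intro integrable_const_bound[where B="t n"]) (auto simp: indicator_def)
    have "(\<integral>y. V zs y \<partial>R) - t n * measure R ?C = (\<integral>y. V zs y - t n * indicator ?C y \<partial>R)"
      using int intC by (simp add: assumption_A1_facts(9)[OF A1])
    also have "\<dots> \<le> (\<integral>y. V (zn n) y \<partial>R)"
      using int intC pt by (intro integral_mono Bochner_Integration.integrable_diff) auto
    finally have 1: "(\<integral>y. V zs y \<partial>R) - t n * measure R ?C \<le> (\<integral>y. V (zn n) y \<partial>R)" .
    have "(\<Sum>k\<in>UNIV. zn n $ k * p k) = (\<Sum>k\<in>UNIV. zs $ k * p k + (if k = i then t n * p i else 0))"
      by (intro sum.cong) (auto simp: zn algebra_simps)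
    also have "\<dots> = (\<Sum>k\<in>UNIV. zs $ k * p k) + t n * p i" by (simp add: sum.distrib)
    finally have "t n * p i \<le> t n * measure R ?C"
      using opt[rule_format, of "zn n"] 1 unfolding dual by simp
    then show ?thesis using t[of n] by simp
  qed
  moreover have "(\<lambda>n. measure R (laguerre_cell x (zn n) i)) \<longlonglongrightarrow> measure R (\<Inter>n. laguerre_cell x (zn n) i)"
  proof (rule finite_Lim_measure_decseq)
    show "range (\<lambda>n. laguerre_cell x (zn n) i) \<subseteq> sets R" by (simp add: assumption_A1_facts(8)[OF A1] image_subset_iff)
    show "decseq (\<lambda>n. laguerre_cell x (zn n) i)"
    proof (rule decseq_SucI)
      fix n
      have "t (Suc n) \<le> t n" by (simp add: t_def field_simps)
      then have "gap x (zn (Suc n)) i j y \<le> gap x (zn n) i j y" for j y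
        using gap_shift[of x "zn (Suc n)" i j y "zn n"] by (auto simp: zn)
      then show "laguerre_cell x (zn (Suc n)) i \<subseteq> laguerre_cell x (zn n) i"
        unfolding laguerre_cell_gap by (blast intro: order_trans)
    qed
  qed
  moreover have "(\<Inter>n. laguerre_cell x (zn n) i) \<subseteq> laguerre_cell x zs i"
  proof
    fix y assume y: "y \<in> (\<Inter>n. laguerre_cell x (zn n) i)"
    have "0 \<le> gap x zs i j y" for j
    proof (cases "j = i")
      case False
      have "0 \<le> gap x zs i j y + t n" for n
      proof -
        have "y \<in> laguerre_cell x (zn n) i" using y by blast
        then have "0 \<le> gap x (zn n) i j y" by (simp add: laguerre_cell_gap)
        then show ?thesis using False gap_shift[of x "zn n" i j y zs] by (simp add: zn)
      qed
      moreover have "(\<lambda>n. gap x zs i j y + t n) \<longlonglongrightarrow> gap x zs i j y + 0"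
        unfolding t_def by (intro tendsto_intros LIMSEQ_Suc[OF lim_1_over_n])
      ultimately show ?thesis by (metis LIMSEQ_le_const add.right_neutral)
    qed simp
    then show "y \<in> laguerre_cell x zs i" by (simp add: laguerre_cell_gap)
  qed
  then have "measure R (\<Inter>n. laguerre_cell x (zn n) i) \<le> measure R (laguerre_cell x zs i)"
    by (intro finite_measure_mono) (simp_all add: assumption_A1_facts(8)[OF A1])
  ultimately show ?thesis by (meson LIMSEQ_le_const order_trans)
qed

text \<open>A hyperplane is null for the absolutely continuous \<open>R\<close>, while the cell has
  mass at least \<open>p i > 0\<close>. Optimality is used later only in this form.\<close>

lemma laguerre_cell_not_in_hyperplane:
  fixes x :: "'n::finite \<Rightarrow> 'a::euclidean_space"
  assumes A1: "assumption_A1 R \<rho> Y" and opt: "\<forall>z. dual_obj R x p z \<le> dual_obj R x p zs"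
    and p: "0 < p i" and a: "a \<noteq> 0" and sub: "laguerre_cell x zs i \<inter> Y \<subseteq> {y. a \<bullet> y = b}"
  shows False
proof -
  interpret prob_space R by (rule assumption_A1_facts(1)[OF A1])
  note [measurable_cong] = assumption_A1_facts(8)[OF A1]
  have "AE y in R. y \<notin> laguerre_cell x zs i"
    using assumption_A1_AE[OF A1 AE_hyperplane[OF a, of b]] assumption_A1_AE_support[OF A1] by eventually_elim (use sub in auto)
  then have "measure R (laguerre_cell x zs i) = 0"
    by (subst (asm) AE_iff_measurable[of "laguerre_cell x zs i"])
       (auto simp: assumption_A1_facts(9)[OF A1] assumption_A1_facts(8)[OF A1] measure_def)
  then show False using laguerre_cell_mass_ge[OF A1 opt, of i] p by simp
qed

lemma inner_perp_swap: "a \<bullet> perp u y = perp u a \<bullet> y"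
  by (simp add: perp_def inner_diff_left inner_diff_right inner_commute)

section \<open>Exceptional sets on the hyperplane of a pair of cells\<close>

locale face =
  fixes R :: "'a::euclidean_space measure" and \<rho> :: "'a \<Rightarrow> real" and Y :: "'a set"
    and x :: "'n::finite \<Rightarrow> 'a" and p :: "'n \<Rightarrow> real" and zs :: "real^'n" and i j :: 'n
  assumes A1: "assumption_A1 R \<rho> Y" and x: "inj x" and p: "\<And>i. 0 < p i"
    and opt: "\<forall>z. dual_obj R x p z \<le> dual_obj R x p zs" and ij: "i \<noteq> j"
begin

text \<open>The normal \<open>u\<close> points from \<open>x j\<close> to \<open>x i\<close>, and
  \<open>c\<close> is the height of the interface along \<open>u\<close>: cell \<open>i\<close> lies
  above it, cell \<open>j\<close> below.\<close>

definition "L = norm (x i - x j)"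
definition "u = (1 / L) *\<^sub>R (x i - x j)"
definition "c = bij_coef x zs i j / L"

lemma L_pos: "0 < L"
  using x ij by (auto simp: L_def dest: injD)

lemma norm_u: "norm u = 1"
  using L_pos by (simp add: u_def L_def)

lemma uu: "u \<bullet> u = 1"
  using norm_u by (simp add: norm_eq_1)

lemma diff_eq: "x i - x j = L *\<^sub>R u"
  using L_pos by (simp add: u_def)

lemma gap_ij: "gap x zs i j y = L * (y \<bullet> u - c)"
  using L_pos by (simp add: gap_def diff_eq c_def inner_commute algebra_simps)

lemma cell_not_in_hyperplane: "laguerre_cell x zs k \<inter> Y \<subseteq> {y. y \<bullet> u = c} \<Longrightarrow> False"
  using laguerre_cell_not_in_hyperplane[OF A1 opt p[of k], of u c] norm_u
  by (cases "u = 0") (auto simp: inner_commute[of _ u])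

text \<open>In the non-polyhedral case this is Assumption A1 for the interface, rewritten by
  \<open>hausdorff_outer_hyperplane\<close>. For a polyhedron the frontier lies in finitely many
  hyperplanes: a transversal one leaves a null trace, a parallel distinct one leaves none, and
  coincidence with the interface would put all of \<open>Y\<close> on one side of it, which flattens
  cell \<open>i\<close> or cell \<open>j\<close>.\<close>

lemma null_cyl_frontier: "emeasure lborel (cyl u c (frontier Y)) = 0"
proof -
  have on: "(perp u y + c *\<^sub>R u) \<bullet> u = c" for y
    using norm_u uu by (simp add: inner_add_left inner_perp_self)
  have cases: "polyhedron Y \<or> hausdorff_outer (DIM('a) - 1) (frontier Y \<inter> {y. (x i - x j) \<bullet> y = bij_coef x zs i j}) = 0"
  proof -
    have "x i - x j \<noteq> 0" using x ij by (auto dest: injD)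
    then show ?thesis using A1 unfolding assumption_A1_def by blast
  qed
  then show ?thesis
  proof
    assume H: "hausdorff_outer (DIM('a) - 1) (frontier Y \<inter> {y. (x i - x j) \<bullet> y = bij_coef x zs i j}) = 0"
    have "{y. (x i - x j) \<bullet> y = bij_coef x zs i j} = {y. y \<bullet> u = c}"
      using L_pos by (auto simp: diff_eq c_def inner_commute field_simps)
    then have "hausdorff_outer (DIM('a) - 1) (frontier Y \<inter> {y. y \<bullet> u = c}) = 0" using H by simp
    moreover have "hausdorff_outer (DIM('a) - 1) (frontier Y \<inter> {y. y \<bullet> u = c}) =
        emeasure lborel (cyl u c (frontier Y \<inter> {y. y \<bullet> u = c}))"
    proof (rule hausdorff_outer_hyperplane[OF norm_u])
      have "{y. y \<bullet> u = c} \<in> sets borel" by measurable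
      then show "frontier Y \<inter> {y. y \<bullet> u = c} \<in> sets borel"
        by (rule sets.Int[OF borel_closed[OF frontier_closed]])
    qed auto
    moreover have "cyl u c (frontier Y \<inter> {y. y \<bullet> u = c}) = cyl u c (frontier Y)"
      using on by (auto simp: cyl_def)
    ultimately show ?thesis by simp
  next
    assume "polyhedron Y"
    then obtain F where F: "finite F" "Y = \<Inter>F" "\<And>h. h \<in> F \<Longrightarrow> \<exists>a b. a \<noteq> 0 \<and> h = {x. a \<bullet> x \<le> b}"
      unfolding polyhedron_def by blast
    then obtain a b where ab: "\<And>h. h \<in> F \<Longrightarrow> a h \<noteq> 0 \<and> h = {x. a h \<bullet> x \<le> b h}" by metis
    have memh: "y \<in> h \<longleftrightarrow> a h \<bullet> y \<le> b h" if "h \<in> F" for h y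
      using ab[OF that] by (metis mem_Collect_eq)
    then have memY: "y \<in> Y \<longleftrightarrow> (\<forall>h\<in>F. a h \<bullet> y \<le> b h)" for y
      unfolding F(2) by blast
    have front: "frontier Y \<subseteq> (\<Union>h\<in>F. {y. a h \<bullet> y = b h})"
    proof
      fix y assume y: "y \<in> frontier Y"
      then have "y \<in> Y" using assumption_A1_facts(4)[OF A1] compact_imp_closed frontier_subset_closed by blast
      show "y \<in> (\<Union>h\<in>F. {y. a h \<bullet> y = b h})"
      proof (rule ccontr)
        assume "\<not> ?thesis"
        then have lt: "a h \<bullet> y < b h" if "h \<in> F" for h
          using that \<open>y \<in> Y\<close> unfolding memY by (simp add: order_le_less)
        have "open (\<Inter>h\<in>F. {y. a h \<bullet> y < b h})"
          using F(1) by (intro open_INT) (auto intro: open_halfspace_lt)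
        moreover have "(\<Inter>h\<in>F. {y. a h \<bullet> y < b h}) \<subseteq> Y" using memY less_imp_le by blast
        moreover have "y \<in> (\<Inter>h\<in>F. {y. a h \<bullet> y < b h})" using lt by auto
        ultimately have "y \<in> interior Y" by (meson interior_maximal subsetD)
        then show False using y by (simp add: frontier_def)
      qed
    qed
    have null: "cyl u c {y. a h \<bullet> y = b h} \<in> null_sets lborel" if h: "h \<in> F" for h
    proof (cases "perp u (a h) = 0")
      case False
      have "cyl u c {y. a h \<bullet> y = b h} \<subseteq> {y. perp u (a h) \<bullet> y = b h - c * (a h \<bullet> u)}"
        by (auto simp: cyl_def inner_add_right inner_perp_swap)
      moreover have "cyl u c {y. a h \<bullet> y = b h} \<in> sets lborel"
      proof -
        have "{y. a h \<bullet> y = b h} \<in> sets borel" by measurable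
        then show ?thesis by simp
      qed
      ultimately show ?thesis
        using null_sets_hyperplane[OF False, of "b h - c * (a h \<bullet> u)"] null_sets_subset by blast
    next
      case True
      define k where "k = a h \<bullet> u"
      have ak: "a h = k *\<^sub>R u" using True perp_decomp[of u "a h"] by (simp add: k_def)
      then have k0: "k \<noteq> 0" using ab[OF h] by auto
      have Yh: "k * (u \<bullet> y) \<le> b h" if "y \<in> Y" for y
        using that h unfolding memY ak[symmetric] by (metis ak inner_scaleR_left)
      have "b h \<noteq> k * c"
      proof
        assume bk: "b h = k * c"
        show False
        \<comment> \<open>The sign of \<open>k\<close> tells on which side \<open>Y\<close> lies;
          the cell on the opposite side is the one squeezed into the hyperplane.\<close>
        proof (cases "0 < k")
          case True
          then have "y \<bullet> u \<le> c" if "y \<in> Y" for y using Yh[OF that] bk by (simp add: inner_commute)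
          moreover have "c \<le> y \<bullet> u" if "y \<in> laguerre_cell x zs i" for y
            using that L_pos gap_ij[of y] by (auto simp: laguerre_cell_gap dest!: spec[of _ j] simp: zero_le_mult_iff)
          ultimately show False by (intro cell_not_in_hyperplane[of i]) (auto intro: antisym)
        next
          case False
          then have "c \<le> y \<bullet> u" if "y \<in> Y" for y using Yh[OF that] bk k0 by (simp add: inner_commute mult_le_cancel_left)
          moreover have "y \<bullet> u \<le> c" if "y \<in> laguerre_cell x zs j" for y
            using that L_pos gap_ij[of y] gap_swap[of x zs j i y] by (auto simp: laguerre_cell_gap dest!: spec[of _ i] simp: mult_le_0_iff)
          ultimately show False by (intro cell_not_in_hyperplane[of j]) (auto intro: antisym)
        qed
      qed
      then have "cyl u c {y. a h \<bullet> y = b h} = {}"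
      proof -
        have "u \<bullet> (perp u y + c *\<^sub>R u) = c" for y using on[of y] by (simp add: inner_commute)
        then show ?thesis using \<open>b h \<noteq> k * c\<close> by (simp add: cyl_def ak)
      qed
      then show ?thesis by simp
    qed
    have "cyl u c (frontier Y) \<subseteq> (\<Union>h\<in>F. cyl u c {y. a h \<bullet> y = b h})"
      using front by (auto simp: cyl_def)
    moreover have "(\<Union>h\<in>F. cyl u c {y. a h \<bullet> y = b h}) \<in> null_sets lborel"
      using F(1) null by (intro null_sets.finite_UN) auto
    ultimately have "cyl u c (frontier Y) \<in> null_sets lborel"
      by (rule null_sets_subset[rotated 2]) (auto intro!: sets_cyl)
    then show ?thesis by auto
  qed
qed

text \<open>If \<open>x i - x k\<close> is not parallel to \<open>u\<close>, the third interface
  cuts the hyperplane in a null set. If it is parallel, the gap is constant on the hyperplane; were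
  it zero, the three interfaces would coincide and the cell of the middle one of the three collinear
  points would be flat.\<close>

lemma AE_third_gap:
  assumes k: "k \<noteq> i" "k \<noteq> j"
  shows "AE y in lborel. gap x zs i k (perp u y + c *\<^sub>R u) \<noteq> 0"
proof (cases "perp u (x i - x k) = 0")
  case False
  have "gap x zs i k (perp u y + c *\<^sub>R u) = perp u (x i - x k) \<bullet> y - (bij_coef x zs i k - c * ((x i - x k) \<bullet> u))" for y
    by (simp add: gap_def inner_add_right inner_perp_swap)
  then show ?thesis
    using AE_hyperplane[OF False, of "bij_coef x zs i k - c * ((x i - x k) \<bullet> u)"] by simp
next
  case True
  define \<kappa> where "\<kappa> = (x i - x k) \<bullet> u"
  have xk: "x i - x k = \<kappa> *\<^sub>R u" using True perp_decomp[of u "x i - x k"] by (simp add: \<kappa>_def)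
  have "x i \<noteq> x k" "x j \<noteq> x k" using x k by (auto dest: injD)
  then have "\<kappa> \<noteq> 0" "\<kappa> \<noteq> L" using xk diff_eq by (auto, metis diff_diff_eq2 diff_add_cancel add_diff_cancel_left' diff_eq_diff_eq)
  have g: "gap x zs i k y = \<kappa> * (y \<bullet> u) - bij_coef x zs i k" for y
    by (simp add: gap_def xk inner_commute)
  have "bij_coef x zs i k \<noteq> \<kappa> * c"
  proof
    assume "bij_coef x zs i k = \<kappa> * c"
    then have gik: "gap x zs i k y = \<kappa> * (y \<bullet> u - c)" for y by (simp add: g algebra_simps)
    have gjk: "gap x zs j k y = (\<kappa> - L) * (y \<bullet> u - c)" for y
      using gap_trans[of x zs j k y i] by (simp add: gik gap_ij algebra_simps)
    have cell: "0 \<le> gap x zs l m y" if "y \<in> laguerre_cell x zs l" for l m y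
      using that by (auto simp: laguerre_cell_gap)
    \<comment> \<open>Measured from \<open>x i\<close> in direction \<open>-u\<close>, the points
      \<open>x i\<close>, \<open>x j\<close>, \<open>x k\<close> sit at 0, \<open>L\<close> and
      \<open>\<kappa>\<close>; the three cases make \<open>i\<close>, \<open>k\<close> and
      \<open>j\<close> the middle point.\<close>
    consider "\<kappa> < 0" | "0 < \<kappa>" "\<kappa> < L" | "L < \<kappa>" using \<open>\<kappa> \<noteq> 0\<close> \<open>\<kappa> \<noteq> L\<close> by linarith
    then show False
    proof cases
      case 1
      show False
      proof (rule cell_not_in_hyperplane[of i], clarify)
        fix y assume "y \<in> laguerre_cell x zs i"
        then show "y \<bullet> u = c" using cell[of y i j] cell[of y i k] 1 L_pos
          by (simp add: gap_ij gik zero_le_mult_iff)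
      qed
    next
      case 2
      show False
      proof (rule cell_not_in_hyperplane[of k], clarify)
        fix y assume "y \<in> laguerre_cell x zs k"
        then show "y \<bullet> u = c" using cell[of y k i] cell[of y k j] 2 L_pos
          by (simp add: gap_swap[of x zs k] gjk gik mult_le_0_iff)
      qed
    next
      case 3
      show False
      proof (rule cell_not_in_hyperplane[of j], clarify)
        fix y assume "y \<in> laguerre_cell x zs j"
        then show "y \<bullet> u = c" using cell[of y j i] cell[of y j k] 3 L_pos
          by (simp add: gap_swap[of x zs j i] gap_ij gjk mult_le_0_iff zero_le_mult_iff)
      qed
    qed
  qed
  moreover have "(perp u y + c *\<^sub>R u) \<bullet> u = c" for y
    using norm_u uu by (simp add: inner_add_left inner_perp_self)
  ultimately show ?thesis by (simp add: g)
qed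

end

subsection \<open>First-order behaviour of cell overlaps\<close>

lemma AE_lborel_fst:
  fixes P :: "'a::euclidean_space \<Rightarrow> bool"
  assumes "AE y in lborel. P y"
  shows "AE q in (lborel :: ('a \<times> 'b::euclidean_space) measure). P (fst q)"
proof -
  obtain N where N: "{y \<in> space lborel. \<not> P y} \<subseteq> N" "N \<in> sets lborel" "emeasure lborel N = 0"
    using AE_E[OF assms] by metis
  have "emeasure (lborel \<Otimes>\<^sub>M (lborel :: 'b measure)) (N \<times> UNIV) = 0"
    using N by (subst lborel.emeasure_pair_measure_Times) auto
  then have "N \<times> (UNIV :: 'b set) \<in> null_sets (lborel \<Otimes>\<^sub>M lborel)"
    using N by (intro null_setsI pair_measureI) auto
  then have "N \<times> UNIV \<in> null_sets (lborel :: ('a \<times> 'b) measure)"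
    unfolding lborel_prod .
  then show ?thesis by (rule AE_I') (use N in auto)
qed

lemma AE_lborel_snd_neq: "AE q in (lborel :: ('a::euclidean_space \<times> real) measure). snd q \<noteq> a"
  using AE_hyperplane[of "(0, 1) :: 'a \<times> real" a] by (simp add: inner_prod_def zero_prod_def)

context face
begin

text \<open>Substituting \<open>c + t * s\<close> for the height along \<open>u\<close> extracts the
  factor \<open>t\<close>, so \<open>R S / t\<close> becomes an integral over a domain that does not
  move with \<open>t\<close>, ready for dominated convergence.\<close>

lemma emeasure_slice:
  assumes S [measurable]: "S \<in> sets borel" and t: "0 < t"
  shows "emeasure R S = ennreal t * (\<integral>\<^sup>+q. ennreal (indicator (slab u) (fst q) *
     (\<rho> (perp u (fst q) + (c + t * snd q) *\<^sub>R u) * indicator S (perp u (fst q) + (c + t * snd q) *\<^sub>R u))) \<partial>lborel)"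
proof -
  note [measurable] = assumption_A1_facts(7)[OF A1]
  define g where "g y = ennreal (\<rho> y * indicator S y)" for y
  have [measurable]: "g \<in> borel_measurable borel" unfolding g_def by measurable
  have "emeasure R S = (\<integral>\<^sup>+y. g y \<partial>lborel)"
    unfolding assumption_A1_facts(2)[OF A1] g_def by (subst emeasure_density) (auto simp: ennreal_mult'' ennreal_indicator)
  also have "\<dots> = (\<integral>\<^sup>+y. indicator (slab u) y * (\<integral>\<^sup>+s. g (perp u y + s *\<^sub>R u) \<partial>lborel) \<partial>lborel)"
    by (rule nn_integral_lborel_fubini_direction[OF norm_u]) measurable
  also have "\<dots> = (\<integral>\<^sup>+y. indicator (slab u) y * (ennreal t * (\<integral>\<^sup>+s. g (perp u y + (c + t * s) *\<^sub>R u) \<partial>lborel)) \<partial>lborel)"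
  proof (rule nn_integral_cong)
    fix y
    have "(\<integral>\<^sup>+s. g (perp u y + s *\<^sub>R u) \<partial>lborel) = ennreal t * (\<integral>\<^sup>+s. g (perp u y + (c + t * s) *\<^sub>R u) \<partial>lborel)"
      using t by (subst nn_integral_real_affine[where c=t and t=c]) auto
    then show "indicator (slab u) y * (\<integral>\<^sup>+s. g (perp u y + s *\<^sub>R u) \<partial>lborel) =
      indicator (slab u) y * (ennreal t * (\<integral>\<^sup>+s. g (perp u y + (c + t * s) *\<^sub>R u) \<partial>lborel))" by simp
  qed
  also have "\<dots> = ennreal t * (\<integral>\<^sup>+y. \<integral>\<^sup>+s. indicator (slab u) y * g (perp u y + (c + t * s) *\<^sub>R u) \<partial>lborel \<partial>lborel)"
    by (subst nn_integral_cmult[symmetric]) (auto simp: nn_integral_cmult mult_ac)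
  also have "(\<integral>\<^sup>+y. \<integral>\<^sup>+s. indicator (slab u) y * g (perp u y + (c + t * s) *\<^sub>R u) \<partial>lborel \<partial>lborel)
      = (\<integral>\<^sup>+q. indicator (slab u) (fst q) * g (perp u (fst q) + (c + t * snd q) *\<^sub>R u) \<partial>(lborel \<Otimes>\<^sub>M lborel))"
    by (subst lborel.nn_integral_fst[symmetric]) auto
  also have "\<dots> = (\<integral>\<^sup>+q. ennreal (indicator (slab u) (fst q) *
     (\<rho> (perp u (fst q) + (c + t * snd q) *\<^sub>R u) * indicator S (perp u (fst q) + (c + t * snd q) *\<^sub>R u))) \<partial>lborel)"
    unfolding lborel_prod g_def by (intro nn_integral_cong) (auto simp: indicator_def)
  finally show ?thesis .
qed

lemma measure_slice:
  assumes S [measurable]: "S \<in> sets borel" and t: "0 < t"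
  shows "measure R S / t = (\<integral>q. indicator (slab u) (fst q) *
     (\<rho> (perp u (fst q) + (c + t * snd q) *\<^sub>R u) * indicator S (perp u (fst q) + (c + t * snd q) *\<^sub>R u)) \<partial>lborel)"
proof -
  note [measurable] = assumption_A1_facts(7)[OF A1]
  have "(\<lambda>q. indicator (slab u) (fst q) * (\<rho> (perp u (fst q) + (c + t * snd q) *\<^sub>R u) *
     indicator S (perp u (fst q) + (c + t * snd q) *\<^sub>R u)) :: real) \<in> borel_measurable (borel \<Otimes>\<^sub>M borel)"
    by measurable
  then show ?thesis
    unfolding measure_def emeasure_slice[OF assms]
    using t assumption_A1_facts(3)[OF A1] by (subst integral_eq_nn_integral) (auto simp: enn2real_mult borel_prod)
qed

lemma density_bound:
  obtains M where "\<And>y. \<rho> y \<le> M" "0 \<le> M"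
proof -
  have "bounded (\<rho> ` Y)"
    using assumption_A1_facts(4,5)[OF A1] by (intro compact_imp_bounded compact_continuous_image)
  then obtain M where M: "\<And>y. y \<in> Y \<Longrightarrow> \<bar>\<rho> y\<bar> \<le> M" by (auto simp: bounded_iff)
  have "\<rho> y \<le> \<bar>M\<bar>" for y using M[of y] assumption_A1_facts(6)[OF A1, of y] by (cases "y \<in> Y") auto
  then show ?thesis by (intro that[of "\<bar>M\<bar>"]) auto
qed

text \<open>The density may jump to 0 across the boundary of \<open>Y\<close>, but nowhere
  else.\<close>

lemma density_isCont:
  assumes "w \<notin> frontier Y"
  shows "isCont \<rho> w"
proof (cases "w \<in> Y")
  case True
  have cl: "closed Y" using assumption_A1_facts(4)[OF A1] by (rule compact_imp_closed)
  then have "w \<in> interior Y" using assms True by (simp add: frontier_def closure_closed)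
  then show ?thesis using assumption_A1_facts(5)[OF A1] by (rule continuous_on_interior[rotated])
next
  case False
  have "open (- Y)" using compact_imp_closed[OF assumption_A1_facts(4)[OF A1]] by auto
  moreover have "continuous_on (- Y) \<rho>"
    using assumption_A1_facts(6)[OF A1] by (subst continuous_on_cong[OF refl, of _ _ "\<lambda>_. 0"]) auto
  ultimately show ?thesis using False by (simp add: continuous_on_eq_continuous_at)
qed

abbreviation "D \<equiv> laguerre_cell x zs i \<inter> laguerre_cell x zs j"

lemma D_subset: "D \<subseteq> {y. y \<bullet> u = c}"
proof
  fix y assume y: "y \<in> D"
  then have "0 \<le> gap x zs i j y" "0 \<le> gap x zs j i y" by (auto simp: laguerre_cell_gap)
  then have "gap x zs i j y = 0" using gap_swap[of x zs j i y] by simp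
  then show "y \<in> {y. y \<bullet> u = c}" using L_pos by (simp add: gap_ij)
qed

text \<open>The limit integrand is a product of a function of the base point and one of the rescaled
  height, so Tonelli separates them; \<open>max 0\<close> accounts for an empty interval.\<close>

lemma integral_limit:
  "(\<integral>q. indicator (slab u) (fst q) * (\<rho> (perp u (fst q) + c *\<^sub>R u) * indicator D (perp u (fst q) + c *\<^sub>R u))
     * indicator {\<alpha>..\<beta>} (snd q) \<partial>(lborel :: ('a \<times> real) measure)) = R_plus \<rho> D * max 0 (\<beta> - \<alpha>)"
proof -
  note [measurable] = assumption_A1_facts(7)[OF A1]
  define F where "F y = indicator (slab u) y * (\<rho> (perp u y + c *\<^sub>R u) * indicator D (perp u y + c *\<^sub>R u))" for y
  have [measurable]: "F \<in> borel_measurable borel" unfolding F_def by measurable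
  have F0: "0 \<le> F y" for y using assumption_A1_facts(3)[OF A1] by (simp add: F_def)
  have "R_plus \<rho> D = (\<integral>y. F y \<partial>lborel)"
    unfolding R_plus_def F_def
    by (subst set_integral_hausdorff_hyperplane[OF norm_u _ D_subset]) (auto simp: mult_ac)
  also have "\<dots> = enn2real (\<integral>\<^sup>+y. F y \<partial>lborel)"
    using F0 by (intro integral_eq_nn_integral) auto
  finally have R: "R_plus \<rho> D = enn2real (\<integral>\<^sup>+y. F y \<partial>lborel)" .
  have "(\<integral>q. F (fst q) * indicator {\<alpha>..\<beta>} (snd q) \<partial>(lborel :: ('a \<times> real) measure)) =
     enn2real (\<integral>\<^sup>+q. ennreal (F (fst q) * indicator {\<alpha>..\<beta>} (snd q)) \<partial>(lborel :: ('a \<times> real) measure))"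
  proof (rule integral_eq_nn_integral)
    have "(\<lambda>q. F (fst q) * indicator {\<alpha>..\<beta>} (snd q)) \<in> borel_measurable (borel \<Otimes>\<^sub>M borel)" by measurable
    then show "(\<lambda>q. F (fst q) * indicator {\<alpha>..\<beta>} (snd q)) \<in> borel_measurable lborel" by (simp add: borel_prod)
  qed (use F0 in auto)
  also have "(\<integral>\<^sup>+q. ennreal (F (fst q) * indicator {\<alpha>..\<beta>} (snd q)) \<partial>(lborel :: ('a \<times> real) measure)) =
     (\<integral>\<^sup>+y. \<integral>\<^sup>+s. ennreal (F y) * indicator {\<alpha>..\<beta>} s \<partial>(lborel :: real measure) \<partial>lborel)"
    unfolding lborel_prod[symmetric] using F0
    by (subst lborel.nn_integral_fst[symmetric]) (auto simp: ennreal_mult ennreal_indicator)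
  also have "\<dots> = (\<integral>\<^sup>+y. F y \<partial>lborel) * ennreal (max 0 (\<beta> - \<alpha>))"
    by (simp add: nn_integral_cmult nn_integral_multc emeasure_lborel_Icc_eq max_def)
  also have "enn2real \<dots> = R_plus \<rho> D * max 0 (\<beta> - \<alpha>)"
    by (cases "\<alpha> \<le> \<beta>") (auto simp: enn2real_mult R max_def ennreal_neg)
  finally show ?thesis unfolding F_def .
qed

text \<open>In rescaled coordinates the conditions between \<open>i\<close> and \<open>j\<close> say
  that the height lies between \<open>e1 n\<close> and \<open>e2 n\<close>, which converge to
  \<open>\<alpha>\<close> and \<open>\<beta>\<close>. The conditions against a third index have a
  nonzero limit almost everywhere, so their truth values eventually settle.\<close>

theorem overlap_limit:
  fixes z1 z2 :: "nat \<Rightarrow> real^'n" and h1 h2 :: "real^'n"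
  assumes t: "\<And>n. 0 < t n" "t \<longlonglongrightarrow> 0"
    and z1: "\<And>k. (\<lambda>n. (z1 n $ k - zs $ k) / t n) \<longlonglongrightarrow> h1 $ k"
    and z2: "\<And>k. (\<lambda>n. (z2 n $ k - zs $ k) / t n) \<longlonglongrightarrow> h2 $ k"
  shows "(\<lambda>n. measure R (laguerre_cell x (z1 n) i \<inter> laguerre_cell x (z2 n) j) / t n)
    \<longlonglongrightarrow> R_plus \<rho> D * max 0 ((h2 $ j - h2 $ i - h1 $ j + h1 $ i) / L)"
proof -
  note [measurable] = assumption_A1_facts(7)[OF A1]
  define S where "S n = laguerre_cell x (z1 n) i \<inter> laguerre_cell x (z2 n) j" for n
  define W where "W n q = perp u (fst q) + (c + t n * snd q) *\<^sub>R u" for n and q :: "'a \<times> real"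
  define W0 where "W0 q = perp u (fst q) + c *\<^sub>R u" for q :: "'a \<times> real"
  define d1 where "d1 n k = (z1 n $ k - zs $ k) / t n" for n k
  define d2 where "d2 n k = (z2 n $ k - zs $ k) / t n" for n k
  define e1 where "e1 n = (d1 n j - d1 n i) / L" for n
  define e2 where "e2 n = (d2 n j - d2 n i) / L" for n
  define \<alpha> where "\<alpha> = (h1 $ j - h1 $ i) / L"
  define \<beta> where "\<beta> = (h2 $ j - h2 $ i) / L"
  have d1: "z1 n $ k - zs $ k = t n * d1 n k" and d2: "z2 n $ k - zs $ k = t n * d2 n k" for n k
    using t(1)[of n] by (simp_all add: d1_def d2_def)
  have d1_lim: "(\<lambda>n. d1 n k) \<longlonglongrightarrow> h1 $ k" and d2_lim: "(\<lambda>n. d2 n k) \<longlonglongrightarrow> h2 $ k" for k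
    using z1 z2 by (simp_all add: d1_def d2_def)
  have e1_lim: "e1 \<longlonglongrightarrow> \<alpha>" and e2_lim: "e2 \<longlonglongrightarrow> \<beta>"
    using L_pos unfolding e1_def e2_def \<alpha>_def \<beta>_def by (auto intro!: tendsto_intros d1_lim d2_lim)
  have Wu: "W n q \<bullet> u = c + t n * snd q" and W0u: "W0 q \<bullet> u = c" for n q
    using norm_u uu by (simp_all add: W_def W0_def inner_add_left inner_perp_self)
  have gap1: "gap x (z1 n) i j (W n q) = L * t n * (snd q - e1 n)" for n q
  proof -
    have "gap x (z1 n) i j (W n q) = L * (t n * snd q) + t n * d1 n i - t n * d1 n j"
      using gap_shift[of x "z1 n" i j "W n q" zs] by (simp add: gap_ij Wu d1)
    moreover have "L * e1 n = d1 n j - d1 n i" using L_pos by (simp add: e1_def)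
    ultimately show ?thesis by algebra
  qed
  have gap2: "gap x (z2 n) j i (W n q) = L * t n * (e2 n - snd q)" for n q
  proof -
    have "gap x (z2 n) j i (W n q) = - (L * (t n * snd q)) + t n * d2 n j - t n * d2 n i"
      using gap_shift[of x "z2 n" j i "W n q" zs] by (simp add: gap_swap[of x zs j i] gap_ij Wu d2)
    moreover have "L * e2 n = d2 n j - d2 n i" using L_pos by (simp add: e2_def)
    ultimately show ?thesis by algebra
  qed
  have pos: "0 < L * t n" for n using L_pos t(1) by simp
  define G where "G n q = indicator (slab u) (fst q) * (\<rho> (W n q) * indicator (S n) (W n q))" for n q
  define G0 where "G0 q = indicator (slab u) (fst q) * (\<rho> (W0 q) * indicator D (W0 q)) * indicator {\<alpha>..\<beta>} (snd q)" for q
  have meas: "measure R (S n) / t n = (\<integral>q. G n q \<partial>lborel)" for n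
    unfolding G_def W_def by (rule measure_slice) (auto simp: S_def t)
  obtain M where M: "\<And>y. \<rho> y \<le> M" "0 \<le> M" using density_bound by metis
  obtain r where r: "\<And>y. y \<in> Y \<Longrightarrow> norm y \<le> r"
    using compact_imp_bounded[OF assumption_A1_facts(4)[OF A1]] by (auto simp: bounded_iff)
  obtain K1 where K1: "\<And>n. \<bar>e1 n\<bar> \<le> K1" using convergent_imp_Bseq[OF convergentI[OF e1_lim]] by (auto simp: Bseq_def)
  obtain K2 where K2: "\<And>n. \<bar>e2 n\<bar> \<le> K2" using convergent_imp_Bseq[OF convergentI[OF e2_lim]] by (auto simp: Bseq_def)
  define K where "K = max K1 K2"
  \<comment> \<open>The box dominating all \<open>n\<close>: a point of \<open>Y\<close> has
    projection of norm at most \<open>r\<close>, the slab coordinate adds at most 1, and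
    \<open>K\<close> bounds both endpoints of the interval.\<close>
  let ?C = "cball 0 (r + 1) \<times> {- K..K} :: ('a \<times> real) set"
  have "(\<lambda>n. \<integral>q. G n q \<partial>lborel) \<longlonglongrightarrow> (\<integral>q. G0 q \<partial>lborel)"
  proof (rule integral_dominated_convergence[where w="\<lambda>q. M * indicator ?C q"])
    have "G0 \<in> borel_measurable (borel \<Otimes>\<^sub>M borel)" unfolding G0_def W0_def by measurable
    then show "G0 \<in> borel_measurable lborel" by (simp add: borel_prod)
    have "G n \<in> borel_measurable (borel \<Otimes>\<^sub>M borel)" for n unfolding G_def W_def S_def by measurable
    then show "G n \<in> borel_measurable lborel" for n by (simp add: borel_prod)
    have "compact ?C" by (intro compact_Times) auto
    then show "integrable lborel (\<lambda>q. M * indicator ?C q)"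
      by (intro integrable_mult_right integrable_real_indicator emeasure_compact_finite) (auto intro: borel_compact)
    show "AE q in lborel. norm (G n q) \<le> M * indicator ?C q" for n
    proof (rule AE_I2)
      fix q :: "'a \<times> real"
      show "norm (G n q) \<le> M * indicator ?C q"
      proof (cases "G n q = 0")
        case True
        then show ?thesis using M by (simp add: indicator_def)
      next
        case False
        then have q: "fst q \<in> slab u" "\<rho> (W n q) \<noteq> 0" "W n q \<in> S n"
          by (auto simp: G_def indicator_def split: if_splits)
        then have "0 \<le> gap x (z1 n) i j (W n q)" "0 \<le> gap x (z2 n) j i (W n q)"
          by (auto simp: S_def laguerre_cell_gap)
        then have "e1 n \<le> snd q" "snd q \<le> e2 n"
          using pos[of n] unfolding gap1 gap2 by (auto simp: zero_le_mult_iff)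
        then have "snd q \<in> {- K..K}" using K1[of n] K2[of n] by (auto simp: K_def abs_le_iff le_max_iff_disj min_def)
        moreover have "norm (fst q) \<le> r + 1"
        proof -
          have "W n q \<in> Y" using q(2) assumption_A1_facts(6)[OF A1] by blast
          then have "norm (W n q) \<le> r" by (rule r)
          moreover have "(norm (perp u (fst q)))\<^sup>2 \<le> (norm (W n q))\<^sup>2"
            unfolding W_def norm_perp_plus[OF norm_u] by simp
          then have "norm (perp u (fst q)) \<le> norm (W n q)" by (rule power2_le_imp_le) simp
          moreover have "norm (fst q) \<le> norm (perp u (fst q)) + norm ((fst q \<bullet> u) *\<^sub>R u)"
            by (metis norm_triangle_ineq perp_decomp)
          moreover have "norm ((fst q \<bullet> u) *\<^sub>R u) \<le> 1" using q(1) norm_u by (simp add: slab_def)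
          ultimately show ?thesis by linarith
        qed
        ultimately have "q \<in> ?C" by (cases q) auto
        moreover have "norm (G n q) \<le> M"
          using M assumption_A1_facts(3)[OF A1] by (auto simp: G_def indicator_def)
        ultimately show ?thesis by simp
      qed
    qed
    have "AE q in (lborel :: ('a \<times> real) measure). fst q \<notin> cyl u c (frontier Y)"
      using null_cyl_frontier
      by (intro AE_lborel_fst AE_not_in null_setsI) (auto intro!: sets_cyl)
    moreover have "AE q in (lborel :: ('a \<times> real) measure). \<forall>k. k \<noteq> i \<longrightarrow> k \<noteq> j \<longrightarrow> gap x zs i k (W0 q) \<noteq> 0"
    proof -
      have "AE q in (lborel :: ('a \<times> real) measure). k \<noteq> i \<longrightarrow> k \<noteq> j \<longrightarrow> gap x zs i k (W0 q) \<noteq> 0" for k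
        using AE_lborel_fst[OF AE_third_gap[of k]] by (cases "k = i \<or> k = j") (auto simp: W0_def)
      then show ?thesis by (simp add: AE_all_countable)
    qed
    ultimately show "AE q in lborel. (\<lambda>n. G n q) \<longlonglongrightarrow> G0 q"
      using AE_lborel_snd_neq[of \<alpha>] AE_lborel_snd_neq[of \<beta>]
    proof eventually_elim
      fix q :: "'a \<times> real"
      assume q: "fst q \<notin> cyl u c (frontier Y)" "\<forall>k. k \<noteq> i \<longrightarrow> k \<noteq> j \<longrightarrow> gap x zs i k (W0 q) \<noteq> 0"
        "snd q \<noteq> \<alpha>" "snd q \<noteq> \<beta>"
      show "(\<lambda>n. G n q) \<longlonglongrightarrow> G0 q"
      proof (cases "fst q \<in> slab u")
        case False
        then show ?thesis by (simp add: G_def G0_def)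
      next
        case True
        then have "W0 q \<notin> frontier Y" using q(1) by (simp add: cyl_def W0_def)
        then have cont: "isCont \<rho> (W0 q)" by (rule density_isCont)
        have "(\<lambda>n. perp u (fst q) + (c + t n * snd q) *\<^sub>R u) \<longlonglongrightarrow> perp u (fst q) + (c + 0 * snd q) *\<^sub>R u"
          by (intro tendsto_intros t)
        then have W_lim: "(\<lambda>n. W n q) \<longlonglongrightarrow> W0 q" by (simp add: W_def W0_def)
        have rho: "(\<lambda>n. \<rho> (W n q)) \<longlonglongrightarrow> \<rho> (W0 q)"
          using cont W_lim by (rule isCont_tendsto_compose)
        have gapW: "(\<lambda>n. gap x zs k l (W n q)) \<longlonglongrightarrow> gap x zs k l (W0 q)" for k l
          unfolding gap_def by (intro tendsto_intros W_lim)
        have td: "(\<lambda>n. t n * d n) \<longlonglongrightarrow> 0" if "d \<longlonglongrightarrow> h" for d :: "nat \<Rightarrow> real" and h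
          using tendsto_mult[OF t(2) that] by simp
        have lim1: "(\<lambda>n. gap x (z1 n) k l (W n q)) \<longlonglongrightarrow> gap x zs k l (W0 q)" for k l
        proof -
          have "(\<lambda>n. gap x zs k l (W n q) + t n * d1 n k - t n * d1 n l) \<longlonglongrightarrow> gap x zs k l (W0 q) + 0 - 0"
            by (intro tendsto_intros gapW td[OF d1_lim])
          moreover have "gap x (z1 n) k l (W n q) = gap x zs k l (W n q) + t n * d1 n k - t n * d1 n l" for n
            using gap_shift[of x "z1 n" k l "W n q" zs] by (simp add: d1)
          ultimately show ?thesis by simp
        qed
        have lim2: "(\<lambda>n. gap x (z2 n) k l (W n q)) \<longlonglongrightarrow> gap x zs k l (W0 q)" for k l
        proof -
          have "(\<lambda>n. gap x zs k l (W n q) + t n * d2 n k - t n * d2 n l) \<longlonglongrightarrow> gap x zs k l (W0 q) + 0 - 0"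
            by (intro tendsto_intros gapW td[OF d2_lim])
          moreover have "gap x (z2 n) k l (W n q) = gap x zs k l (W n q) + t n * d2 n k - t n * d2 n l" for n
            using gap_shift[of x "z2 n" k l "W n q" zs] by (simp add: d2)
          ultimately show ?thesis by simp
        qed
        have gij: "gap x zs i j (W0 q) = 0" by (simp add: gap_ij W0u)
        \<comment> \<open>On the interface \<open>i\<close> and \<open>j\<close> cost the same, so
          comparing either with a third index is a single condition.\<close>
        then have gjk: "gap x zs j k (W0 q) = gap x zs i k (W0 q)" for k
          using gap_trans[of x zs j k "W0 q" i] by simp
        \<comment> \<open>Convergence decides a weak inequality only away from a zero limit; this is
          why heights equal to \<open>\<alpha>\<close> or \<open>\<beta>\<close> and points on third
          interfaces were discarded.\<close>
        have sign: "\<forall>\<^sub>F n in sequentially. 0 \<le> f n \<longleftrightarrow> 0 \<le> l"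
          if "f \<longlonglongrightarrow> l" "l \<noteq> 0" for f :: "nat \<Rightarrow> real" and l
        proof (cases "0 < l")
          case True
          then have "\<forall>\<^sub>F n in sequentially. 0 < f n" using order_tendstoD(1)[OF that(1)] by blast
          then show ?thesis by eventually_elim (use True in auto)
        next
          case False
          then have "\<forall>\<^sub>F n in sequentially. f n < 0" using order_tendstoD(2)[OF that(1)] that(2) by auto
          then show ?thesis by eventually_elim (use False that(2) in auto)
        qed
        have ev1: "\<forall>\<^sub>F n in sequentially. 0 \<le> snd q - e1 n \<longleftrightarrow> 0 \<le> snd q - \<alpha>"
          using q(3) by (intro sign tendsto_intros e1_lim) auto
        have ev2: "\<forall>\<^sub>F n in sequentially. 0 \<le> e2 n - snd q \<longleftrightarrow> 0 \<le> \<beta> - snd q"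
          using q(4) by (intro sign tendsto_intros e2_lim) auto
        have ev3: "\<forall>\<^sub>F n in sequentially. \<forall>k\<in>UNIV - {i, j}.
            (0 \<le> gap x (z1 n) i k (W n q) \<longleftrightarrow> 0 \<le> gap x zs i k (W0 q)) \<and>
            (0 \<le> gap x (z2 n) j k (W n q) \<longleftrightarrow> 0 \<le> gap x zs i k (W0 q))"
        proof (rule eventually_ball_finite)
          show "\<forall>k\<in>UNIV - {i, j}. \<forall>\<^sub>F n in sequentially.
            (0 \<le> gap x (z1 n) i k (W n q) \<longleftrightarrow> 0 \<le> gap x zs i k (W0 q)) \<and>
            (0 \<le> gap x (z2 n) j k (W n q) \<longleftrightarrow> 0 \<le> gap x zs i k (W0 q))"
          proof
            fix k assume "k \<in> UNIV - {i, j}"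
            then have "gap x zs i k (W0 q) \<noteq> 0" using q(2) by auto
            then show "\<forall>\<^sub>F n in sequentially.
              (0 \<le> gap x (z1 n) i k (W n q) \<longleftrightarrow> 0 \<le> gap x zs i k (W0 q)) \<and>
              (0 \<le> gap x (z2 n) j k (W n q) \<longleftrightarrow> 0 \<le> gap x zs i k (W0 q))"
              using lim2[of j k] unfolding gjk by (intro eventually_conj sign lim1)
          qed
        qed simp
        have split: "(\<forall>k. P k) \<longleftrightarrow> P i \<and> P j \<and> (\<forall>k\<in>UNIV - {i, j}. P k)" for P :: "'n \<Rightarrow> bool"
          by blast
        have WD: "W0 q \<in> D \<longleftrightarrow> (\<forall>k\<in>UNIV - {i, j}. 0 \<le> gap x zs i k (W0 q))"
          unfolding laguerre_cell_gap Int_iff mem_Collect_eq gjk split[of "\<lambda>k. 0 \<le> gap x zs i k (W0 q)"]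
          by (simp add: gij)
        have "\<forall>\<^sub>F n in sequentially. W n q \<in> S n \<longleftrightarrow> W0 q \<in> D \<and> snd q \<in> {\<alpha>..\<beta>}"
          using ev1 ev2 ev3
        proof eventually_elim
          case (elim n)
          have "W n q \<in> S n \<longleftrightarrow> (0 \<le> gap x (z1 n) i j (W n q) \<and> 0 \<le> gap x (z2 n) j i (W n q)) \<and>
             (\<forall>k\<in>UNIV - {i, j}. 0 \<le> gap x (z1 n) i k (W n q) \<and> 0 \<le> gap x (z2 n) j k (W n q))"
            unfolding S_def laguerre_cell_gap Int_iff mem_Collect_eq
              split[of "\<lambda>k. 0 \<le> gap x (z1 n) i k (W n q)"] split[of "\<lambda>k. 0 \<le> gap x (z2 n) j k (W n q)"]
            by auto
          also have "\<dots> \<longleftrightarrow> (0 \<le> snd q - e1 n \<and> 0 \<le> e2 n - snd q) \<and> W0 q \<in> D"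
          proof -
            have "0 \<le> L * t n * a \<longleftrightarrow> 0 \<le> a" for a
              using mult_le_cancel_left_pos[OF pos[of n], of 0 a] by simp
            then show ?thesis unfolding gap1 gap2 WD using elim(3) by simp
          qed
          finally show ?case using elim(1,2) by auto
        qed
        then have "\<forall>\<^sub>F n in sequentially. indicator (S n) (W n q) = (indicator D (W0 q) * indicator {\<alpha>..\<beta>} (snd q) :: real)"
          by eventually_elim (auto simp: indicator_def)
        then have "(\<lambda>n. indicator (S n) (W n q) :: real) \<longlonglongrightarrow> indicator D (W0 q) * indicator {\<alpha>..\<beta>} (snd q)"
          by (rule tendsto_eventually)
        then have "(\<lambda>n. indicator (slab u) (fst q) * (\<rho> (W n q) * indicator (S n) (W n q)))
           \<longlonglongrightarrow> indicator (slab u) (fst q) * (\<rho> (W0 q) * (indicator D (W0 q) * indicator {\<alpha>..\<beta>} (snd q)))"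
          by (intro tendsto_mult tendsto_const rho)
        then show ?thesis by (simp add: G_def G0_def mult.assoc)
      qed
    qed
  qed
  moreover have "(\<integral>q. G0 q \<partial>lborel) = R_plus \<rho> D * max 0 (\<beta> - \<alpha>)"
    unfolding G0_def W0_def by (rule integral_limit)
  moreover have "\<beta> - \<alpha> = (h2 $ j - h2 $ i - h1 $ j + h1 $ i) / L"
    by (simp add: \<alpha>_def \<beta>_def diff_divide_distrib[symmetric] algebra_simps)
  ultimately show ?thesis
    unfolding S_def[symmetric] meas by simp
qed

end

section \<open>Assembling ordered pairs into the derivative\<close>

lemma sum_pairs_strict:
  fixes f :: "'n::{finite,linorder} \<Rightarrow> 'n \<Rightarrow> real"
  assumes "\<And>i. f i i = 0"
  shows "(\<Sum>(i, j)\<in>UNIV. f i j) = (\<Sum>(i, j)\<in>{(i, j). i < j}. f i j + f j i)"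
proof -
  have "(\<Sum>(i, j)\<in>UNIV. f i j) = (\<Sum>(i, j)\<in>{(i, j). i < j} \<union> {(i, j). j < i}. f i j)"
    using assms by (intro sum.mono_neutral_right) (auto simp: not_less_iff_gr_or_eq)
  also have "\<dots> = (\<Sum>(i, j)\<in>{(i, j). i < j}. f i j) + (\<Sum>(i, j)\<in>{(i, j). j < i}. f i j)"
    by (intro sum.union_disjoint) auto
  also have "(\<Sum>(i, j)\<in>{(i, j). j < i}. f i j) = (\<Sum>(i, j)\<in>{(i, j). i < j}. f j i)"
    by (rule sum.reindex_bij_witness[of _ prod.swap prod.swap]) auto
  finally show ?thesis by (simp add: sum.distrib case_prod_unfold)
qed

lemma delta_s_refl: "delta_s R x s (z, z) = 0"
  by (simp add: delta_s_def)

theorem theorem1: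
  fixes R :: "'a::euclidean_space measure" and \<rho> :: "'a \<Rightarrow> real" and Y :: "'a set"
    and x :: "'n::{finite,linorder} \<Rightarrow> 'a" and p :: "'n \<Rightarrow> real"
    and zs :: "real^('n::{finite,linorder})" and s :: real
  assumes A1: "assumption_A1 R \<rho> Y"
    and x_distinct: "inj x"
    and p_pos: "\<forall>i. p i > 0" and p_sum: "(\<Sum>i\<in>UNIV. p i) = 1"
    and zs_opt: "\<forall>z. dual_obj R x p z \<le> dual_obj R x p zs"
    and s_ge: "s \<ge> 1"
  shows "hadamard_dir_diff (delta_s R x s) UNIV (zs, zs)
           (\<lambda>(h1, h2). \<Sum>(i, j) \<in> {(i, j). i < j}.
               norm (x i - x j) powr (s - 1)
               * R_plus \<rho> (laguerre_cell x zs i \<inter> laguerre_cell x zs j)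
               * \<bar>h2 $ j - h2 $ i - h1 $ j + h1 $ i\<bar>)"
  proof -
  let ?C = "\<lambda>z i. laguerre_cell x z i"
  let ?D = "\<lambda>i j. ?C zs i \<inter> ?C zs j"
  show ?thesis
    unfolding hadamard_dir_diff_def
  proof (intro allI impI, elim conjE)
    fix t :: "nat \<Rightarrow> real" and \<theta> and h :: "(real, 'n) vec \<times> (real, 'n) vec"
    assume t: "\<forall>n. 0 < t n" "t \<longlonglongrightarrow> 0" and lim: "(\<lambda>n. (1 / t n) *\<^sub>R (\<theta> n - (zs, zs))) \<longlonglongrightarrow> h"
    obtain h1 h2 where h: "h = (h1, h2)" by (cases h)
    define z1 where "z1 n = fst (\<theta> n)" for n
    define z2 where "z2 n = snd (\<theta> n)" for n
    have \<theta>: "\<theta> n = (z1 n, z2 n)" for n by (simp add: z1_def z2_def)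
    have l1: "(\<lambda>n. (z1 n $ k - zs $ k) / t n) \<longlonglongrightarrow> h1 $ k" for k
      using tendsto_vec_nth[OF tendsto_fst[OF lim], of k] by (simp add: h z1_def)
    have l2: "(\<lambda>n. (z2 n $ k - zs $ k) / t n) \<longlonglongrightarrow> h2 $ k" for k
      using tendsto_vec_nth[OF tendsto_snd[OF lim], of k] by (simp add: h z2_def)
    define v where "v i j = h2 $ j - h2 $ i - h1 $ j + h1 $ i" for i j
    \<comment> \<open>The limit for one ordered pair. It retains only the positive part of
      \<open>v i j\<close>, because points move from cell \<open>i\<close> to cell \<open>j\<close>
      only if the interface shifts towards \<open>x i\<close>.\<close>
    define w where "w i j = norm (x i - x j) powr s * (R_plus \<rho> (?D i j) * max 0 (v i j / norm (x i - x j)))" for i j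
    have pair: "(\<lambda>n. norm (x i - x j) powr s * (measure R (?C (z1 n) i \<inter> ?C (z2 n) j) / t n)) \<longlonglongrightarrow> w i j" for i j
    proof (cases "i = j")
      case True
      then show ?thesis by (simp add: w_def)
    next
      case False
      interpret face R \<rho> Y x p zs i j
        using A1 x_distinct p_pos zs_opt False by unfold_locales auto
      have "(\<lambda>n. measure R (?C (z1 n) i \<inter> ?C (z2 n) j) / t n) \<longlonglongrightarrow>
          R_plus \<rho> (?D i j) * max 0 (v i j / norm (x i - x j))"
        using overlap_limit[of t z1 h1 z2 h2] t l1 l2 by (simp add: L_def v_def)
      then show ?thesis unfolding w_def by (rule tendsto_mult_left)
    qed
    have "(delta_s R x s (\<theta> n) - delta_s R x s (zs, zs)) / t n =
       (\<Sum>(i, j)\<in>UNIV. norm (x i - x j) powr s * (measure R (?C (z1 n) i \<inter> ?C (z2 n) j) / t n))" for n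
      unfolding \<theta> delta_s_refl delta_s_sum[OF A1 x_distinct]
      by (simp add: sum_divide_distrib case_prod_unfold)
    moreover have "(\<lambda>n. \<Sum>(i, j)\<in>UNIV. norm (x i - x j) powr s * (measure R (?C (z1 n) i \<inter> ?C (z2 n) j) / t n))
       \<longlonglongrightarrow> (\<Sum>(i, j)\<in>UNIV. w i j)"
      unfolding case_prod_unfold by (intro tendsto_sum pair)
    moreover have "(\<Sum>(i, j)\<in>UNIV. w i j) = (\<Sum>(i, j)\<in>{(i, j). i < j}. w i j + w j i)"
      by (rule sum_pairs_strict) (simp add: w_def)
    moreover have "w i j + w j i = norm (x i - x j) powr (s - 1) * R_plus \<rho> (?D i j) * \<bar>v i j\<bar>" if "i < j" for i j
    proof -
      define l where "l = norm (x i - x j)"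
      have l: "0 < l" using x_distinct that by (auto simp: l_def dest: injD)
      have lji: "norm (x j - x i) = l" by (simp add: l_def norm_minus_commute)
      have vji: "v j i = - v i j" by (simp add: v_def)
      \<comment> \<open>Since \<open>v\<close> is antisymmetric, the reversed pair supplies the
        negative part; the common divisor \<open>l\<close> then lowers the exponent of the distance
        by one.\<close>
      have "max 0 (v i j / l) + max 0 (- v i j / l) = \<bar>v i j\<bar> / l"
        using l by (auto simp: max_def abs_if field_simps)
      then have "w i j + w j i = l powr s * (R_plus \<rho> (?D i j) * (\<bar>v i j\<bar> / l))"
        unfolding w_def lji vji l_def[symmetric] Int_commute[of "?C zs j"]
        by (simp add: distrib_left[symmetric])
      also have "\<dots> = (l powr s / l) * R_plus \<rho> (?D i j) * \<bar>v i j\<bar>" by simp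
      also have "l powr s / l = l powr (s - 1)" using l by (simp add: powr_diff)
      finally show ?thesis by (simp add: l_def)
    qed
    then have "(\<Sum>(i, j)\<in>{(i, j). i < j}. w i j + w j i) =
        (\<Sum>(i, j)\<in>{(i, j). i < j}. norm (x i - x j) powr (s - 1) * R_plus \<rho> (?D i j) * \<bar>v i j\<bar>)"
      by (intro sum.cong) auto
    ultimately show "(\<lambda>n. (delta_s R x s (\<theta> n) - delta_s R x s (zs, zs)) / t n) \<longlonglongrightarrow>
       (case h of (h1, h2) \<Rightarrow> \<Sum>(i, j) \<in> {(i, j). i < j}. norm (x i - x j) powr (s - 1)
          * R_plus \<rho> (laguerre_cell x zs i \<inter> laguerre_cell x zs j) * \<bar>h2 $ j - h2 $ i - h1 $ j + h1 $ i\<bar>)"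
      by (simp add: h v_def)
  qed
qed

end
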